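(* Let $0<\alpha<4$. The operator $$\mathcal L_\alpha:=P_4^{\mathbb S^4}-\kappa_\alpha\bigl(\mathcal R_\alpha+\mu_0(\alpha)I\bigr),$$ with domain $H^4(\mathbb S^4)$ in $L^2(\mathbb S^4)$, is self-adjoint with compact resolvent. For every $k\ge0$ the space $\mathcal H_k$ is an eigenspace of $\mathcal L_\alpha$, with eigenvalue $$\Lambda_k(\alpha)=k(k+1)(k+2)(k+3)-\kappa_\alpha\bigl(\mu_k(\alpha)+\mu_0(\alpha)\bigr).$$ More precisely, $\Lambda_0(\alpha)=-6(8-\alpha)$, $\Lambda_1(\alpha)=0$, and for every $k\ge2$ $$\Lambda_k(\alpha)\ge\frac45\,k(k+1)(k+2)(k+3)>0 .$$ Consequently the Morse index of $\mathcal L_\alpha$ is one and $\ker\mathcal L_\alpha=\mathcal H_1=\operatorname{span}\{\xi_1,\dots,\xi_5\}$. Moreover, for every $\Phi\in H^2(\mathbb S^4)$ with $\Phi\perp_{L^2}\mathcal H_0\oplus\mathcal H_1$, $$\langle\mathcal L_\alpha\Phi,\Phi\rangle_{L^2(\mathbb S^4)}\ge\frac45\langle P_4^{\mathbb S^4}\Phi,\Phi\rangle_{L^2(\mathbb S^4)} .$$ On the $L^2$-orthogonal complement of $\mathcal H_1$ the operator $\mathcal L_\alpha$ is invertible and $$\|\Phi\|_{H^4(\mathbb S^4)}\le C\|\mathcal L_\alpha\Phi\|_{L^2(\mathbb S^4)}\qquad\text{for }\Phi\in H^4(\mathbb S^4),\ \Phi\perp_{L^2}\mathcal H_1,$$ where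 $C$ is independent of $\alpha\in(0,4)$.
   Context: All functions are real-valued. $\mathbb S^4\subset\mathbb R^5$ is the unit round sphere with surface measure $d\xi$, coordinates $\xi=(\xi_1,\dots,\xi_5)$ and chordal distance $|\xi-\eta|$. $\mathcal H_k$ is the space of spherical harmonics of degree $k$ on $\mathbb S^4$. The Paneitz operator is $P_4^{\mathbb S^4}=(-\Delta_{\mathbb S^4})(-\Delta_{\mathbb S^4}+2)$. The spherical Riesz operator is $\mathcal R_\alpha\Phi(\xi)=\int_{\mathbb S^4}|\xi-\eta|^{-\alpha}\Phi(\eta)\,d\eta$, and $\mu_k(\alpha)$ is its (Funk--Hecke) eigenvalue on $\mathcal H_k$, i.e. $\mathcal R_\alpha Y=\mu_k(\alpha)Y$ for $Y\in\mathcal H_k$; explicitly $$\mu_k(\alpha)=2^{4-\alpha}\pi^2\frac{\Gamma(2-\frac\alpha2)\Gamma(k+\frac\alpha2)}{\Gamma(\frac\alpha2)\Gamma(k+4-\frac\alpha2)} .$$ The constants are $C_\alpha=\left(\frac{12(8-\alpha)(6-\alpha)(4-\alpha)}{\pi^2}\right)^{1/(8-\alpha)}$ and $\kappa_\alpha=C_\alpha^{8-\alpha}2^{-(8-\alpha)}$. For $\Phi\in H^2(\mathbb S^4)$ the pairings $\langle\mathcal L_\alpha\Phi,\Phi\rangle$ and $\langle P_4^{\mathbb S^4}\Phi,\Phi\rangle$ are understood as the associated quadratic forms. The Morse index is the total dimension of the eigenspaces with negative eigenvalue. *)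

theory Defs
  imports "HOL-Analysis.Analysis" "HOL-Library.Extended_Nat"
begin

section \<open>The sphere and its $L^2$ space\<close>

text \<open>
  Surface measure of the unit sphere, as the cone measure
  \<open>\<sigma>(A) = 5 \<cdot> vol {x. norm x < 1 \<and> x / norm x \<in> A}\<close>. It is a Borel measure on the ambient
  space that is concentrated on the sphere, so integrals over the sphere are integrals
  against it, and only the values of a function on the sphere matter.
\<close>

definition surf :: "(real^5) measure" where
  "surf = scale_measure 5 (distr (restrict_space lborel (ball 0 1)) borel (\<lambda>x. x /\<^sub>R norm x))"

definition square_integrable :: "(real^5 \<Rightarrow> real) \<Rightarrow> bool" where
  "square_integrable f \<longleftrightarrow> f \<in> borel_measurable surf \<and> integrable surf (\<lambda>x. (f x)\<^sup>2)"

definition l2_eq :: "(real^5 \<Rightarrow> real) \<Rightarrow> (real^5 \<Rightarrow> real) \<Rightarrow> bool" where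
  "l2_eq f g \<longleftrightarrow> square_integrable f \<and> square_integrable g \<and> (AE x in surf. f x = g x)"

lemma integrable_mult_square_integrable:
  assumes "square_integrable f" "square_integrable g"
  shows "integrable surf (\<lambda>x. f x * g x)"
proof (rule Bochner_Integration.integrable_bound)
  show "integrable surf (\<lambda>x. (f x)\<^sup>2 + (g x)\<^sup>2)"
    using assms by (auto simp: square_integrable_def)
  show "(\<lambda>x. f x * g x) \<in> borel_measurable surf"
    using assms by (auto simp: square_integrable_def)
  have "\<bar>a * b\<bar> \<le> a\<^sup>2 + b\<^sup>2" for a b :: real
  proof -
    have "2 * \<bar>a * b\<bar> \<le> a\<^sup>2 + b\<^sup>2"
      using sum_squares_bound[of "\<bar>a\<bar>" "\<bar>b\<bar>"] by (simp add: abs_mult mult.assoc)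
    then show ?thesis using abs_ge_zero[of "a * b"] by linarith
  qed
  then show "AE x in surf. norm (f x * g x) \<le> norm ((f x)\<^sup>2 + (g x)\<^sup>2)"
    by auto
qed

lemma square_integrable_zero: "square_integrable (\<lambda>x. 0)"
  by (simp add: square_integrable_def)

lemma square_integrable_scale: "square_integrable f \<Longrightarrow> square_integrable (\<lambda>x. c * f x)"
  by (auto simp: square_integrable_def power_mult_distrib)

lemma square_integrable_add:
  assumes "square_integrable f" "square_integrable g"
  shows "square_integrable (\<lambda>x. f x + g x)"
proof -
  have "integrable surf (\<lambda>x. (f x)\<^sup>2 + (g x)\<^sup>2 + 2 * (f x * g x))"
    using assms integrable_mult_square_integrable[OF assms]
    by (auto simp: square_integrable_def)
  then show ?thesis
    using assms by (auto simp: square_integrable_def power2_sum algebra_simps)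
qed

lemma square_integrable_minus: "square_integrable f \<Longrightarrow> square_integrable (\<lambda>x. - f x)"
  by (auto simp: square_integrable_def)

lemma square_integrable_diff:
  "square_integrable f \<Longrightarrow> square_integrable g \<Longrightarrow> square_integrable (\<lambda>x. f x - g x)"
  using square_integrable_add[OF _ square_integrable_minus, of f g] by simp

quotient_type l2_S4 = "real^5 \<Rightarrow> real" / partial: l2_eq
proof (rule part_equivpI)
  show "\<exists>f. l2_eq f f"
    using square_integrable_zero by (auto simp: l2_eq_def)
  show "symp l2_eq"
    by (auto simp: symp_def l2_eq_def)
  show "transp l2_eq"
    unfolding transp_def l2_eq_def
  proof (intro allI impI conjI; (elim conjE)?)
    fix f g h :: "real^5 \<Rightarrow> real"
    assume "AE x in surf. f x = g x" "AE x in surf. g x = h x"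
    then show "AE x in surf. f x = h x" by eventually_elim simp
  qed
qed

abbreviation class_of :: "(real^5 \<Rightarrow> real) \<Rightarrow> l2_S4" where
  "class_of \<equiv> abs_l2_S4"

instantiation l2_S4 :: real_inner
begin

lift_definition zero_l2_S4 :: l2_S4 is "\<lambda>x. 0"
  by (auto simp: l2_eq_def square_integrable_zero)

lift_definition plus_l2_S4 :: "l2_S4 \<Rightarrow> l2_S4 \<Rightarrow> l2_S4" is "\<lambda>f g x. f x + g x"
  by (auto simp: l2_eq_def square_integrable_add)

lift_definition minus_l2_S4 :: "l2_S4 \<Rightarrow> l2_S4 \<Rightarrow> l2_S4" is "\<lambda>f g x. f x - g x"
  by (auto simp: l2_eq_def square_integrable_diff)

lift_definition uminus_l2_S4 :: "l2_S4 \<Rightarrow> l2_S4" is "\<lambda>f x. - f x"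
  by (auto simp: l2_eq_def square_integrable_minus)

lift_definition scaleR_l2_S4 :: "real \<Rightarrow> l2_S4 \<Rightarrow> l2_S4" is "\<lambda>c f x. c * f x"
  by (auto simp: l2_eq_def square_integrable_scale)

lift_definition inner_l2_S4 :: "l2_S4 \<Rightarrow> l2_S4 \<Rightarrow> real" is "\<lambda>f g. \<integral>x. f x * g x \<partial>surf"
proof -
  fix f f' g g' :: "real^5 \<Rightarrow> real"
  assume a: "l2_eq f f'" "l2_eq g g'"
  have "AE x in surf. f x = f' x" "AE x in surf. g x = g' x"
    using a by (simp_all add: l2_eq_def)
  then have ae: "AE x in surf. f x * g x = f' x * g' x"
    by eventually_elim simp
  show "(\<integral>x. f x * g x \<partial>surf) = (\<integral>x. f' x * g' x \<partial>surf)"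
    by (rule integral_cong_AE) (use a ae in \<open>auto simp: l2_eq_def square_integrable_def\<close>)
qed

definition norm_l2_S4 :: "l2_S4 \<Rightarrow> real" where
  "norm_l2_S4 f = sqrt (inner f f)"

definition sgn_l2_S4 :: "l2_S4 \<Rightarrow> l2_S4" where
  "sgn_l2_S4 f = inverse (norm f) *\<^sub>R f"

definition dist_l2_S4 :: "l2_S4 \<Rightarrow> l2_S4 \<Rightarrow> real" where
  "dist_l2_S4 f g = norm (f - g)"

definition uniformity_l2_S4 :: "(l2_S4 \<times> l2_S4) filter" where
  "uniformity_l2_S4 = (INF e\<in>{0 <..}. principal {(x, y). dist x y < e})"

definition open_l2_S4 :: "l2_S4 set \<Rightarrow> bool" where
  "open_l2_S4 U \<longleftrightarrow> (\<forall>x\<in>U. eventually (\<lambda>(x', y). x' = x \<longrightarrow> y \<in> U) uniformity)"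

instance
proof
  fix f g h :: l2_S4 and a b :: real
  show "f + g + h = f + (g + h)"
    by transfer (simp add: l2_eq_def square_integrable_add add.assoc)
  show "f + g = g + f"
    by transfer (simp add: l2_eq_def square_integrable_add add.commute)
  show "0 + f = f"
    by transfer (simp add: l2_eq_def)
  show "- f + f = 0"
    by transfer (simp add: l2_eq_def square_integrable_zero)
  show "f - g = f + - g"
    by transfer (simp add: l2_eq_def square_integrable_diff)
  show "a *\<^sub>R (f + g) = a *\<^sub>R f + a *\<^sub>R g"
    by transfer (simp add: l2_eq_def square_integrable_add square_integrable_scale distrib_left)
  show "(a + b) *\<^sub>R f = a *\<^sub>R f + b *\<^sub>R f"
    by transfer (simp add: l2_eq_def square_integrable_add square_integrable_scale distrib_right)
  show "a *\<^sub>R b *\<^sub>R f = (a * b) *\<^sub>R f"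
    by transfer (simp add: l2_eq_def square_integrable_scale mult.assoc)
  show "1 *\<^sub>R f = f"
    by transfer (simp add: l2_eq_def)
  show "dist f g = norm (f - g)"
    by (fact dist_l2_S4_def)
  show "sgn f = inverse (norm f) *\<^sub>R f"
    by (fact sgn_l2_S4_def)
  show "uniformity = (INF e\<in>{0 <..}. principal {(x, y :: l2_S4). dist x y < e})"
    by (fact uniformity_l2_S4_def)
  fix U :: "l2_S4 set"
  show "open U = (\<forall>x\<in>U. \<forall>\<^sub>F (x', y) in uniformity. x' = x \<longrightarrow> y \<in> U)"
    by (fact open_l2_S4_def)
  show "inner f g = inner g f"
    by transfer (simp add: mult.commute)
  show "inner (f + g) h = inner f h + inner g h"
    by transfer (simp add: l2_eq_def integrable_mult_square_integrable distrib_right)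
  show "inner (a *\<^sub>R f) g = a * inner f g"
    by transfer (simp add: mult.assoc)
  show "0 \<le> inner f f"
    by transfer simp
  show "inner f f = 0 \<longleftrightarrow> f = 0"
  proof transfer
    fix f :: "real^5 \<Rightarrow> real"
    assume "l2_eq f f"
    then have f: "square_integrable f" by (simp add: l2_eq_def)
    have "(\<integral>x. f x * f x \<partial>surf) = 0 \<longleftrightarrow> (AE x in surf. f x * f x = 0)"
      by (rule integral_nonneg_eq_0_iff_AE)
        (auto intro: integrable_mult_square_integrable f)
    then show "(\<integral>x. f x * f x \<partial>surf) = 0 \<longleftrightarrow> l2_eq f (\<lambda>x. 0)"
      using f by (simp add: l2_eq_def square_integrable_zero)
  qed
  show "norm f = sqrt (inner f f)"
    by (fact norm_l2_S4_def)
qed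

end


section \<open>Differential calculus on the sphere\<close>

primrec Ck_on :: "nat \<Rightarrow> (real^5) set \<Rightarrow> (real^5 \<Rightarrow> real) \<Rightarrow> bool" where
  "Ck_on 0 S f \<longleftrightarrow> continuous_on S f"
| "Ck_on (Suc n) S f \<longleftrightarrow>
     (\<forall>x\<in>S. f differentiable (at x)) \<and> (\<forall>v. Ck_on n S (\<lambda>x. frechet_derivative f (at x) v))"

text \<open>
  Smooth functions on the sphere are represented by smooth functions on the punctured space
  (every smooth function on the sphere extends, e.g. homogeneously of degree 0).
\<close>

definition smooth :: "(real^5 \<Rightarrow> real) \<Rightarrow> bool" where
  "smooth f \<longleftrightarrow> (\<forall>n. Ck_on n (- {0}) f)"

definition euclidean_laplacian :: "(real^5 \<Rightarrow> real) \<Rightarrow> real^5 \<Rightarrow> real" where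
  "euclidean_laplacian f x =
     (\<Sum>b\<in>Basis. frechet_derivative (\<lambda>y. frechet_derivative f (at y) b) (at x) b)"

text \<open>
  Laplace--Beltrami operator on smooth functions: on the sphere it is the Euclidean Laplacian
  of the extension that is constant along rays.
\<close>

definition smooth_laplacian :: "(real^5 \<Rightarrow> real) \<Rightarrow> real^5 \<Rightarrow> real" where
  "smooth_laplacian f = euclidean_laplacian (\<lambda>x. f (x /\<^sub>R norm x))"

text \<open>
  The rotation fields \<open>x\<^sub>i \<partial>\<^sub>j - x\<^sub>j \<partial>\<^sub>i\<close> are tangent to the sphere and divergence free, and they
  span every tangent space. On the unit sphere the squares of the derivatives along the fields
  with \<open>i < j\<close> add up to the squared length of the tangential gradient.
\<close>

definition rot_deriv :: "5 \<Rightarrow> 5 \<Rightarrow> (real^5 \<Rightarrow> real) \<Rightarrow> real^5 \<Rightarrow> real" where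
  "rot_deriv i j f x = frechet_derivative f (at x) (x $ i *\<^sub>R axis j 1 - x $ j *\<^sub>R axis i 1)"

definition has_weak_rot_deriv :: "5 \<Rightarrow> 5 \<Rightarrow> l2_S4 \<Rightarrow> l2_S4 \<Rightarrow> bool" where
  "has_weak_rot_deriv i j \<Phi> \<Psi> \<longleftrightarrow>
     (\<forall>f. smooth f \<longrightarrow> inner \<Phi> (class_of (rot_deriv i j f)) = - inner \<Psi> (class_of f))"

definition weak_rot_deriv :: "5 \<Rightarrow> 5 \<Rightarrow> l2_S4 \<Rightarrow> l2_S4" where
  "weak_rot_deriv i j \<Phi> = (THE \<Psi>. has_weak_rot_deriv i j \<Phi> \<Psi>)"

text \<open>
  The Sobolev spaces \<open>H\<^sup>m\<close>: all iterated weak derivatives of order at most \<open>m\<close> along the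
  rotation fields are in \<open>L\<^sup>2\<close>; the squared norm is the sum of their squared \<open>L\<^sup>2\<close> norms.
\<close>

primrec sobolev :: "nat \<Rightarrow> l2_S4 set" where
  "sobolev 0 = UNIV"
| "sobolev (Suc m) = {\<Phi>. \<forall>i j. \<exists>\<Psi>\<in>sobolev m. has_weak_rot_deriv i j \<Phi> \<Psi>}"

primrec sobolev_norm_sq :: "nat \<Rightarrow> l2_S4 \<Rightarrow> real" where
  "sobolev_norm_sq 0 \<Phi> = (norm \<Phi>)\<^sup>2"
| "sobolev_norm_sq (Suc m) \<Phi> =
     (norm \<Phi>)\<^sup>2 + (\<Sum>(i, j)\<in>{(i, j). i < j}. sobolev_norm_sq m (weak_rot_deriv i j \<Phi>))"

definition sobolev_norm :: "nat \<Rightarrow> l2_S4 \<Rightarrow> real" where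
  "sobolev_norm m \<Phi> = sqrt (sobolev_norm_sq m \<Phi>)"

text \<open>The Laplace--Beltrami operator in the sense of distributions.\<close>

definition laplacian :: "l2_S4 \<Rightarrow> l2_S4" where
  "laplacian \<Phi> =
     (THE \<Psi>. \<forall>f. smooth f \<longrightarrow> inner \<Phi> (class_of (smooth_laplacian f)) = inner \<Psi> (class_of f))"

definition paneitz :: "l2_S4 \<Rightarrow> l2_S4" where
  "paneitz \<Phi> = - laplacian (- laplacian \<Phi> + 2 *\<^sub>R \<Phi>)"

text \<open>The quadratic form of the Paneitz operator, \<open>\<integral> (\<Delta>\<Phi>)\<^sup>2 + 2 |\<nabla>\<Phi>|\<^sup>2\<close>, on \<open>H\<^sup>2\<close>.\<close>

definition paneitz_form :: "l2_S4 \<Rightarrow> real" where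
  "paneitz_form \<Phi> =
     (norm (laplacian \<Phi>))\<^sup>2 + 2 * (\<Sum>(i, j)\<in>{(i, j). i < j}. (norm (weak_rot_deriv i j \<Phi>))\<^sup>2)"

definition harmonics :: "nat \<Rightarrow> l2_S4 set" where
  "harmonics k = {class_of p |p. real_polynomial_function p \<and>
     (\<forall>t x. p (t *\<^sub>R x) = t ^ k * p x) \<and> (\<forall>x. euclidean_laplacian p x = 0)}"


section \<open>The linearized operator\<close>

text \<open>The integral does not depend on the choice of the representative of \<open>\<Phi>\<close>.\<close>

definition riesz :: "real \<Rightarrow> l2_S4 \<Rightarrow> l2_S4" where
  "riesz \<alpha> \<Phi> = class_of (\<lambda>\<xi>. \<integral>\<eta>. dist \<xi> \<eta> powr (- \<alpha>) * rep_l2_S4 \<Phi> \<eta> \<partial>surf)"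

definition mu :: "real \<Rightarrow> nat \<Rightarrow> real" where
  "mu \<alpha> k = 2 powr (4 - \<alpha>) * pi\<^sup>2 *
     (Gamma (2 - \<alpha> / 2) * Gamma (real k + \<alpha> / 2)) /
     (Gamma (\<alpha> / 2) * Gamma (real k + 4 - \<alpha> / 2))"

definition C_const :: "real \<Rightarrow> real" where
  "C_const \<alpha> = (12 * (8 - \<alpha>) * (6 - \<alpha>) * (4 - \<alpha>) / pi\<^sup>2) powr (1 / (8 - \<alpha>))"

definition kappa :: "real \<Rightarrow> real" where
  "kappa \<alpha> = C_const \<alpha> powr (8 - \<alpha>) * 2 powr (- (8 - \<alpha>))"

definition L_op :: "real \<Rightarrow> l2_S4 \<Rightarrow> l2_S4" where
  "L_op \<alpha> \<Phi> = paneitz \<Phi> - kappa \<alpha> *\<^sub>R (riesz \<alpha> \<Phi> + mu \<alpha> 0 *\<^sub>R \<Phi>)"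

definition L_form :: "real \<Rightarrow> l2_S4 \<Rightarrow> real" where
  "L_form \<alpha> \<Phi> = paneitz_form \<Phi> - kappa \<alpha> * (inner (riesz \<alpha> \<Phi>) \<Phi> + mu \<alpha> 0 * inner \<Phi> \<Phi>)"

definition Lambda :: "real \<Rightarrow> nat \<Rightarrow> real" where
  "Lambda \<alpha> k = real (k * (k + 1) * (k + 2) * (k + 3)) - kappa \<alpha> * (mu \<alpha> k + mu \<alpha> 0)"


section \<open>Unbounded operators\<close>

text \<open>
  An unbounded operator on a real inner product space is given by a domain \<open>D\<close> and a function
  \<open>T\<close>, of which only the values on \<open>D\<close> matter.
\<close>

definition operator_graph :: "'a set \<Rightarrow> ('a \<Rightarrow> 'a) \<Rightarrow> ('a \<times> 'a) set" where
  "operator_graph D T = {(x, T x) |x. x \<in> D}"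

definition adjoint_graph :: "'a::real_inner set \<Rightarrow> ('a \<Rightarrow> 'a) \<Rightarrow> ('a \<times> 'a) set" where
  "adjoint_graph D T = {(x, y). \<forall>u\<in>D. inner (T u) x = inner u y}"

definition self_adjoint :: "'a::real_inner set \<Rightarrow> ('a \<Rightarrow> 'a) \<Rightarrow> bool" where
  "self_adjoint D T \<longleftrightarrow>
     subspace D \<and> closure D = UNIV \<and>
     (\<forall>x\<in>D. \<forall>y\<in>D. T (x + y) = T x + T y) \<and> (\<forall>c. \<forall>x\<in>D. T (c *\<^sub>R x) = c *\<^sub>R T x) \<and>
     adjoint_graph D T = operator_graph D T"

definition compact_resolvent :: "'a::real_normed_vector set \<Rightarrow> ('a \<Rightarrow> 'a) \<Rightarrow> bool" where
  "compact_resolvent D T \<longleftrightarrow>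
     (\<exists>l. bij_betw (\<lambda>x. T x - l *\<^sub>R x) D UNIV \<and>
          compact (closure (inv_into D (\<lambda>x. T x - l *\<^sub>R x) ` cball 0 1)))"

definition eigenspace :: "'a::real_vector set \<Rightarrow> ('a \<Rightarrow> 'a) \<Rightarrow> real \<Rightarrow> 'a set" where
  "eigenspace D T l = {x\<in>D. T x = l *\<^sub>R x}"

definition eigenvalue :: "'a::real_vector set \<Rightarrow> ('a \<Rightarrow> 'a) \<Rightarrow> real \<Rightarrow> bool" where
  "eigenvalue D T l \<longleftrightarrow> eigenspace D T l \<noteq> {0}"

definition operator_kernel :: "'a::real_vector set \<Rightarrow> ('a \<Rightarrow> 'a) \<Rightarrow> 'a set" where
  "operator_kernel D T = {x\<in>D. T x = 0}"

text \<open>The case distinction is needed since \<open>dim\<close> and \<open>sum\<close> default to 0 in infinite cases.\<close>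

definition morse_index :: "'a::real_vector set \<Rightarrow> ('a \<Rightarrow> 'a) \<Rightarrow> enat" where
  "morse_index D T =
     (let N = {l. l < 0 \<and> eigenvalue D T l} in
      if finite N \<and> (\<forall>l\<in>N. \<exists>B. finite B \<and> span B = eigenspace D T l)
      then enat (\<Sum>l\<in>N. dim (eigenspace D T l)) else \<infinity>)"

end

(* In L^2 of the sphere, every operator in the statement acts on the space of spherical
   harmonics of degree k by a scalar, so the theorem is a statement about the sequence
   Lambda alpha k. The Laplacian is the sum of the squares of the rotation derivatives D_ij with
   i < j, which are antisymmetric by rotation invariance of the surface measure; on harmonics of
   degree k it is -k (k + 3). This gives orthogonality, the weak derivatives, the Sobolev norms and
   the Paneitz operator degree by degree.

   The eigenvalues of the Riesz operator R are found without the Funk-Hecke formula. For the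
   conformal field X_i (the tangential part of the coordinate vector e_i) the kernel satisfies
   (X_i^xi + X_i^eta) |xi - eta|^(-alpha) = (alpha / 2) (xi_i + eta_i) |xi - eta|^(-alpha), and
   integration by parts turns this into an intertwining relation between R, X_i and the
   multiplication by xi_i. On a harmonic Y of degree k write xi_i Y = U + V with U, V harmonic of
   degrees k + 1 and k - 1; then X_i Y = (k + 3) V - k U, and the relation determines R U from R Y
   and R V. Since the U span the harmonics of degree k + 1, all eigenvalues follow from the one in
   degree 0, an integral over the sphere that reduces to the density 2 pi^2 (1 - t^2) of the height
   function. *)
theory Submission
  imports Defs
begin

section \<open>Orthogonal decompositions and diagonal operators\<close>

text \<open>Two obstacles shape the argument. One derivative of the Riesz kernel has a singularity
  of order |xi - eta|^(-alpha - 1), which is not integrable in dimension 4 when alpha >= 3. Only the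
  sum of its two conformal derivatives is as mild as the kernel itself, so both integrations by
  parts are done together on a regularised kernel, and the limit is taken after the bad terms have
  cancelled. Further, the operator is unbounded and acts on classes through distributional
  derivatives; it is therefore handled only through its components in the spaces of harmonics, and
  domains become weighted summability conditions. The relation yields (k + 4 - alpha/2) mu_(k+1) =
  (k + alpha/2) mu_k, so mu decreases and Lambda increases strictly, and each eigenspace is exactly
  one space of harmonics. The normalisation of kappa makes kappa (mu_1 + mu_0) = 24, the Paneitz
  eigenvalue in degree 1. For k >= 1 the subtracted term is at most 24, and for k >= 2 the Paneitz
  eigenvalue is at least 120, so at most a fifth of it is lost: this is the origin of 4/5.\<close>

locale orth_decomp =
  fixes H :: "nat \<Rightarrow> 'a::{real_inner, complete_space} set"
  assumes finite_span: "\<exists>B. finite B \<and> H k = span B"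
    and orth: "\<lbrakk>x \<in> H j; y \<in> H k; j \<noteq> k\<rbrakk> \<Longrightarrow> inner x y = 0"
    and total: "(\<And>k y. y \<in> H k \<Longrightarrow> inner x y = 0) \<Longrightarrow> x = 0"
begin

lemma subspace_H: "subspace (H k)"
  using finite_span[of k] by auto

lemma zero_H [simp]: "0 \<in> H k"
  by (rule subspace_0[OF subspace_H])

lemma proj_exists: "\<exists>y\<in>H k. \<forall>z\<in>H k. inner x z = inner y z"
proof -
  obtain B where "finite B" "H k = span B"
    using finite_span by blast
  then obtain C where C: "finite C" "H k = span C" "pairwise orthogonal C"
    using basis_orthogonal by metis
  \<comment> \<open>The orthogonal set \<open>C\<close> may contain 0; its coefficient is then 0 / 0
    = 0, so the Fourier sum is right nevertheless.\<close>
  define y where "y = (\<Sum>b\<in>C. (inner x b / inner b b) *\<^sub>R b)"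
  have "inner y c = inner x c" if c: "c \<in> C" for c
  proof -
    have "inner y c = (\<Sum>b\<in>C. (inner x b / inner b b) * inner b c)"
      by (simp add: y_def inner_sum_left)
    also have "\<dots> = (\<Sum>b\<in>C. if b = c then inner x c else 0)"
    proof (rule sum.cong)
      fix b assume "b \<in> C"
      then show "(inner x b / inner b b) * inner b c = (if b = c then inner x c else 0)"
        using C(3) c by (auto simp: pairwise_def orthogonal_def)
    qed simp
    also have "\<dots> = inner x c" using c C(1) by simp
    finally show ?thesis .
  qed
  then have "orthogonal (x - y) z" if "z \<in> span C" for z
    using that
    by (intro orthogonal_to_span[of z C]) (auto simp: orthogonal_def inner_diff_left)
  moreover have "y \<in> H k"
    unfolding C y_def by (intro span_sum span_scale span_base)
  ultimately show ?thesis
    using C by (auto simp: orthogonal_def inner_diff_left)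
qed

definition proj :: "nat \<Rightarrow> 'a \<Rightarrow> 'a" where
  "proj k x = (SOME y. y \<in> H k \<and> (\<forall>z\<in>H k. inner x z = inner y z))"

lemma proj_in [simp]: "proj k x \<in> H k"
  and inner_proj: "z \<in> H k \<Longrightarrow> inner (proj k x) z = inner x z"
proof -
  have "proj k x \<in> H k \<and> (\<forall>z\<in>H k. inner x z = inner (proj k x) z)"
    unfolding proj_def by (rule someI_ex) (use proj_exists in blast)
  then show "proj k x \<in> H k" "z \<in> H k \<Longrightarrow> inner (proj k x) z = inner x z"
    by auto
qed

text \<open>The difference of two candidates lies in \<open>H k\<close> and is orthogonal to
  \<open>H k\<close>. Nearly every formula for \<open>proj\<close> is obtained through this
  test.\<close>

lemma proj_eqI:
  assumes "y \<in> H k" "\<And>z. z \<in> H k \<Longrightarrow> inner x z = inner y z"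
  shows "proj k x = y"
proof -
  have "proj k x - y \<in> H k"
    by (intro subspace_diff subspace_H assms proj_in)
  then have "inner (proj k x - y) (proj k x - y) = 0"
    by (simp add: assms(2) inner_proj inner_diff_left)
  then show ?thesis by simp
qed

lemma proj_add: "proj k (x + y) = proj k x + proj k y"
  by (rule proj_eqI) (auto simp: inner_add_left inner_proj intro: subspace_add subspace_H)

lemma proj_scaleR: "proj k (c *\<^sub>R x) = c *\<^sub>R proj k x"
  by (rule proj_eqI) (auto simp: inner_proj intro: subspace_scale subspace_H)

lemma proj_zero [simp]: "proj k 0 = 0"
  by (rule proj_eqI) auto

lemma proj_minus: "proj k (- x) = - proj k x"
  using proj_scaleR[of k "-1" x] by simp

lemma proj_diff: "proj k (x - y) = proj k x - proj k y"
  using proj_add[of k x "- y"] by (simp add: proj_minus)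

lemma proj_id: "y \<in> H k \<Longrightarrow> proj k y = y"
  by (rule proj_eqI) auto

lemma proj_other: "y \<in> H j \<Longrightarrow> j \<noteq> k \<Longrightarrow> proj k y = 0"
  by (rule proj_eqI) (auto simp: orth)

lemma proj_sum: "finite F \<Longrightarrow> proj k (\<Sum>j\<in>F. f j) = (\<Sum>j\<in>F. proj k (f j))"
  by (induction F rule: finite_induct) (auto simp: proj_add)

lemma eq_if_proj_eq: "(\<And>k. proj k x = proj k y) \<Longrightarrow> x = y"
proof -
  assume eq: "\<And>k. proj k x = proj k y"
  have "x - y = 0"
  proof (rule total)
    fix k z assume "z \<in> H k"
    then show "inner (x - y) z = 0"
      using eq[of k] inner_proj[of z k x] inner_proj[of z k y] by (simp add: inner_diff_left)
  qed
  then show ?thesis by simp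
qed

lemma norm_sum_sq:
  assumes "finite F" "\<And>k. k \<in> F \<Longrightarrow> y k \<in> H k"
  shows "(norm (\<Sum>k\<in>F. y k))\<^sup>2 = (\<Sum>k\<in>F. (norm (y k))\<^sup>2)"
  using assms
  by (intro norm_sum_Pythagorean) (auto simp: pairwise_def orthogonal_def intro: orth)

lemma bessel: "finite F \<Longrightarrow> (\<Sum>k\<in>F. (norm (proj k x))\<^sup>2) \<le> (norm x)\<^sup>2"
proof -
  assume F: "finite F"
  define s where "s = (\<Sum>k\<in>F. proj k x)"
  have "inner x s = (\<Sum>k\<in>F. (norm (proj k x))\<^sup>2)"
    unfolding s_def inner_sum_right
    by (intro sum.cong) (auto simp: inner_proj[symmetric] power2_norm_eq_inner)
  moreover have "(norm s)\<^sup>2 = (\<Sum>k\<in>F. (norm (proj k x))\<^sup>2)"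
    unfolding s_def by (rule norm_sum_sq[OF F]) auto
  moreover have "0 \<le> (norm (x - s))\<^sup>2" by simp
  ultimately show ?thesis
    by (simp add: power2_norm_eq_inner inner_diff_left inner_diff_right inner_commute)
qed

lemma summable_proj: "summable (\<lambda>k. (norm (proj k x))\<^sup>2)"
  by (rule bounded_imp_summable[where B = "(norm x)\<^sup>2"]) (auto intro: bessel)

text \<open>By orthogonality the squared norm of a block of the series is the same block of the
  series of squares, so the partial sums are Cauchy; completeness of the space does the
  rest.\<close>

lemma summable_H:
  assumes y: "\<And>k. y k \<in> H k" and s: "summable (\<lambda>k. (norm (y k))\<^sup>2)"
  shows "summable y"
proof -
  have "Cauchy (\<lambda>n. \<Sum>k<n. y k)"
  proof (rule metric_CauchyI)
    fix e :: real assume e: "e > 0"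
    then obtain N where N: "\<And>m n. m \<ge> N \<Longrightarrow> norm (\<Sum>k\<in>{m..<n}. (norm (y k))\<^sup>2) < e\<^sup>2"
      using s[unfolded summable_Cauchy, rule_format, of "e\<^sup>2"] by auto
    have *: "dist (\<Sum>k<m. y k) (\<Sum>k<n. y k) < e" if "N \<le> m" "m \<le> n" for m n
    proof -
      have "(\<Sum>k<n. y k) - (\<Sum>k<m. y k) = (\<Sum>k\<in>{m..<n}. y k)"
        using that sum_diff_nat_ivl[of 0 m n y] by (simp add: atLeast0LessThan)
      then have "(dist (\<Sum>k<m. y k) (\<Sum>k<n. y k))\<^sup>2 = (norm (\<Sum>k\<in>{m..<n}. y k))\<^sup>2"
        by (metis dist_norm norm_minus_commute)
      also have "\<dots> = (\<Sum>k\<in>{m..<n}. (norm (y k))\<^sup>2)"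
        by (rule norm_sum_sq) (auto intro: y)
      also have "\<dots> < e\<^sup>2" using N[OF that(1), of n] by simp
      finally show ?thesis using e by (simp add: power_less_imp_less_base)
    qed
    show "\<exists>N. \<forall>m\<ge>N. \<forall>n\<ge>N. dist (\<Sum>k<m. y k) (\<Sum>k<n. y k) < e"
      using * by (metis dist_commute nle_le)
  qed
  then show ?thesis
    by (simp add: Cauchy_convergent_iff summable_iff_convergent)
qed

lemma inner_sums_right: "f sums x \<Longrightarrow> (\<lambda>k. inner y (f k)) sums inner y x"
  unfolding sums_def inner_sum_right[symmetric] by (intro tendsto_intros)

text \<open>The Riesz-Fischer property: every square summable choice of components is realised. Weak
  derivatives and preimages under an operator are produced by it.\<close>

lemma synthesis:
  assumes y: "\<And>k. y k \<in> H k" and s: "summable (\<lambda>k. (norm (y k))\<^sup>2)"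
  shows "\<exists>x. \<forall>k. proj k x = y k"
proof -
  obtain x where x: "y sums x"
    using summable_H[OF assms] by (auto simp: summable_def)
  have "proj k x = y k" for k
  proof (rule proj_eqI)
    fix z assume z: "z \<in> H k"
    have "(\<lambda>j. inner z (y j)) sums inner z x"
      by (rule inner_sums_right[OF x])
    moreover have "(\<lambda>j. inner z (y j)) sums inner z (y k)"
      using sums_finite[of "{k}" "\<lambda>j. inner z (y j)"] orth[OF z y] by simp
    ultimately show "inner x z = inner (y k) z"
      by (metis inner_commute sums_unique2)
  qed (rule y)
  then show ?thesis by blast
qed

text \<open>Bessel's inequality gives convergence to some \<open>x'\<close>; that limit has the same
  components as \<open>x\<close>, and totality excludes a difference.\<close>

lemma proj_sums: "(\<lambda>k. proj k x) sums x"
proof -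
  obtain x' where x': "(\<lambda>k. proj k x) sums x'"
    using summable_H[OF proj_in summable_proj] by (auto simp: summable_def)
  have "proj k x' = proj k x" for k
  proof (rule proj_eqI)
    fix z assume z: "z \<in> H k"
    have "(\<lambda>j. inner z (proj j x)) sums inner z x'"
      by (rule inner_sums_right[OF x'])
    moreover have "(\<lambda>j. inner z (proj j x)) sums inner z (proj k x)"
      using sums_finite[of "{k}" "\<lambda>j. inner z (proj j x)"] orth[OF z proj_in] by simp
    ultimately show "inner x' z = inner (proj k x) z"
      by (metis inner_commute sums_unique2)
  qed auto
  then show ?thesis using x' eq_if_proj_eq[of x' x] by simp
qed

lemma inner_sums: "(\<lambda>k. inner (proj k x) (proj k y)) sums inner x y"
  using inner_sums_right[OF proj_sums[of y], of x]
  by (simp add: inner_proj)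

lemma norm_sums: "(\<lambda>k. (norm (proj k x))\<^sup>2) sums (norm x)\<^sup>2"
  using inner_sums[of x x] by (simp add: power2_norm_eq_inner)

lemma orthogonal_comp_iff: "x \<in> orthogonal_comp (H k) \<longleftrightarrow> proj k x = 0"
proof
  assume "x \<in> orthogonal_comp (H k)"
  then show "proj k x = 0"
    by (intro proj_eqI) (auto simp: orthogonal_comp_def orthogonal_def inner_commute)
next
  assume "proj k x = 0"
  then show "x \<in> orthogonal_comp (H k)"
    using inner_proj[of _ k x] by (auto simp: orthogonal_comp_def orthogonal_def inner_commute)
qed

lemma mem_H_iff: "x \<in> H k \<longleftrightarrow> (\<forall>j. j \<noteq> k \<longrightarrow> proj j x = 0)"
proof
  assume *: "\<forall>j. j \<noteq> k \<longrightarrow> proj j x = 0"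
  have "x = proj k x"
    by (rule eq_if_proj_eq) (metis * proj_id proj_in proj_other)
  then show "x \<in> H k" by (metis proj_in)
qed (auto simp: proj_other)

text \<open>The maximal domain of the multiplier \<open>l\<close>: by orthogonality the series of
  \<open>l k *\<^sub>R proj k x\<close> converges in norm exactly for these
  \<open>x\<close>.\<close>

definition diag_dom :: "(nat \<Rightarrow> real) \<Rightarrow> 'a set" where
  "diag_dom l = {x. summable (\<lambda>k. (norm (l k *\<^sub>R proj k x))\<^sup>2)}"

lemma diag_domI: "(\<And>k. proj k y = l k *\<^sub>R proj k x) \<Longrightarrow> x \<in> diag_dom l"
  using summable_proj[of y] by (simp add: diag_dom_def)

lemma diag_dom_ex: "x \<in> diag_dom l \<longleftrightarrow> (\<exists>y. \<forall>k. proj k y = l k *\<^sub>R proj k x)"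
proof
  assume "x \<in> diag_dom l"
  then show "\<exists>y. \<forall>k. proj k y = l k *\<^sub>R proj k x"
    by (intro synthesis) (auto simp: diag_dom_def intro!: subspace_scale subspace_H)
qed (use diag_domI in blast)

text \<open>The summand 1 costs nothing, as the components of any element are square summable.
  Domains thus depend only on the growth of the multiplier, which later identifies the domain of the
  operator with a Sobolev space.\<close>

lemma diag_dom_mono:
  assumes "\<And>k. \<bar>l k\<bar> \<le> c * (\<bar>m k\<bar> + 1)"
  shows "diag_dom m \<subseteq> diag_dom l"
proof
  fix x assume "x \<in> diag_dom m"
  then have s: "summable (\<lambda>k. 2 * c\<^sup>2 * ((norm (m k *\<^sub>R proj k x))\<^sup>2 + (norm (proj k x))\<^sup>2))"
    by (intro summable_mult summable_add summable_proj) (simp add: diag_dom_def)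
  have "norm ((norm (l k *\<^sub>R proj k x))\<^sup>2) \<le> 2 * c\<^sup>2 * ((norm (m k *\<^sub>R proj k x))\<^sup>2 + (norm (proj k x))\<^sup>2)" for k
  proof -
    have "norm (l k *\<^sub>R proj k x) \<le> c * (norm (m k *\<^sub>R proj k x) + norm (proj k x))"
      using mult_right_mono[OF assms[of k] norm_ge_zero[of "proj k x"]] by (simp add: algebra_simps)
    then have "(norm (l k *\<^sub>R proj k x))\<^sup>2 \<le> (c * (norm (m k *\<^sub>R proj k x) + norm (proj k x)))\<^sup>2"
      by (intro power_mono) auto
    also have "\<dots> \<le> c\<^sup>2 * (2 * ((norm (m k *\<^sub>R proj k x))\<^sup>2 + (norm (proj k x))\<^sup>2))"
      unfolding power_mult_distrib
      using sum_squares_bound[of "norm (m k *\<^sub>R proj k x)" "norm (proj k x)"]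
      by (intro mult_left_mono) (auto simp: power2_sum)
    finally show ?thesis by (simp add: algebra_simps)
  qed
  then have "summable (\<lambda>k. (norm (l k *\<^sub>R proj k x))\<^sup>2)"
    by (rule summable_comparison_test'[OF s, of 0])
  then show "x \<in> diag_dom l" by (simp add: diag_dom_def)
qed

lemma H_subset_diag_dom: "H k \<subseteq> diag_dom l"
proof
  fix x assume x: "x \<in> H k"
  show "x \<in> diag_dom l"
  proof (rule diag_domI)
    fix j show "proj j (l k *\<^sub>R x) = l j *\<^sub>R proj j x"
      using x by (cases "j = k") (auto simp: proj_scaleR proj_other)
  qed
qed

lemma subspace_diag_dom: "subspace (diag_dom l)"
proof (rule subspaceI)
  show "0 \<in> diag_dom l" by (simp add: diag_dom_def)
next
  fix x y assume "x \<in> diag_dom l" "y \<in> diag_dom l"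
  then obtain u v where "\<forall>k. proj k u = l k *\<^sub>R proj k x" "\<forall>k. proj k v = l k *\<^sub>R proj k y"
    by (auto simp: diag_dom_ex)
  then have "\<forall>k. proj k (u + v) = l k *\<^sub>R proj k (x + y)"
    by (simp add: proj_add scaleR_add_right)
  then show "x + y \<in> diag_dom l" by (auto simp: diag_dom_ex)
next
  fix c x assume "x \<in> diag_dom l"
  then obtain u where "\<forall>k. proj k u = l k *\<^sub>R proj k x"
    by (auto simp: diag_dom_ex)
  then have "\<forall>k. proj k (c *\<^sub>R u) = l k *\<^sub>R proj k (c *\<^sub>R x)"
    by (simp add: proj_scaleR)
  then show "c *\<^sub>R x \<in> diag_dom l" by (auto simp: diag_dom_ex)
qed

text \<open>Finite partial sums of an expansion lie in every diagonal domain.\<close>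

lemma closure_diag_dom: "closure (diag_dom l) = UNIV"
proof -
  have "x \<in> closure (diag_dom l)" for x
  proof (rule closure_sequential[THEN iffD2], intro exI conjI allI)
    show "(\<lambda>n. \<Sum>k<n. proj k x) \<longlonglongrightarrow> x"
      using proj_sums by (simp add: sums_def)
    show "(\<Sum>k<n. proj k x) \<in> diag_dom l" for n
      by (intro subspace_sum subspace_diag_dom subsetD[OF H_subset_diag_dom[of k for k], OF proj_in])
  qed
  then show ?thesis by auto
qed

end

text \<open>Nothing is asked of \<open>T\<close> outside the domain: the distributional Laplacian is
  a definite description, unspecified where no class represents it.\<close>

locale diag_operator = orth_decomp H for H :: "nat \<Rightarrow> 'a::{real_inner, complete_space} set" +
  fixes l :: "nat \<Rightarrow> real" and T :: "'a \<Rightarrow> 'a"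
  assumes proj_T: "x \<in> diag_dom l \<Longrightarrow> proj k (T x) = l k *\<^sub>R proj k x"
begin

abbreviation "D \<equiv> diag_dom l"

text \<open>The graph of \<open>T\<close> consists of all pairs whose components are related by
  \<open>l\<close>, so that finding the value also settles membership in the domain.\<close>

lemma T_eqI: "(\<And>k. proj k y = l k *\<^sub>R proj k x) \<Longrightarrow> x \<in> D \<and> T x = y"
proof -
  assume *: "\<And>k. proj k y = l k *\<^sub>R proj k x"
  then have "x \<in> D" by (rule diag_domI)
  with * show ?thesis using eq_if_proj_eq[of "T x" y] by (simp add: proj_T)
qed

lemma T_add: "x \<in> D \<Longrightarrow> y \<in> D \<Longrightarrow> T (x + y) = T x + T y"
  using T_eqI[of "T x + T y" "x + y"] by (simp add: proj_add proj_T scaleR_add_right)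

lemma T_scaleR: "x \<in> D \<Longrightarrow> T (c *\<^sub>R x) = c *\<^sub>R T x"
  using T_eqI[of "c *\<^sub>R T x" "c *\<^sub>R x"] by (simp add: proj_scaleR proj_T)

lemma T_H: "x \<in> H k \<Longrightarrow> T x = l k *\<^sub>R x"
proof -
  assume x: "x \<in> H k"
  have "proj j (l k *\<^sub>R x) = l j *\<^sub>R proj j x" for j
    using x by (cases "j = k") (auto simp: proj_scaleR proj_other)
  then show ?thesis using T_eqI by blast
qed

text \<open>The adjoint relation, tested on \<open>u\<close> in a single \<open>H k\<close>, already
  forces the component equations, which by maximality of the domain put the pair into the graph. The
  converse inclusion is Parseval's identity.\<close>

lemma self_adjoint_T: "self_adjoint D T"
proof -
  have "adjoint_graph D T = operator_graph D T"
  proof (intro set_eqI iffI)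
    fix p assume "p \<in> adjoint_graph D T"
    then obtain x y where p: "p = (x, y)" and xy: "\<And>u. u \<in> D \<Longrightarrow> inner (T u) x = inner u y"
      by (auto simp: adjoint_graph_def)
    have "proj k y = l k *\<^sub>R proj k x" for k
    proof (rule proj_eqI)
      show "l k *\<^sub>R proj k x \<in> H k" by (intro subspace_scale subspace_H proj_in)
      fix z assume z: "z \<in> H k"
      then have "inner z y = l k * inner z x"
        using xy[of z] H_subset_diag_dom[of k l] T_H[OF z] by auto
      then show "inner y z = inner (l k *\<^sub>R proj k x) z"
        using inner_proj[OF z, of x] by (simp add: inner_commute)
    qed
    then have "x \<in> D \<and> T x = y" by (rule T_eqI)
    then show "p \<in> operator_graph D T" by (auto simp: p operator_graph_def)
  next
    fix p assume "p \<in> operator_graph D T"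
    then obtain x where p: "p = (x, T x)" and x: "x \<in> D"
      by (auto simp: operator_graph_def)
    have "inner (T u) x = inner u (T x)" if u: "u \<in> D" for u
      using inner_sums[of "T u" x] inner_sums[of u "T x"] u x
      by (simp add: proj_T sums_unique2)
    then show "p \<in> adjoint_graph D T" by (simp add: p adjoint_graph_def)
  qed
  then show ?thesis
    by (simp add: self_adjoint_def subspace_diag_dom closure_diag_dom T_add T_scaleR)
qed

text \<open>Comparing components, \<open>(l j - l k) *\<^sub>R proj j x = 0\<close>; since
  \<open>l\<close> is injective, only the component \<open>k\<close> survives.\<close>

lemma eigenspace_T:
  assumes "inj l" shows "eigenspace D T (l k) = H k"
proof (intro set_eqI iffI)
  fix x assume "x \<in> eigenspace D T (l k)"
  then have x: "x \<in> D" "T x = l k *\<^sub>R x" by (auto simp: eigenspace_def)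
  have "l j *\<^sub>R proj j x = l k *\<^sub>R proj j x" for j
    using proj_T[OF x(1), of j] unfolding x(2) proj_scaleR by (rule sym)
  then show "x \<in> H k"
    using assms unfolding mem_H_iff by (metis injD scaleR_cancel_right)
next
  fix x assume "x \<in> H k"
  then show "x \<in> eigenspace D T (l k)"
    using H_subset_diag_dom T_H by (auto simp: eigenspace_def)
qed

lemma eigenvalue_T: "eigenvalue D T c \<Longrightarrow> c \<in> range l"
proof (rule ccontr)
  assume "eigenvalue D T c" and c: "c \<notin> range l"
  \<comment> \<open>\<open>eigenvalue\<close> says only that the eigenspace differs from {0}; the
    empty set has to be excluded before a nonzero element can be chosen.\<close>
  moreover have "0 \<in> eigenspace D T c"
    using subspace_0[OF subspace_diag_dom] T_scaleR[of 0 0] by (auto simp: eigenspace_def)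
  ultimately obtain x where x: "x \<in> D" "T x = c *\<^sub>R x" "x \<noteq> 0"
    by (auto simp: eigenvalue_def eigenspace_def)
  have "proj j x = 0" for j
    using proj_T[OF x(1), of j] x(2) c by (auto simp: proj_scaleR)
  then have "x = 0" by (intro total) (simp add: inner_proj[symmetric])
  with x show False by simp
qed

text \<open>Off \<open>Z\<close> the multiplier stays away from 0 and has a bounded inverse; on
  \<open>Z\<close> both sides have no component. With \<open>Z\<close> empty this gives a resolvent,
  with \<open>Z\<close> = {1} the inverse off the kernel.\<close>

lemma bij_betw_T:
  assumes z: "\<And>k. k \<notin> Z \<Longrightarrow> \<delta> \<le> \<bar>l k\<bar>" "\<delta> > 0"
  shows "bij_betw T {x \<in> D. \<forall>k\<in>Z. proj k x = 0} {x. \<forall>k\<in>Z. proj k x = 0}"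
  unfolding bij_betw_def
proof
  show "inj_on T {x \<in> D. \<forall>k\<in>Z. proj k x = 0}"
  proof (rule inj_onI)
    fix x y assume xy: "x \<in> {x \<in> D. \<forall>k\<in>Z. proj k x = 0}" "y \<in> {x \<in> D. \<forall>k\<in>Z. proj k x = 0}" "T x = T y"
    show "x = y"
    proof (rule eq_if_proj_eq)
      fix k show "proj k x = proj k y"
      proof (cases "k \<in> Z")
        case False
        then have "l k \<noteq> 0" using z(1)[of k] z(2) by auto
        with xy show ?thesis using proj_T[of x k] proj_T[of y k] by auto
      qed (use xy in auto)
    qed
  qed
  show "T ` {x \<in> D. \<forall>k\<in>Z. proj k x = 0} = {x. \<forall>k\<in>Z. proj k x = 0}"
  proof (intro set_eqI iffI)
    fix y assume y: "y \<in> {x. \<forall>k\<in>Z. proj k x = 0}"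
    have "\<bar>if k \<in> Z then 0 else 1 / l k\<bar> \<le> 1 / \<delta> * (\<bar>1\<bar> + 1)" for k
    proof (cases "k \<in> Z")
      case False
      with z(2) z(1)[OF this] have "1 / \<bar>l k\<bar> \<le> 1 / \<delta>"
        by (intro divide_left_mono mult_pos_pos) auto
      moreover have "0 \<le> 1 / \<delta>" using z(2) by simp
      ultimately have "1 / \<bar>l k\<bar> \<le> 1 / \<delta> + 1 / \<delta>" by linarith
      then show ?thesis using False by (simp add: abs_divide)
    qed (use z(2) in auto)
    then have "y \<in> diag_dom (\<lambda>k. if k \<in> Z then 0 else 1 / l k)"
      by (rule subsetD[OF diag_dom_mono[of _ "1 / \<delta>" "\<lambda>_. 1"]])
        (simp add: diag_dom_def summable_proj)
    then obtain x where x: "\<And>k. proj k x = (if k \<in> Z then 0 else 1 / l k) *\<^sub>R proj k y"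
      unfolding diag_dom_ex by blast
    have "x \<in> D \<and> T x = y"
    proof (rule T_eqI)
      fix k show "proj k y = l k *\<^sub>R proj k x"
      proof (cases "k \<in> Z")
        case False
        then have "l k \<noteq> 0" using z(1)[of k] z(2) by auto
        then show ?thesis using False by (simp add: x)
      qed (use x y in auto)
    qed
    then show "y \<in> T ` {x \<in> D. \<forall>k\<in>Z. proj k x = 0}" using x by force
  qed (auto simp: proj_T)
qed

end

section \<open>Compactness from multipliers that tend to zero\<close>

lemma compact_span_box:
  fixes B :: "'a::real_normed_vector set"
  assumes "finite B"
  shows "compact {\<Sum>b\<in>B. c b *\<^sub>R b |c. \<forall>b\<in>B. \<bar>c b\<bar> \<le> r}"
  using assms
\<comment> \<open>The ambient space has no Heine-Borel property, so the box is built as a sum of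
  compact segments, one vector at a time.\<close>
proof (induction B rule: finite_induct)
  case (insert a B)
  have "{\<Sum>b\<in>insert a B. c b *\<^sub>R b |c. \<forall>b\<in>insert a B. \<bar>c b\<bar> \<le> r} =
    {x + y |x y. x \<in> (\<lambda>t. t *\<^sub>R a) ` {- r..r} \<and> y \<in> {\<Sum>b\<in>B. c b *\<^sub>R b |c. \<forall>b\<in>B. \<bar>c b\<bar> \<le> r}}"
  proof (intro set_eqI iffI)
    fix z assume "z \<in> {\<Sum>b\<in>insert a B. c b *\<^sub>R b |c. \<forall>b\<in>insert a B. \<bar>c b\<bar> \<le> r}"
    then obtain c where "z = c a *\<^sub>R a + (\<Sum>b\<in>B. c b *\<^sub>R b)" "\<forall>b\<in>insert a B. \<bar>c b\<bar> \<le> r"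
      using insert by auto
    moreover from this(2) have "c a \<in> {-r..r}" by auto
    ultimately show "z \<in> {x + y |x y. x \<in> (\<lambda>t. t *\<^sub>R a) ` {- r..r} \<and> y \<in> {\<Sum>b\<in>B. c b *\<^sub>R b |c. \<forall>b\<in>B. \<bar>c b\<bar> \<le> r}}"
      by blast
  next
    fix z assume "z \<in> {x + y |x y. x \<in> (\<lambda>t. t *\<^sub>R a) ` {- r..r} \<and> y \<in> {\<Sum>b\<in>B. c b *\<^sub>R b |c. \<forall>b\<in>B. \<bar>c b\<bar> \<le> r}}"
    then obtain t c where z: "z = t *\<^sub>R a + (\<Sum>b\<in>B. c b *\<^sub>R b)" "t \<in> {-r..r}" "\<forall>b\<in>B. \<bar>c b\<bar> \<le> r"
      by auto
    then show "z \<in> {\<Sum>b\<in>insert a B. c b *\<^sub>R b |c. \<forall>b\<in>insert a B. \<bar>c b\<bar> \<le> r}"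
      using insert by (intro CollectI exI[of _ "c(a := t)"]) (auto intro!: sum.cong)
  qed
  then show ?case
    using insert by (simp only:) (intro compact_sums compact_continuous_image continuous_intros; simp)
qed simp

context orth_decomp
begin

lemma finite_rank_ball_compact:
  "\<exists>K. compact K \<and> (\<forall>x. norm x \<le> r \<longrightarrow> proj k x \<in> K)"
proof -
  obtain B where "finite B" "H k = span B"
    using finite_span by blast
  then obtain C where C: "finite C" "H k = span C" "pairwise orthogonal C"
    using basis_orthogonal by metis
  \<comment> \<open>Without 0, every coefficient has the Cauchy-Schwarz bound
    \<open>r / norm b\<close>, uniformly on the ball of radius \<open>r\<close>.\<close>
  define C' where "C' = C - {0}"
  define m where "m = Max (insert 0 ((\<lambda>b. r / norm b) ` C'))"
  have C': "finite C'" "H k = span C'" "pairwise orthogonal C'"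
    using C by (auto simp: C'_def span_delete_0 pairwise_def)
  have "proj k x \<in> {\<Sum>b\<in>C'. c b *\<^sub>R b |c. \<forall>b\<in>C'. \<bar>c b\<bar> \<le> m}" if "norm x \<le> r" for x
  proof -
    define c where "c b = inner x b / inner b b" for b
    have "proj k x = (\<Sum>b\<in>C'. c b *\<^sub>R b)"
    proof (rule proj_eqI)
      show in_H: "(\<Sum>b\<in>C'. c b *\<^sub>R b) \<in> H k"
        unfolding C' by (intro span_sum span_scale span_base)
      have "orthogonal (x - (\<Sum>b\<in>C'. c b *\<^sub>R b)) z" if "z \<in> span C'" for z
      proof (rule orthogonal_to_span[OF that])
        fix d assume d: "d \<in> C'"
        have "(\<Sum>b\<in>C'. c b * inner b d) = (\<Sum>b\<in>C'. if b = d then inner x d else 0)"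
        proof (rule sum.cong)
          fix b assume "b \<in> C'"
          then show "c b * inner b d = (if b = d then inner x d else 0)"
            using C'(3) d by (auto simp: pairwise_def orthogonal_def c_def C'_def)
        qed simp
        then show "orthogonal (x - (\<Sum>b\<in>C'. c b *\<^sub>R b)) d"
          using d C'(1) by (simp add: orthogonal_def inner_diff_left inner_sum_left)
      qed
      then show "inner x z = inner (\<Sum>b\<in>C'. c b *\<^sub>R b) z" if "z \<in> H k" for z
        using that C' by (auto simp: orthogonal_def inner_diff_left)
    qed
    moreover have "\<bar>c b\<bar> \<le> m" if b: "b \<in> C'" for b
    proof -
      have "\<bar>inner x b\<bar> \<le> r * norm b"
        using Cauchy_Schwarz_ineq2[of x b] mult_right_mono[OF \<open>norm x \<le> r\<close> norm_ge_zero[of b]] by linarith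
      then have "\<bar>c b\<bar> \<le> r * norm b / (norm b)\<^sup>2"
        by (simp add: c_def power2_norm_eq_inner divide_right_mono)
      also have "\<dots> = r / norm b"
        using b by (simp add: C'_def power2_eq_square)
      also have "\<dots> \<le> m"
        using b C'(1) by (auto simp: m_def intro!: Max_ge)
      finally show ?thesis .
    qed
    ultimately show ?thesis by blast
  qed
  then show ?thesis using compact_span_box[OF C'(1)] by blast
qed

lemma finite_ranks_ball_compact:
  "\<exists>K. compact K \<and> (\<forall>x. norm x \<le> r \<longrightarrow> (\<Sum>k<n. proj k x) \<in> K)"
proof (induction n)
  case (Suc n)
  then obtain K where K: "compact K" "\<And>x. norm x \<le> r \<Longrightarrow> (\<Sum>k<n. proj k x) \<in> K" by blast
  obtain K' where K': "compact K'" "\<And>x. norm x \<le> r \<Longrightarrow> proj n x \<in> K'"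
    using finite_rank_ball_compact by blast
  show ?case
    using K K' by (intro exI[of _ "{x + y |x y. x \<in> K \<and> y \<in> K'}"]) (auto intro: compact_sums)
qed (auto intro!: exI[of _ "{0}"])

text \<open>Parseval turns a bound on the components from \<open>n\<close> on into a bound on the
  tail. With \<open>n = 0\<close> it is an operator norm estimate.\<close>

lemma tail_norm:
  assumes "\<And>k. k \<ge> n \<Longrightarrow> norm (proj k x) \<le> e * norm (proj k y)" "e \<ge> 0"
  shows "norm (x - (\<Sum>k<n. proj k x)) \<le> e * norm y"
proof -
  define z where "z = x - (\<Sum>k<n. proj k x)"
  have z: "proj k z = (if k < n then 0 else proj k x)" for k
  proof -
    have "(\<Sum>j<n. proj k (proj j x)) = (\<Sum>j<n. if j = k then proj k x else 0)"
      by (intro sum.cong) (auto simp: proj_id intro: proj_other[OF proj_in])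
    then show ?thesis by (simp add: z_def proj_diff proj_sum)
  qed
  have "(norm (proj k z))\<^sup>2 \<le> e\<^sup>2 * (norm (proj k y))\<^sup>2" for k
  proof -
    have "norm (proj k z) \<le> e * norm (proj k y)"
      using assms(1)[of k] assms(2) by (auto simp: z)
    then have "(norm (proj k z))\<^sup>2 \<le> (e * norm (proj k y))\<^sup>2"
      by (intro power_mono) auto
    then show ?thesis by (simp add: power_mult_distrib)
  qed
  then have "(norm z)\<^sup>2 \<le> e\<^sup>2 * (norm y)\<^sup>2"
    by (rule sums_le) (auto intro: norm_sums sums_mult)
  then have "(norm z)\<^sup>2 \<le> (e * norm y)\<^sup>2" by (simp add: power_mult_distrib)
  then show ?thesis
    using assms(2) by (simp add: z_def abs_le_square_iff[symmetric])
qed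

text \<open>A diagonal operator with \<open>c\<close> tending to 0 is a norm limit of operators of
  finite rank. From some \<open>n\<close> on the multiplier is below e/3, so up to an error e/3 the
  set lies in a compact set that contains the first \<open>n\<close> components of a whole
  ball.\<close>

lemma compact_closure_diag:
  assumes c: "c \<longlonglongrightarrow> 0" and S: "\<And>x. x \<in> S \<Longrightarrow> \<exists>y. norm y \<le> 1 \<and> (\<forall>k. proj k x = c k *\<^sub>R proj k y)"
  shows "compact (closure S)"
proof -
  obtain M where M: "\<And>k. \<bar>c k\<bar> \<le> M"
    using c Bseq_def[of c] convergent_imp_Bseq[of c] by (auto simp: convergent_def)
  have M0: "M \<ge> 0" using M[of 0] by linarith
  have tot_bdd: "\<exists>F. finite F \<and> S \<subseteq> (\<Union>x\<in>F. ball x e)" if e: "e > 0" for e :: real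
  proof -
    obtain n where n: "\<And>k. k \<ge> n \<Longrightarrow> \<bar>c k\<bar> < e / 3"
      using LIMSEQ_D[OF c, of "e / 3"] e by auto
    obtain K where K: "compact K" "\<And>x. norm x \<le> M \<Longrightarrow> (\<Sum>k<n. proj k x) \<in> K"
      using finite_ranks_ball_compact by blast
    then obtain F where F: "finite F" "K \<subseteq> (\<Union>x\<in>F. ball x (e / 3))"
      using e compact_eq_totally_bounded[of K] by (metis divide_pos_pos zero_less_numeral)
    have "x \<in> (\<Union>x\<in>F. ball x e)" if x: "x \<in> S" for x
    proof -
      obtain y where y: "norm y \<le> 1" "\<And>k. proj k x = c k *\<^sub>R proj k y"
        using S[OF x] by blast
      have "norm (proj k x) \<le> e / 3 * norm (proj k y)" if "k \<ge> n" for k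
        using mult_right_mono[OF less_imp_le[OF n[OF that]] norm_ge_zero[of "proj k y"]] by (simp add: y)
      then have "norm (x - (\<Sum>k<n. proj k x)) \<le> e / 3 * norm y"
        using e by (intro tail_norm) auto
      also have "\<dots> \<le> e / 3" using y e by simp
      finally have 1: "norm (x - (\<Sum>k<n. proj k x)) \<le> e / 3" .
      have "norm x \<le> M * norm y"
        using tail_norm[of 0 x M y] M M0 by (simp add: y mult_right_mono)
      also have "\<dots> \<le> M" using M0 y mult_left_le by blast
      finally have "(\<Sum>k<n. proj k x) \<in> K" by (rule K)
      then obtain f where f: "f \<in> F" "dist f (\<Sum>k<n. proj k x) < e / 3"
        using F by auto
      have "dist f x \<le> dist f (\<Sum>k<n. proj k x) + dist (\<Sum>k<n. proj k x) x"
        by (rule dist_triangle)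
      also have "\<dots> < e" using f 1 e by (simp add: dist_norm norm_minus_commute)
      finally show ?thesis using f by auto
    qed
    with F show ?thesis by blast
  qed
  show ?thesis
    unfolding compact_eq_totally_bounded
  proof (intro conjI allI impI)
    show "complete (closure S)" by (simp add: complete_eq_closed)
    fix e :: real assume e: "e > 0"
    then obtain F where F: "finite F" "S \<subseteq> (\<Union>x\<in>F. ball x (e / 2))"
      using tot_bdd[of "e / 2"] by auto
    have "closure S \<subseteq> (\<Union>x\<in>F. cball x (e / 2))"
      using F by (intro closure_minimal closed_UN order_trans[OF F(2)] UN_mono) auto
    also have "\<dots> \<subseteq> (\<Union>x\<in>F. ball x e)" using e by force
    finally show "\<exists>k. finite k \<and> closure S \<subseteq> (\<Union>x\<in>k. ball x e)" using F(1) by blast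
  qed
qed

end

context diag_operator
begin

text \<open>Shifting by \<open>a - 1\<close>, below the spectrum, makes the multiplier at least 1;
  the inverse then exists on the whole space and has the multiplier \<open>inverse (m k)\<close>,
  which tends to 0.\<close>

lemma compact_resolvent_T:
  assumes lim: "filterlim l at_top sequentially" and lb: "\<And>k. l k \<ge> a"
  shows "compact_resolvent D T"
proof -
  define m where "m = (\<lambda>k. l k - (a - 1))"
  have m1: "m k \<ge> 1" for k using lb[of k] by (simp add: m_def)
  have D: "diag_dom m = D"
  proof (intro set_eqI)
    fix x show "x \<in> diag_dom m \<longleftrightarrow> x \<in> D"
    proof
      assume "x \<in> diag_dom m"
      then obtain u where u: "\<And>k. proj k u = m k *\<^sub>R proj k x" by (auto simp: diag_dom_ex)
      show "x \<in> D"
        by (rule diag_domI[of "u + (a - 1) *\<^sub>R x"])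
          (simp add: u proj_add proj_diff proj_scaleR m_def scaleR_diff_left)
    next
      assume "x \<in> D"
      then obtain u where u: "\<And>k. proj k u = l k *\<^sub>R proj k x" by (auto simp: diag_dom_ex)
      show "x \<in> diag_dom m"
        by (rule diag_domI[of "u - (a - 1) *\<^sub>R x"])
          (simp add: u proj_diff proj_scaleR m_def scaleR_diff_left)
    qed
  qed
  interpret R: diag_operator H m "\<lambda>x. T x - (a - 1) *\<^sub>R x"
  proof unfold_locales
    fix x k assume "x \<in> diag_dom m"
    then have "x \<in> D" by (simp add: D)
    then show "proj k (T x - (a - 1) *\<^sub>R x) = m k *\<^sub>R proj k x"
      by (simp only: proj_diff proj_T proj_scaleR m_def scaleR_diff_left)
  qed
  have bij: "bij_betw (\<lambda>x. T x - (a - 1) *\<^sub>R x) D UNIV"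
    using R.bij_betw_T[of "{}" 1] order_trans[OF m1 abs_ge_self] by (simp add: D)
  define S where "S = inv_into D (\<lambda>x. T x - (a - 1) *\<^sub>R x)"
  have "compact (closure (S ` cball 0 1))"
  proof (rule compact_closure_diag)
    have "filterlim m at_top sequentially"
      unfolding m_def diff_conv_add_uminus
      by (subst add.commute, intro filterlim_tendsto_add_at_top[OF tendsto_const] lim)
    then show "(\<lambda>k. inverse (m k)) \<longlonglongrightarrow> 0"
      by (rule tendsto_inverse_0_at_top)
    fix x assume "x \<in> S ` cball 0 1"
    then obtain y where y: "norm y \<le> 1" "x = S y" by auto
    have "x \<in> D" "T x - (a - 1) *\<^sub>R x = y"
      using bij bij_betw_inv_into_right[OF bij, of y] inv_into_into[of y "\<lambda>x. T x - (a - 1) *\<^sub>R x" D]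
      unfolding y S_def bij_betw_def by auto
    then have "proj k y = m k *\<^sub>R proj k x" for k
      using R.proj_T[of x k] D by simp
    then show "\<exists>y. norm y \<le> 1 \<and> (\<forall>k. proj k x = inverse (m k) *\<^sub>R proj k y)"
      using y m1[THEN less_le_trans[OF zero_less_one], THEN less_imp_neq] by (intro exI[of _ y]) (simp add: eq_commute[of 0])
  qed
  then show ?thesis
    using bij unfolding compact_resolvent_def S_def by blast
qed

end

section \<open>Surface measure\<close>

lemma measurable_normalize [measurable]: "(\<lambda>x::real^5. x /\<^sub>R norm x) \<in> borel_measurable borel"
  by measurable

lemma sets_surf [measurable_cong, simp]: "sets surf = sets borel"
  and space_surf [simp]: "space surf = UNIV"
  by (simp_all add: surf_def space_scale_measure)

lemma nn_integral_surf:
  assumes [measurable]: "f \<in> borel_measurable borel"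
  shows "(\<integral>\<^sup>+x. f x \<partial>surf) = 5 * (\<integral>\<^sup>+x. f (x /\<^sub>R norm x) * indicator (ball 0 1) x \<partial>lborel)"
  unfolding surf_def
  by (subst nn_integral_scale_measure)
    (auto simp: nn_integral_distr nn_integral_restrict_space measurable_restrict_space1)

lemma emeasure_surf_UNIV: "emeasure surf UNIV = ennreal (8 * pi\<^sup>2 / 3)"
proof -
  have "emeasure surf UNIV = 5 * emeasure lborel (ball (0::real^5) 1)"
    using nn_integral_surf[of "\<lambda>_. 1"] by simp
  also have "\<dots> = 5 * ennreal (unit_ball_vol 5)"
    using emeasure_ball[of 1 "0::real^5"] by simp
  also have "\<dots> = ennreal (5 * unit_ball_vol 5)"
    by (simp add: ennreal_mult'')
  also have "5 * unit_ball_vol 5 = 8 * pi\<^sup>2 / 3"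
    by (simp add: eval_unit_ball_vol)
  finally show ?thesis .
qed

lemma finite_measure_surf: "finite_measure surf"
  by (rule finite_measureI) (simp add: emeasure_surf_UNIV)

interpretation surf: finite_measure surf
  by (rule finite_measure_surf)

lemma measure_surf_UNIV: "measure surf UNIV = 8 * pi\<^sup>2 / 3"
  by (simp add: measure_def emeasure_surf_UNIV)

lemma AE_surf_iff:
  assumes [measurable]: "Measurable.pred borel P"
  shows "(AE x in surf. P x) \<longleftrightarrow> (AE x in lborel. x \<in> ball 0 1 \<longrightarrow> P (x /\<^sub>R norm x))"
proof -
  have "(AE x in surf. P x) \<longleftrightarrow> (\<integral>\<^sup>+x. indicator {x. \<not> P x} x \<partial>surf) = 0"
    by (subst nn_integral_0_iff_AE) (auto simp: indicator_def)
  also have "\<dots> \<longleftrightarrow> (\<integral>\<^sup>+x. indicator {x. \<not> P x} (x /\<^sub>R norm x) * indicator (ball 0 1) x \<partial>lborel) = 0"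
    by (subst nn_integral_surf) auto
  also have "\<dots> \<longleftrightarrow> (AE x in lborel. x \<in> ball 0 1 \<longrightarrow> P (x /\<^sub>R norm x))"
    by (subst nn_integral_0_iff_AE) (auto simp: indicator_def)
  finally show ?thesis .
qed

lemma AE_surf_norm: "AE x in surf. norm x = 1"
proof (subst AE_surf_iff)
  show "AE x::real^5 in lborel. x \<in> ball 0 1 \<longrightarrow> norm (x /\<^sub>R norm x) = 1"
    using AE_lborel_singleton[of "0::real^5"] by eventually_elim simp
qed measurable

lemma AE_surf_nonzero: "AE x in surf. x \<noteq> 0"
  using AE_surf_norm by eventually_elim auto

lemma AE_surf_sphereI: "(\<And>x. norm x = 1 \<Longrightarrow> P x) \<Longrightarrow> AE x in surf. P x"
  using AE_surf_norm by eventually_elim auto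

text \<open>Points of the ball that normalise to \<open>\<xi>\<close> lie on one line, a Lebesgue
  null set. This is why the value of a kernel on the diagonal does not matter.\<close>

lemma AE_surf_neq: "AE x in surf. x \<noteq> \<xi>"
proof (subst AE_surf_iff)
  have "negligible (span {\<xi>})"
  proof (rule negligible_lowdim)
    show "dim (span {\<xi>}) < DIM(real^5)"
      using dim_le_card'[of "{\<xi>}"] by (simp add: dim_span)
  qed
  then have "AE x in lebesgue. x \<notin> span {\<xi>}"
    by (simp add: negligible_iff_null_sets AE_not_in)
  then have "AE x in lborel. x \<notin> span {\<xi>}"
    by (subst (asm) AE_completion_iff) (auto)
  then show "AE x in lborel. x \<in> ball 0 1 \<longrightarrow> x /\<^sub>R norm x \<noteq> \<xi>"
  proof eventually_elim
    case (elim x)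
    show ?case
    proof (intro impI notI)
      assume "x /\<^sub>R norm x = \<xi>"
      then have "x = norm x *\<^sub>R \<xi>" by (cases "x = 0") auto
      then show False using elim by (metis insertI1 span_base span_scale)
    qed
  qed
qed measurable

section \<open>Rotation invariance\<close>

lemma distr_lborel_orthogonal:
  fixes T :: "real^5 \<Rightarrow> real^5"
  assumes T: "orthogonal_transformation T"
  shows "distr lborel borel T = lborel"
\<comment> \<open>Lebesgue measure is determined by its values on boxes, and the preimage of a box
  is its image under the inverse isometry, which preserves volume.\<close>
proof (rule lborel_eqI[symmetric])
  have lin: "linear T" using T by (rule orthogonal_transformation_linear)
  have [measurable]: "T \<in> borel_measurable borel"
    using lin by (intro borel_measurable_continuous_onI linear_continuous_on) (simp add: linear_conv_bounded_linear)
  fix l u :: "real^5"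
  assume lu: "\<And>b. b \<in> Basis \<Longrightarrow> l \<bullet> b \<le> u \<bullet> b"
  have inv: "orthogonal_transformation (inv T)"
    by (rule orthogonal_transformation_inv[OF T])
  have eq: "T -` box l u = inv T ` box l u"
    using orthogonal_transformation_bij[OF T] by (rule bij_vimage_eq_inv_image)
  have m: "inv T ` box l u \<in> sets borel"
    unfolding eq[symmetric] by (rule measurable_sets_borel[of T borel]) measurable
  have "emeasure (distr lborel borel T) (box l u) = emeasure lborel (inv T ` box l u)"
    by (simp add: emeasure_distr eq)
  also have "\<dots> = emeasure lebesgue (inv T ` box l u)"
    using m by simp
  also have "\<dots> = ennreal (measure lebesgue (inv T ` box l u))"
    using measurable_orthogonal_image[OF inv, of "box l u"]
    by (intro emeasure_eq_measure2) auto
  also have "measure lebesgue (inv T ` box l u) = measure lebesgue (box l u)"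
    by (rule measure_orthogonal_image[OF inv]) auto
  also have "measure lebesgue (box l u) = (\<Prod>b\<in>Basis. (u - l) \<bullet> b)"
    using lu by (simp add: measure_lborel_box_eq inner_diff_left)
  finally show "emeasure (distr lborel borel T) (box l u) = ennreal (\<Prod>b\<in>Basis. (u - l) \<bullet> b)" .
qed simp

text \<open>\<open>T\<close> commutes with normalisation and maps the unit ball to itself, so the
  invariance of Lebesgue measure passes to the cone measure.\<close>

lemma nn_integral_surf_orthogonal:
  assumes T: "orthogonal_transformation T" and [measurable]: "f \<in> borel_measurable borel"
  shows "(\<integral>\<^sup>+x. f (T x) \<partial>surf) = (\<integral>\<^sup>+x. f x \<partial>surf)"
proof -
  have lin: "linear T" using T by (rule orthogonal_transformation_linear)
  have T_meas [measurable]: "T \<in> borel_measurable borel"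
    using lin by (intro borel_measurable_continuous_onI linear_continuous_on) (simp add: linear_conv_bounded_linear)
  have m: "(\<lambda>x. f (x /\<^sub>R norm x) * indicator (ball 0 1) x) \<in> borel_measurable borel"
    by (intro borel_measurable_times_ennreal borel_measurable_indicator) simp_all
  have "(\<integral>\<^sup>+x. f (T x) \<partial>surf)
      = 5 * (\<integral>\<^sup>+x. f (T (x /\<^sub>R norm x)) * indicator (ball 0 1) x \<partial>lborel)"
    by (rule nn_integral_surf) measurable
  also have "\<dots> = 5 * (\<integral>\<^sup>+x. f (T x /\<^sub>R norm (T x)) * indicator (ball 0 1) (T x) \<partial>lborel)"
    using T lin by (simp add: orthogonal_transformation_norm linear_scale indicator_def)
  also have "\<dots> = 5 * (\<integral>\<^sup>+x. f (x /\<^sub>R norm x) * indicator (ball 0 1) x \<partial>distr lborel borel T)"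
    using nn_integral_distr[of T lborel borel "\<lambda>x. f (x /\<^sub>R norm x) * indicator (ball 0 1) x"] m by simp
  also have "\<dots> = (\<integral>\<^sup>+x. f x \<partial>surf)"
    by (simp add: distr_lborel_orthogonal[OF T] nn_integral_surf)
  finally show ?thesis .
qed

lemma distr_surf_orthogonal:
  assumes T: "orthogonal_transformation T"
  shows "distr surf borel T = surf"
proof (rule measure_eqI)
  have [measurable]: "T \<in> borel_measurable borel"
    using orthogonal_transformation_linear[OF T]
    by (intro borel_measurable_continuous_onI linear_continuous_on) (simp add: linear_conv_bounded_linear)
  fix A assume "A \<in> sets (distr surf borel T)"
  then have [measurable]: "A \<in> sets borel" by simp
  show "emeasure (distr surf borel T) A = emeasure surf A"
    using nn_integral_surf_orthogonal[OF T, of "indicator A"]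
      nn_integral_distr[of T surf borel "indicator A"] by simp
qed simp

lemma integral_surf_orthogonal:
  fixes f :: "real^5 \<Rightarrow> real"
  assumes T: "orthogonal_transformation T" and [measurable]: "f \<in> borel_measurable borel"
  shows "(\<integral>x. f (T x) \<partial>surf) = (\<integral>x. f x \<partial>surf)"
proof -
  have [measurable]: "T \<in> borel_measurable borel"
    using orthogonal_transformation_linear[OF T]
    by (intro borel_measurable_continuous_onI linear_continuous_on) (simp add: linear_conv_bounded_linear)
  show ?thesis
    using integral_distr[of T surf borel f] by (simp add: distr_surf_orthogonal[OF T])
qed

text \<open>Functions on the sphere are represented by functions that are regular on the punctured
  space only; a single exceptional point does not spoil Borel measurability.\<close>

lemma measurable_continuous_punctured:
  fixes f :: "real^5 \<Rightarrow> real"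
  assumes "continuous_on (- {0}) f"
  shows "f \<in> borel_measurable borel"
  using assms by (intro borel_measurable_continuous_countable_exceptions[of "{0}"]) auto

lemma bounded_on_sphere:
  fixes f :: "real^5 \<Rightarrow> real"
  assumes "continuous_on (- {0}) f"
  obtains B where "B > 0" "\<And>x. norm x = 1 \<Longrightarrow> \<bar>f x\<bar> \<le> B"
proof -
  have "compact (f ` sphere 0 1)"
    by (intro compact_continuous_image continuous_on_subset[OF assms]) auto
  then obtain B where "\<And>y. y \<in> f ` sphere 0 1 \<Longrightarrow> norm y \<le> B"
    using compact_imp_bounded bounded_iff by metis
  then show ?thesis
    by (intro that[of "max 1 B"]) force+
qed

lemma integrable_surf_continuous:
  fixes f :: "real^5 \<Rightarrow> real"
  assumes "continuous_on (- {0}) f"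
  shows "integrable surf f"
proof -
  obtain B where B: "B > 0" "\<And>x. norm x = 1 \<Longrightarrow> \<bar>f x\<bar> \<le> B"
    using bounded_on_sphere[OF assms] by blast
  show ?thesis
    using measurable_continuous_punctured[OF assms] B
    by (intro surf.integrable_const_bound[of _ B]) (auto intro!: AE_surf_sphereI)
qed

lemma square_integrable_continuous:
  fixes f :: "real^5 \<Rightarrow> real"
  assumes "continuous_on (- {0}) f"
  shows "square_integrable f"
  unfolding square_integrable_def
proof
  show "f \<in> borel_measurable surf"
    using measurable_continuous_punctured[OF assms] by simp
  show "integrable surf (\<lambda>x. (f x)\<^sup>2)"
    by (intro integrable_surf_continuous continuous_on_power assms)
qed

lemma l2_eq_refl: "l2_eq f f \<longleftrightarrow> square_integrable f"
  by (simp add: l2_eq_def)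

lemma inner_class:
  "square_integrable f \<Longrightarrow> square_integrable g \<Longrightarrow> inner (class_of f) (class_of g) = (\<integral>x. f x * g x \<partial>surf)"
  by (rule inner_l2_S4.abs_eq) (auto simp: l2_eq_refl)

lemma class_add:
  "square_integrable f \<Longrightarrow> square_integrable g \<Longrightarrow> class_of (\<lambda>x. f x + g x) = class_of f + class_of g"
  using plus_l2_S4.abs_eq[of f g] by (simp add: l2_eq_refl)

lemma class_diff:
  "square_integrable f \<Longrightarrow> square_integrable g \<Longrightarrow> class_of (\<lambda>x. f x - g x) = class_of f - class_of g"
  using minus_l2_S4.abs_eq[of f g] by (simp add: l2_eq_refl)

lemma class_scale: "square_integrable f \<Longrightarrow> class_of (\<lambda>x. c * f x) = c *\<^sub>R class_of f"
  using scaleR_l2_S4.abs_eq[of f c] by (simp add: l2_eq_refl)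

lemma class_zero: "class_of (\<lambda>x. 0) = 0"
  by (simp add: zero_l2_S4_def)

lemma class_minus: "square_integrable f \<Longrightarrow> class_of (\<lambda>x. - f x) = - class_of f"
  using uminus_l2_S4.abs_eq[of f] by (simp add: l2_eq_refl)

lemma class_sum:
  assumes "finite I" "\<And>i. i \<in> I \<Longrightarrow> square_integrable (f i)"
  shows "square_integrable (\<lambda>x. \<Sum>i\<in>I. f i x) \<and> class_of (\<lambda>x. \<Sum>i\<in>I. f i x) = (\<Sum>i\<in>I. class_of (f i))"
  using assms
  by (induction I rule: finite_induct)
    (auto simp: class_zero class_add square_integrable_zero square_integrable_add)

lemma class_eqI:
  "square_integrable f \<Longrightarrow> square_integrable g \<Longrightarrow> (AE x in surf. f x = g x) \<Longrightarrow> class_of f = class_of g"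
  using Quotient3_rel_abs[OF Quotient3_l2_S4, of f g] by (auto simp: l2_eq_def)

lemma class_eq_iff:
  assumes "square_integrable f" "square_integrable g"
  shows "class_of f = class_of g \<longleftrightarrow> (AE x in surf. f x = g x)"
  using Quotient3_rel[OF Quotient3_l2_S4, of f g] assms by (auto simp: l2_eq_def)

lemma class_rep: "class_of (rep_l2_S4 \<Phi>) = \<Phi>"
  by (rule Quotient3_abs_rep[OF Quotient3_l2_S4])

lemma square_integrable_rep: "square_integrable (rep_l2_S4 \<Phi>)"
  using Quotient3_rep_reflp[OF Quotient3_l2_S4, of \<Phi>] by (simp add: l2_eq_refl)

lemma rep_class: "square_integrable f \<Longrightarrow> AE x in surf. rep_l2_S4 (class_of f) x = f x"
  using class_eq_iff[OF square_integrable_rep, of f "class_of f"] by (simp add: class_rep)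

lemma norm_class: "square_integrable f \<Longrightarrow> (norm (class_of f))\<^sup>2 = (\<integral>x. (f x)\<^sup>2 \<partial>surf)"
  unfolding power2_norm_eq_inner by (simp add: inner_class power2_eq_square)

lemma integrable_square_integrable: "square_integrable f \<Longrightarrow> integrable surf f"
  unfolding square_integrable_def by (blast intro: surf.square_integrable_imp_integrable)

lemma square_integrable_bounded_mult:
  assumes f: "square_integrable f" and [measurable]: "g \<in> borel_measurable borel"
    and B: "\<And>x. norm x = 1 \<Longrightarrow> \<bar>g x\<bar> \<le> B"
  shows "square_integrable (\<lambda>x. g x * f x)"
proof -
  have [measurable]: "f \<in> borel_measurable borel"
    using f measurable_cong_sets[OF sets_surf refl] unfolding square_integrable_def by blast
  have "integrable surf (\<lambda>x. (g x * f x)\<^sup>2)"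
  proof (rule Bochner_Integration.integrable_bound)
    show "integrable surf (\<lambda>x. B\<^sup>2 * (f x)\<^sup>2)"
      using f by (simp add: square_integrable_def)
    show "AE x in surf. norm ((g x * f x)\<^sup>2) \<le> norm (B\<^sup>2 * (f x)\<^sup>2)"
    proof (rule AE_surf_sphereI)
      fix x :: "real^5" assume "norm x = 1"
      then have "(g x)\<^sup>2 \<le> B\<^sup>2" using B power_mono[of "\<bar>g x\<bar>" B 2] by fastforce
      then show "norm ((g x * f x)\<^sup>2) \<le> norm (B\<^sup>2 * (f x)\<^sup>2)"
        by (simp add: power_mult_distrib mult_right_mono)
    qed
  qed measurable
  then show ?thesis by (simp add: square_integrable_def)
qed

section \<open>Completeness and integration by parts\<close>

text \<open>Cauchy-Schwarz against the constant 1: since the measure is finite, L^2 embeds into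
  L^1.\<close>

lemma integral_abs_le_norm:
  assumes "square_integrable g"
  shows "(\<integral>x. \<bar>g x\<bar> \<partial>surf) \<le> norm (class_of g) * norm (class_of (\<lambda>x. 1))"
proof -
  have sq: "square_integrable (\<lambda>x. \<bar>g x\<bar>)" "square_integrable (\<lambda>x. 1)"
    using assms by (auto simp: square_integrable_def)
  have "(\<integral>x. \<bar>g x\<bar> \<partial>surf) = inner (class_of (\<lambda>x. \<bar>g x\<bar>)) (class_of (\<lambda>x. 1))"
    using inner_class[OF sq] by simp
  also have "\<dots> \<le> norm (class_of (\<lambda>x. \<bar>g x\<bar>)) * norm (class_of (\<lambda>x. 1))"
    by (rule norm_cauchy_schwarz)
  also have "norm (class_of (\<lambda>x. \<bar>g x\<bar>)) = norm (class_of g)"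
    using norm_class[OF sq(1)] norm_class[OF assms]
    by (simp add: power2_eq_imp_eq)
  finally show ?thesis .
qed

lemma nn_integral_square_class:
  "square_integrable g \<Longrightarrow> (\<integral>\<^sup>+x. ennreal ((g x)\<^sup>2) \<partial>surf) = ennreal ((norm (class_of g))\<^sup>2)"
  by (subst nn_integral_eq_integral) (auto simp: norm_class square_integrable_def)

text \<open>The Riesz-Fischer argument: along a fast subsequence the increments are summable in L^1,
  which gives a limit almost everywhere; Fatou's lemma bounds its L^2 distance to the subsequence,
  and the Cauchy property carries the whole sequence along.\<close>

instance l2_S4 :: complete_space
proof
  fix X :: "nat \<Rightarrow> l2_S4"
  assume X: "Cauchy X"
  have "\<forall>n. \<exists>N. \<forall>k\<ge>N. \<forall>m\<ge>N. dist (X k) (X m) < (1/2) ^ n"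
    using metric_CauchyD[OF X] by simp
  then obtain N where N: "\<And>n k m. k \<ge> N n \<Longrightarrow> m \<ge> N n \<Longrightarrow> dist (X k) (X m) < (1/2) ^ n"
    by metis
  \<comment> \<open>Partial sums make the indices monotone while keeping
    \<open>N n \<le> r n\<close>.\<close>
  define r where "r n = (\<Sum>k\<le>n. N k)" for n
  have r: "N n \<le> r n" for n
    unfolding r_def by (rule member_le_sum) auto
  have r_mono: "n \<le> m \<Longrightarrow> r n \<le> r m" for n m
    unfolding r_def by (rule sum_mono2) auto
  have close: "dist (X k) (X (r n)) < (1/2) ^ n" if "k \<ge> r n" for k n
    using that r[of n] by (intro N) auto
  define f where "f n = rep_l2_S4 (X (r n))" for n
  have f: "square_integrable (f n)" "class_of (f n) = X (r n)" for n
    by (auto simp: f_def square_integrable_rep class_rep)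
  have [measurable]: "f n \<in> borel_measurable surf" for n
    using f(1)[of n] by (simp add: square_integrable_def)
  define c where "c = norm (class_of (\<lambda>x. 1))"
  have fd: "square_integrable (\<lambda>x. f n x - f m x)" for n m
    by (intro square_integrable_diff f)
  have cd: "norm (class_of (\<lambda>x. f n x - f m x)) \<le> (1/2) ^ m" if "m \<le> n" for n m
    using close[OF r_mono[OF that]] f by (simp add: class_diff dist_norm less_imp_le)
  \<comment> \<open>The increment is at most (1/2)^n in L^2, hence in L^1 up to the norm
    \<open>c\<close> of the constant 1.\<close>
  have step: "(\<integral>\<^sup>+x. ennreal \<bar>f (Suc n) x - f n x\<bar> \<partial>surf) \<le> ennreal ((1/2) ^ n * c)" for n
  proof -
    have "(\<integral>\<^sup>+x. ennreal \<bar>f (Suc n) x - f n x\<bar> \<partial>surf) = ennreal (\<integral>x. \<bar>f (Suc n) x - f n x\<bar> \<partial>surf)"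
      by (intro nn_integral_eq_integral)
        (intro integrable_abs integrable_square_integrable fd, simp)
    also have "\<dots> \<le> ennreal ((1/2) ^ n * c)"
      using integral_abs_le_norm[OF fd, of "Suc n" n] cd[of n "Suc n"]
      by (intro ennreal_leI order_trans[OF integral_abs_le_norm[OF fd]])
        (auto simp: c_def intro!: mult_right_mono)
    finally show ?thesis .
  qed
  have "(\<integral>\<^sup>+x. (\<Sum>n. ennreal \<bar>f (Suc n) x - f n x\<bar>) \<partial>surf)
      = (\<Sum>n. \<integral>\<^sup>+x. ennreal \<bar>f (Suc n) x - f n x\<bar> \<partial>surf)"
    by (rule nn_integral_suminf) measurable
  also have "\<dots> \<le> (\<Sum>n. ennreal ((1/2) ^ n * c))"
    by (intro suminf_le step) auto
  also have "\<dots> = ennreal (\<Sum>n. (1/2) ^ n * c)"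
    by (intro suminf_ennreal2) (auto simp: c_def intro!: summable_mult2 summable_geometric)
  also have "\<dots> < \<infinity>" by simp
  finally have "AE x in surf. (\<Sum>n. ennreal \<bar>f (Suc n) x - f n x\<bar>) \<noteq> \<infinity>"
    by (intro nn_integral_PInf_AE) auto
  then have conv: "AE x in surf. convergent (\<lambda>n. f n x)"
  proof eventually_elim
    case (elim x)
    then have "summable (\<lambda>n. \<bar>f (Suc n) x - f n x\<bar>)"
      by (intro summable_suminf_not_top) (auto simp: top_ennreal.rep_eq)
    then have "summable (\<lambda>n. f (Suc n) x - f n x)"
      by (rule summable_rabs_cancel)
    then have "convergent (\<lambda>n. \<Sum>k<n. f (Suc k) x - f k x)"
      by (simp add: summable_iff_convergent)
    then have "convergent (\<lambda>n. f n x - f 0 x)"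
      using sum_lessThan_telescope[of "\<lambda>n. f n x"] by simp
    then have "convergent (\<lambda>n. (f n x - f 0 x) + f 0 x)"
      by (intro convergent_add convergent_const)
    then show ?case by simp
  qed
  define g where "g x = lim (\<lambda>n. f n x)" for x
  have [measurable]: "g \<in> borel_measurable surf"
    unfolding g_def by (rule borel_measurable_lim_metric) measurable
  have bound: "(\<integral>\<^sup>+x. ennreal ((g x - f m x)\<^sup>2) \<partial>surf) \<le> ennreal (((1/2) ^ m)\<^sup>2)" for m
  proof -
    have "AE x in surf. ennreal ((g x - f m x)\<^sup>2) = liminf (\<lambda>n. ennreal ((f n x - f m x)\<^sup>2))"
      using conv
    proof eventually_elim
      case (elim x)
      then have "(\<lambda>n. f n x) \<longlonglongrightarrow> g x"
        by (simp add: g_def convergent_LIMSEQ_iff)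
      then have "(\<lambda>n. ennreal ((f n x - f m x)\<^sup>2)) \<longlonglongrightarrow> ennreal ((g x - f m x)\<^sup>2)"
        by (intro tendsto_ennrealI tendsto_intros)
      then show ?case
        by (intro lim_imp_Liminf[symmetric]) auto
    qed
    then have "(\<integral>\<^sup>+x. ennreal ((g x - f m x)\<^sup>2) \<partial>surf)
        = (\<integral>\<^sup>+x. liminf (\<lambda>n. ennreal ((f n x - f m x)\<^sup>2)) \<partial>surf)"
      by (rule nn_integral_cong_AE)
    also have "\<dots> \<le> liminf (\<lambda>n. \<integral>\<^sup>+x. ennreal ((f n x - f m x)\<^sup>2) \<partial>surf)"
      by (rule nn_integral_liminf) measurable
    also have "\<dots> \<le> limsup (\<lambda>n. \<integral>\<^sup>+x. ennreal ((f n x - f m x)\<^sup>2) \<partial>surf)"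
      by (rule Liminf_le_Limsup) simp
    also have "\<dots> \<le> ennreal (((1/2) ^ m)\<^sup>2)"
    proof (rule Limsup_bounded)
      show "\<forall>\<^sub>F n in sequentially. (\<integral>\<^sup>+x. ennreal ((f n x - f m x)\<^sup>2) \<partial>surf) \<le> ennreal (((1/2) ^ m)\<^sup>2)"
        using eventually_ge_at_top[of m]
      proof eventually_elim
        case (elim n)
        show ?case
          unfolding nn_integral_square_class[OF fd]
          by (intro ennreal_leI power_mono cd elim) auto
      qed
    qed
    finally show ?thesis .
  qed
  have gd: "square_integrable (\<lambda>x. g x - f m x)" for m
  proof -
    have "integrable surf (\<lambda>x. (g x - f m x)\<^sup>2)"
    proof (rule integrableI_bounded)
      show "(\<integral>\<^sup>+x. ennreal (norm ((g x - f m x)\<^sup>2)) \<partial>surf) < \<infinity>"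
        using le_less_trans[OF bound[of m], of \<infinity>] by simp
    qed measurable
    then show ?thesis by (simp add: square_integrable_def)
  qed
  have g: "square_integrable g"
    using square_integrable_add[OF gd f(1), of 0 0] by simp
  have lim: "dist (X (r m)) (class_of g) \<le> (1/2) ^ m" for m
  proof -
    have "ennreal ((norm (class_of g - X (r m)))\<^sup>2) \<le> ennreal (((1/2) ^ m)\<^sup>2)"
      using bound[of m] unfolding nn_integral_square_class[OF gd] by (simp add: class_diff g f)
    then have "(norm (class_of g - X (r m)))\<^sup>2 \<le> ((1/2) ^ m)\<^sup>2"
      by (subst (asm) ennreal_le_iff) auto
    then show ?thesis
      by (simp add: dist_norm norm_minus_commute power2_le_iff_abs_le)
  qed
  have "X \<longlonglongrightarrow> class_of g"
  proof (rule metric_LIMSEQ_I)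
    fix e :: real assume "e > 0"
    then obtain m where m: "(1/2) ^ m < e / 2"
      using real_arch_pow_inv[of "e / 2" "1/2"] by auto
    have "dist (X n) (class_of g) < e" if "n \<ge> r m" for n
      using dist_triangle[of "X n" "class_of g" "X (r m)"] close[OF that] lim[of m] m by linarith
    then show "\<exists>no. \<forall>n\<ge>no. dist (X n) (class_of g) < e" by blast
  qed
  then show "convergent X" by (auto simp: convergent_def)
qed

section \<open>Partial derivatives and rotation fields\<close>

definition pd :: "5 \<Rightarrow> (real^5 \<Rightarrow> real) \<Rightarrow> real^5 \<Rightarrow> real" where
  "pd i f x = frechet_derivative f (at x) (axis i 1)"

lemma has_derivative_pd:
  assumes "f differentiable (at x)"
  shows "(f has_derivative (\<lambda>v. \<Sum>i\<in>UNIV. v $ i * pd i f x)) (at x)"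
proof -
  have D: "(f has_derivative frechet_derivative f (at x)) (at x)"
    using assms by (simp add: frechet_derivative_works)
  then have lin: "linear (frechet_derivative f (at x))"
    by (rule has_derivative_linear)
  have "frechet_derivative f (at x) v = (\<Sum>i\<in>UNIV. v $ i * pd i f x)" for v
  proof -
    have "frechet_derivative f (at x) v = frechet_derivative f (at x) (\<Sum>i\<in>UNIV. v $ i *\<^sub>R axis i 1)"
      using basis_expansion[of v] by (simp add: scalar_mult_eq_scaleR)
    then show ?thesis
      by (simp add: linear_sum[OF lin] linear_scale[OF lin] pd_def)
  qed
  then have "frechet_derivative f (at x) = (\<lambda>v. \<Sum>i\<in>UNIV. v $ i * pd i f x)" by blast
  with D show ?thesis by simp
qed

lemma frechet_derivative_pd:
  "f differentiable (at x) \<Longrightarrow> frechet_derivative f (at x) v = (\<Sum>i\<in>UNIV. v $ i * pd i f x)"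
  by (subst fun_cong[OF frechet_derivative_at[OF has_derivative_pd], of f x v, symmetric]) simp_all

lemma pd_eqI: "(f has_derivative f') (at x) \<Longrightarrow> pd i f x = f' (axis i 1)"
proof -
  assume "(f has_derivative f') (at x)"
  from frechet_derivative_at[OF this] show ?thesis by (simp add: pd_def)
qed

lemma sum_axis: "(\<Sum>i\<in>UNIV. axis j (1::real) $ i * g i) = g (j :: 5)"
proof -
  have "axis j (1::real) $ i * g i = (if i = j then g i else 0)" for i
    by (simp add: axis_def)
  then show ?thesis by simp
qed

lemma rot_deriv_pd:
  assumes "f differentiable (at x)"
  shows "rot_deriv i j f x = x $ i * pd j f x - x $ j * pd i f x"
proof -
  have "(\<Sum>k\<in>UNIV. (x $ i *\<^sub>R axis j 1 - x $ j *\<^sub>R axis i 1) $ k * pd k f x)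
      = (\<Sum>k\<in>UNIV. x $ i * (axis j 1 $ k * pd k f x) - x $ j * (axis i 1 $ k * pd k f x))"
    by (intro sum.cong) (simp_all add: algebra_simps)
  also have "\<dots> = x $ i * pd j f x - x $ j * pd i f x"
    unfolding sum_subtractf sum_distrib_left[symmetric] sum_axis ..
  finally show ?thesis
    unfolding rot_deriv_def frechet_derivative_pd[OF assms] .
qed

text \<open>The field vanishes, yet the value can be replaced by 0 only where \<open>f\<close> is
  differentiable: elsewhere \<open>frechet_derivative\<close> need not be linear.\<close>

lemma rot_deriv_same [simp]: "rot_deriv i i f = (\<lambda>x. frechet_derivative f (at x) 0)"
  by (simp add: rot_deriv_def fun_eq_iff)

text \<open>The flow of the field
  \<open>x $ i *\<^sub>R axis j 1 - x $ j *\<^sub>R axis i 1\<close>: rotation by the angle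
  \<open>t\<close> in the plane of the coordinates i and j, written as a displacement of
  \<open>x\<close>. It has this meaning for distinct i and j.\<close>

definition rotation :: "5 \<Rightarrow> 5 \<Rightarrow> real \<Rightarrow> real^5 \<Rightarrow> real^5" where
  "rotation i j t x = x + ((cos t - 1) * x $ i - sin t * x $ j) *\<^sub>R axis i 1
     + ((cos t - 1) * x $ j + sin t * x $ i) *\<^sub>R axis j 1"

lemma rotation_0 [simp]: "rotation i j 0 x = x"
  by (simp add: rotation_def)

lemma orthogonal_rotation:
  assumes "i \<noteq> j"
  shows "orthogonal_transformation (rotation i j t)"
  unfolding orthogonal_transformation
proof (intro conjI allI)
  show "linear (rotation i j t)"
    by (rule linearI) (simp_all add: rotation_def vec_eq_iff algebra_simps)
  fix x
  define a b where "a = (cos t - 1) * x $ i - sin t * x $ j"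
    and "b = (cos t - 1) * x $ j + sin t * x $ i"
  have "axis i (1::real) $ j = 0" "axis j (1::real) $ i = 0"
    using assms by (simp_all add: axis_def)
  then have "inner (rotation i j t x) (rotation i j t x)
      = inner x x + 2 * a * x $ i + 2 * b * x $ j + a\<^sup>2 + b\<^sup>2"
    unfolding rotation_def a_def[symmetric] b_def[symmetric]
    by (simp add: inner_add_left inner_add_right inner_axis inner_axis' inner_commute[of "axis i 1" x]
        inner_commute[of "axis j 1"] power2_eq_square algebra_simps)
  also have "\<dots> = inner x x + ((sin t)\<^sup>2 + (cos t)\<^sup>2 - 1) * ((x $ i)\<^sup>2 + (x $ j)\<^sup>2)"
    unfolding a_def b_def by (simp only: power2_eq_square) algebra
  also have "\<dots> = inner x x" by simp
  finally show "norm (rotation i j t x) = norm x"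
    by (simp add: norm_eq_sqrt_inner)
qed

lemma has_derivative_rotation:
  assumes "i \<noteq> j"
  shows "((\<lambda>t. rotation i j t x) has_derivative
    (\<lambda>h. h *\<^sub>R (rotation i j t x $ i *\<^sub>R axis j 1 - rotation i j t x $ j *\<^sub>R axis i 1))) (at t)"
proof -
  have 1: "rotation i j t x $ i = cos t * x $ i - sin t * x $ j"
    "rotation i j t x $ j = cos t * x $ j + sin t * x $ i"
    using assms by (simp_all add: rotation_def axis_def algebra_simps)
  show ?thesis
    unfolding 1 unfolding rotation_def
    by (auto intro!: derivative_eq_intros simp: vec_eq_iff algebra_simps)
qed

text \<open>The integral of \<open>f\<close> composed with \<open>rotation i j t\<close> is constant
  in \<open>t\<close>; differentiating at t = 0 under the integral gives the claim.\<close>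

lemma integral_rot_deriv:
  assumes f: "\<And>x. x \<noteq> 0 \<Longrightarrow> f differentiable (at x)"
    and cont: "continuous_on (- {0}) (rot_deriv i j f)"
  shows "(\<integral>x. rot_deriv i j f x \<partial>surf) = 0"
proof (cases "i = j")
  case True
  have "AE x in surf. rot_deriv i j f x = 0"
    using AE_surf_nonzero
  proof eventually_elim
    case (elim x)
    then show ?case using f[of x] True
      by (simp add: frechet_derivative_pd)
  qed
  then show ?thesis
    by (intro integral_eq_zero_AE)
next
  case ij: False
  define g where "g = rot_deriv i j f"
  have cf: "continuous_on (- {0}) f"
    using f by (auto simp: continuous_on_eq_continuous_at differentiable_imp_continuous_within open_Compl)
  have [measurable]: "f \<in> borel_measurable borel" "g \<in> borel_measurable borel"
    using cf cont by (auto simp: g_def intro: measurable_continuous_punctured)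
  have orth: "orthogonal_transformation (rotation i j t)" for t
    by (rule orthogonal_rotation[OF ij])
  have nr: "norm (rotation i j t x) = norm x" for t x
    using orth by (simp add: orthogonal_transformation_norm)
  have rm [measurable]: "rotation i j t \<in> borel_measurable borel" for t
    using orthogonal_transformation_linear[OF orth]
    by (intro borel_measurable_continuous_onI linear_continuous_on) (simp add: linear_conv_bounded_linear)
  have der: "((\<lambda>t. f (rotation i j t x)) has_real_derivative g (rotation i j t x)) (at t)"
    if x: "norm x = 1" for x t
  proof -
    define y where "y = rotation i j t x"
    have "y \<noteq> 0" using nr[of t x] x by (auto simp: y_def)
    then have D: "(f has_derivative frechet_derivative f (at y)) (at y)"
      using f by (simp add: frechet_derivative_works)
    have "((\<lambda>t. f (rotation i j t x)) has_derivative
        (\<lambda>h. frechet_derivative f (at y) (h *\<^sub>R (y $ i *\<^sub>R axis j 1 - y $ j *\<^sub>R axis i 1)))) (at t)"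
      using has_derivative_compose[OF has_derivative_rotation[OF ij, of x t] D[unfolded y_def]]
      by (simp add: y_def)
    also have "(\<lambda>h. frechet_derivative f (at y) (h *\<^sub>R (y $ i *\<^sub>R axis j 1 - y $ j *\<^sub>R axis i 1)))
        = (\<lambda>h. g y * h)"
      using linear_scale[OF has_derivative_linear[OF D]] by (simp add: g_def rot_deriv_def fun_eq_iff)
    finally show ?thesis by (simp add: has_field_derivative_def y_def)
  qed
  obtain B where B: "B > 0" "\<And>x. norm x = 1 \<Longrightarrow> \<bar>g x\<bar> \<le> B"
    using bounded_on_sphere[OF cont] unfolding g_def by blast
  define h where "h n = 1 / real (Suc n)" for n
  have h: "h n > 0" for n by (simp add: h_def)
  define s where "s n x = (f (rotation i j (h n) x) - f x) / h n" for n x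
  have [measurable]: "s n \<in> borel_measurable borel" for n
    unfolding s_def by measurable
  have "(\<lambda>n. \<integral>x. s n x \<partial>surf) \<longlonglongrightarrow> (\<integral>x. g x \<partial>surf)"
  proof (rule integral_dominated_convergence)
    show "AE x in surf. (\<lambda>n. s n x) \<longlonglongrightarrow> g x"
    proof (rule AE_surf_sphereI)
      fix x :: "real^5" assume x: "norm x = 1"
      have "((\<lambda>t. (f (rotation i j t x) - f x) / t) \<longlongrightarrow> g x) (at 0)"
        using der[OF x, of 0] by (simp add: has_field_derivative_iff)
      moreover have "filterlim h (at 0) sequentially"
        unfolding filterlim_at h_def
        using LIMSEQ_inverse_real_of_nat by (auto simp: inverse_eq_divide)
      ultimately show "(\<lambda>n. s n x) \<longlonglongrightarrow> g x"
        unfolding s_def by (rule filterlim_compose)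
    qed
    show "AE x in surf. norm (s n x) \<le> B" for n
    proof (rule AE_surf_sphereI)
      fix x :: "real^5" assume x: "norm x = 1"
      \<comment> \<open>The mean value theorem along the orbit bounds the difference quotient by the
        maximum of the derivative on the sphere, uniformly in \<open>n\<close>.\<close>
      obtain z where "0 < z" "z < h n" "f (rotation i j (h n) x) - f (rotation i j 0 x) = (h n - 0) * g (rotation i j z x)"
        using MVT2[OF h[of n], of "\<lambda>t. f (rotation i j t x)" "\<lambda>t. g (rotation i j t x)"] der[OF x] by blast
      then have "s n x = g (rotation i j z x)"
        using h[of n] by (simp add: s_def)
      then show "norm (s n x) \<le> B"
        using B(2)[of "rotation i j z x"] x by (simp add: nr)
    qed
  qed (auto)
  moreover have "(\<integral>x. s n x \<partial>surf) = 0" for n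
  proof -
    have int: "integrable surf f" by (rule integrable_surf_continuous[OF cf])
    have int': "integrable surf (\<lambda>x. f (rotation i j (h n) x))"
      using integrable_distr_eq[of "rotation i j (h n)" surf borel f] int
      by (simp add: distr_surf_orthogonal[OF orth])
    show ?thesis
      using int int' integral_surf_orthogonal[OF orth, of f "h n" ]
      by (simp add: s_def)
  qed
  ultimately show ?thesis by (simp add: g_def LIMSEQ_const_iff)
qed

abbreviation "C1 \<equiv> Ck_on (Suc 0) (- {0})"

lemma C1_differentiable: "C1 f \<Longrightarrow> x \<noteq> 0 \<Longrightarrow> f differentiable (at x)"
  unfolding Ck_on.simps by blast

lemma C1_continuous: "C1 f \<Longrightarrow> continuous_on (- {0}) f"
proof -
  assume f: "C1 f"
  have "isCont f x" if "x \<noteq> 0" for x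
    by (rule differentiable_imp_continuous_within[OF C1_differentiable[OF f that]])
  then show ?thesis
    by (intro continuous_at_imp_continuous_on) auto
qed

lemma C1_pd: "C1 f \<Longrightarrow> continuous_on (- {0}) (pd i f)"
proof -
  assume "C1 f"
  then have "\<forall>v. continuous_on (- {0}) (\<lambda>x. frechet_derivative f (at x) v)"
    unfolding Ck_on.simps by (rule conjunct2)
  then show ?thesis unfolding pd_def[abs_def] by (rule spec)
qed

lemma C1_rot_deriv: "C1 f \<Longrightarrow> continuous_on (- {0}) (rot_deriv i j f)"
proof -
  assume f: "C1 f"
  have "continuous_on (- {0}) (\<lambda>x. x $ i * pd j f x - x $ j * pd i f x)"
    by (intro continuous_intros C1_pd f)
  then show ?thesis
    using f by (subst continuous_on_cong[OF refl, of _ _ "\<lambda>x. x $ i * pd j f x - x $ j * pd i f x"])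
      (auto simp: rot_deriv_pd)
qed

lemma rot_deriv_mult:
  assumes "f differentiable (at x)" "g differentiable (at x)"
  shows "rot_deriv i j (\<lambda>x. f x * g x) x = f x * rot_deriv i j g x + rot_deriv i j f x * g x"
proof -
  have "((\<lambda>x. f x * g x) has_derivative
      (\<lambda>h. f x * frechet_derivative g (at x) h + frechet_derivative f (at x) h * g x)) (at x)"
    using assms by (intro has_derivative_mult) (simp_all add: frechet_derivative_works[symmetric])
  from fun_cong[OF frechet_derivative_at[OF this]] show ?thesis
    by (simp add: rot_deriv_def)
qed

lemma rot_deriv_by_parts:
  assumes f: "C1 f" and g: "C1 g"
  shows "(\<integral>x. f x * rot_deriv i j g x \<partial>surf) = - (\<integral>x. rot_deriv i j f x * g x \<partial>surf)"
proof -
  let ?h = "\<lambda>x. f x * g x"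
  have eq: "rot_deriv i j ?h x = f x * rot_deriv i j g x + rot_deriv i j f x * g x" if "x \<noteq> 0" for x
    using that f g by (intro rot_deriv_mult) (auto simp: C1_differentiable)
  have c: "continuous_on (- {0}) (\<lambda>x. f x * rot_deriv i j g x)"
    "continuous_on (- {0}) (\<lambda>x. rot_deriv i j f x * g x)"
    by (intro continuous_on_mult C1_continuous C1_rot_deriv f g)+
  have "continuous_on (- {0}) (rot_deriv i j ?h)"
    using continuous_on_add[OF c] by (rule continuous_on_eq) (simp add: eq)
  then have "0 = (\<integral>x. rot_deriv i j ?h x \<partial>surf)"
    using f g by (intro integral_rot_deriv[symmetric]) (auto intro: differentiable_mult)
  also have "\<dots> = (\<integral>x. f x * rot_deriv i j g x + rot_deriv i j f x * g x \<partial>surf)"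
  proof (rule integral_cong_AE)
    show "rot_deriv i j ?h \<in> borel_measurable surf"
      using measurable_continuous_punctured \<open>continuous_on (- {0}) (rot_deriv i j ?h)\<close> by simp
    show "(\<lambda>x. f x * rot_deriv i j g x + rot_deriv i j f x * g x) \<in> borel_measurable surf"
      using measurable_continuous_punctured[OF continuous_on_add[OF c]] by simp
    show "AE x in surf. rot_deriv i j ?h x = f x * rot_deriv i j g x + rot_deriv i j f x * g x"
      using AE_surf_nonzero by eventually_elim (rule eq)
  qed
  also have "\<dots> = (\<integral>x. f x * rot_deriv i j g x \<partial>surf) + (\<integral>x. rot_deriv i j f x * g x \<partial>surf)"
    by (intro Bochner_Integration.integral_add integrable_surf_continuous c)
  finally show ?thesis by simp
qed

lemma rot_deriv_by_parts_class:
  assumes f: "C1 f" and g: "C1 g"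
  shows "inner (class_of f) (class_of (rot_deriv i j g)) = - inner (class_of (rot_deriv i j f)) (class_of g)"
  using rot_deriv_by_parts[OF assms]
proof -
  have sq: "square_integrable f" "square_integrable g"
    "square_integrable (rot_deriv i j f)" "square_integrable (rot_deriv i j g)"
    by (rule square_integrable_continuous, rule C1_continuous C1_rot_deriv, rule f g)+
  show ?thesis
    by (simp only: inner_class[OF sq(1,4)] inner_class[OF sq(3,2)] rot_deriv_by_parts[OF f g])
qed

section \<open>Harmonic polynomials\<close>

abbreviation "poly_fun \<equiv> (real_polynomial_function :: (real^5 \<Rightarrow> real) \<Rightarrow> bool)"

lemmas poly_linear = real_polynomial_function.intros(1)
  and poly_const = real_polynomial_function.intros(2)
  and poly_add = real_polynomial_function.intros(3)
  and poly_mult = real_polynomial_function.intros(4)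

lemma pd_add:
  assumes "f differentiable (at x)" "g differentiable (at x)"
  shows "pd i (\<lambda>x. f x + g x) x = pd i f x + pd i g x"
  using pd_eqI[OF has_derivative_add[OF assms[THEN has_derivative_pd]], of i] by (simp add: sum_axis)

lemma pd_diff:
  assumes "f differentiable (at x)" "g differentiable (at x)"
  shows "pd i (\<lambda>x. f x - g x) x = pd i f x - pd i g x"
  using pd_eqI[OF has_derivative_diff[OF assms[THEN has_derivative_pd]], of i] by (simp add: sum_axis)

lemma pd_mult:
  assumes "f differentiable (at x)" "g differentiable (at x)"
  shows "pd i (\<lambda>x. f x * g x) x = f x * pd i g x + pd i f x * g x"
  using pd_eqI[OF has_derivative_mult[OF assms[THEN has_derivative_pd]], of i] by (simp add: sum_axis)

lemma pd_const [simp]: "pd i (\<lambda>x. c) = (\<lambda>x. 0)"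
  using pd_eqI[OF has_derivative_const] by (simp add: fun_eq_iff)

lemma pd_cmult:
  assumes "f differentiable (at x)"
  shows "pd i (\<lambda>x. c * f x) x = c * pd i f x"
  using pd_mult[of "\<lambda>_. c" x f i] assms by simp

lemma pd_sum:
  assumes "finite I" "\<And>a. a \<in> I \<Longrightarrow> f a differentiable (at x)"
  shows "pd i (\<lambda>x. \<Sum>a\<in>I. f a x) x = (\<Sum>a\<in>I. pd i (f a) x)"
  using assms
proof (induction I rule: finite_induct)
  case (insert a I)
  then show ?case
    using pd_add[of "f a" x "\<lambda>x. \<Sum>a\<in>I. f a x" i] by (auto simp: differentiable_sum)
qed simp

lemma coord_has_derivative: "((\<lambda>x::real^5. x $ j) has_derivative (\<lambda>h. h $ j)) (at x)"
  by (rule bounded_linear.has_derivative[OF bounded_linear_vec_nth has_derivative_ident])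

lemma coord_differentiable [simp]: "(\<lambda>x::real^5. x $ j) differentiable (at x)"
  using coord_has_derivative by (rule differentiableI)

lemma pd_coord: "pd i (\<lambda>x. x $ j) x = (if i = j then 1 else 0)"
  using pd_eqI[OF coord_has_derivative, of i j x] by (simp add: axis_def)

lemma poly_differentiable: "poly_fun p \<Longrightarrow> p differentiable (at x)"
  by (rule differentiable_at_real_polynomial_function)

lemma poly_coord [intro, simp]: "poly_fun (\<lambda>x. x $ j)"
  by (rule poly_linear) (rule bounded_linear_vec_nth)

lemma poly_pd: "poly_fun p \<Longrightarrow> poly_fun (pd i p)"
proof (induction p rule: real_polynomial_function.induct)
  case (linear f)
  have "pd i f = (\<lambda>x. f (axis i 1))"
    by (rule ext, rule pd_eqI, rule bounded_linear_imp_has_derivative, rule linear)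
  then show ?case by simp (rule poly_const)
next
  case (add f g)
  have "pd i (\<lambda>x. f x + g x) = (\<lambda>x. pd i f x + pd i g x)"
    by (rule ext, rule pd_add) (auto intro: poly_differentiable add)
  with add show ?case by auto
next
  case (mult f g)
  have "pd i (\<lambda>x. f x * g x) = (\<lambda>x. f x * pd i g x + pd i f x * g x)"
    by (rule ext, rule pd_mult) (auto intro: poly_differentiable mult)
  with mult show ?case by auto
qed auto

lemma poly_pd_differentiable: "poly_fun p \<Longrightarrow> pd i p differentiable (at x)"
  by (intro poly_differentiable poly_pd)

lemma pd_commute: "poly_fun p \<Longrightarrow> pd i (pd j p) = pd j (pd i p)"
proof (induction p rule: real_polynomial_function.induct)
  case (linear f)
  have "pd i f = (\<lambda>x. f (axis i 1))" for i
    by (rule ext, rule pd_eqI, rule bounded_linear_imp_has_derivative, rule linear)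
  then show ?case by simp
next
  case (add f g)
  have 1: "pd i (\<lambda>x. f x + g x) = (\<lambda>x. pd i f x + pd i g x)"
    if "poly_fun f" "poly_fun g" for i f g
    by (rule ext, rule pd_add) (auto intro: poly_differentiable that)
  show ?case using add by (simp add: 1 poly_pd)
next
  case (mult f g)
  have a: "pd i (\<lambda>x. f x + g x) = (\<lambda>x. pd i f x + pd i g x)"
    if "poly_fun f" "poly_fun g" for i f g
    by (rule ext, rule pd_add) (auto intro: poly_differentiable that)
  have m: "pd i (\<lambda>x. f x * g x) = (\<lambda>x. f x * pd i g x + pd i f x * g x)"
    if "poly_fun f" "poly_fun g" for i f g
    by (rule ext, rule pd_mult) (auto intro: poly_differentiable that)
  show ?case using mult
    by (simp add: a m poly_pd poly_mult fun_eq_iff)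
qed auto

lemma poly_frechet:
  assumes "poly_fun p" shows "poly_fun (\<lambda>x. frechet_derivative p (at x) v)"
proof -
  have "(\<lambda>x. frechet_derivative p (at x) v) = (\<lambda>x. \<Sum>i\<in>UNIV. v $ i * pd i p x)"
    by (rule ext, rule frechet_derivative_pd) (rule poly_differentiable[OF assms])
  then show ?thesis
    by (simp add: real_polynomial_function_sum poly_mult
        poly_const poly_pd assms)
qed

lemma poly_Ck: "poly_fun p \<Longrightarrow> Ck_on n S p"
proof (induction n arbitrary: p)
  case 0
  then show ?case
    by (simp add: continuous_on_polymonial_function real_polynomial_function_eq)
next
  case (Suc n)
  then show ?case by (simp add: poly_differentiable poly_frechet)
qed

lemma poly_smooth: "poly_fun p \<Longrightarrow> smooth p"
  by (simp add: smooth_def poly_Ck)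

lemma poly_continuous: "poly_fun p \<Longrightarrow> continuous_on S p"
  by (simp add: continuous_on_polymonial_function real_polynomial_function_eq)

lemma poly_square_integrable: "poly_fun p \<Longrightarrow> square_integrable p"
  by (intro square_integrable_continuous poly_continuous)

lemma euclidean_laplacian_pd: "euclidean_laplacian f x = (\<Sum>i\<in>UNIV. pd i (pd i f) x)"
proof -
  have B: "Basis = range (\<lambda>i::5. axis i (1::real))"
    by (auto simp: Basis_vec_def)
  have inj: "inj (\<lambda>i::5. axis i (1::real))"
    by (auto simp: inj_on_def axis_eq_axis)
  show ?thesis
    unfolding euclidean_laplacian_def B sum.reindex[OF inj] by (simp add: pd_def[abs_def])
qed

definition hom :: "nat \<Rightarrow> (real^5 \<Rightarrow> real) \<Rightarrow> bool" where
  "hom k p \<longleftrightarrow> (\<forall>t x. p (t *\<^sub>R x) = t ^ k * p x)"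

text \<open>Differentiating p(t x) = t^(k+1) p(x) in x yields t times the claim; the factor cancels
  for nonzero t, and t = 0 follows by continuity.\<close>

lemma hom_pd:
  assumes p: "poly_fun p" and h: "hom (Suc k) p"
  shows "hom k (pd i p)"
  unfolding hom_def
proof (intro allI)
  fix t :: real and x
  have nz: "pd i p (t *\<^sub>R x) = t ^ k * pd i p x" if "t \<noteq> 0" for t
  proof -
    have "((\<lambda>x. p (t *\<^sub>R x)) has_derivative (\<lambda>h. \<Sum>j\<in>UNIV. (t *\<^sub>R h) $ j * pd j p (t *\<^sub>R x))) (at x)"
      by (rule has_derivative_compose[of "\<lambda>x. t *\<^sub>R x", OF _ has_derivative_pd])
        (auto intro!: derivative_eq_intros poly_differentiable p)
    then have "pd i (\<lambda>x. p (t *\<^sub>R x)) x = t * pd i p (t *\<^sub>R x)"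
      by (subst pd_eqI, assumption) (simp add: mult.assoc sum_distrib_left[symmetric] sum_axis)
    moreover have "(\<lambda>x. p (t *\<^sub>R x)) = (\<lambda>x. t ^ Suc k * p x)"
      using h by (simp add: hom_def)
    moreover have "pd i (\<lambda>x. t ^ Suc k * p x) x = t ^ Suc k * pd i p x"
      by (rule pd_cmult[OF poly_differentiable[OF p]])
    ultimately have "t * pd i p (t *\<^sub>R x) = t * (t ^ k * pd i p x)" by simp
    then show ?thesis using that by simp
  qed
  show "pd i p (t *\<^sub>R x) = t ^ k * pd i p x"
  proof (cases "t = 0")
    case True
    have c: "continuous_on UNIV (\<lambda>t. pd i p (t *\<^sub>R x))"
      by (intro continuous_on_compose2[OF poly_continuous[OF poly_pd[OF p], of UNIV]] continuous_intros) auto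
    have "((\<lambda>t. pd i p (t *\<^sub>R x)) \<longlongrightarrow> pd i p (0 *\<^sub>R x)) (at 0)"
      using c unfolding continuous_on_def by (drule_tac x = 0 in bspec) auto
    moreover have "((\<lambda>t. t ^ k * pd i p x) \<longlongrightarrow> 0 ^ k * pd i p x) (at 0)"
      by (intro tendsto_intros)
    then have "((\<lambda>t. pd i p (t *\<^sub>R x)) \<longlongrightarrow> 0 ^ k * pd i p x) (at 0)"
      by (rule Lim_transform_eventually) (auto simp: eventually_at_filter nz)
    ultimately show ?thesis
      unfolding True by (rule tendsto_unique[rotated]) simp
  qed (rule nz)
qed

text \<open>With t = 0 the definition reads \<open>p 0 = p x\<close>, because
  \<open>0 ^ 0 = 1\<close>.\<close>

lemma hom_0_const: "hom 0 p \<Longrightarrow> p = (\<lambda>x. p 0)"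
  unfolding hom_def by (rule ext) (metis mult_1 power_0 scaleR_zero_left)

lemma hom_0_pd: "hom 0 p \<Longrightarrow> pd i p = (\<lambda>x. 0)"
  by (subst hom_0_const) auto

text \<open>Two evaluations of the derivative of p(t x) at t = 1.\<close>

lemma euler:
  assumes p: "poly_fun p" and h: "hom k p"
  shows "(\<Sum>i\<in>UNIV. x $ i * pd i p x) = real k * p x"
proof -
  have "((\<lambda>t. p (t *\<^sub>R x)) has_derivative (\<lambda>h. \<Sum>i\<in>UNIV. (h *\<^sub>R x) $ i * pd i p (1 *\<^sub>R x))) (at 1)"
    by (rule has_derivative_compose[of "\<lambda>t. t *\<^sub>R x", OF _ has_derivative_pd])
      (auto intro!: derivative_eq_intros poly_differentiable p)
  then have "((\<lambda>t. p (t *\<^sub>R x)) has_real_derivative (\<Sum>i\<in>UNIV. x $ i * pd i p x)) (at 1)"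
    by (simp add: has_field_derivative_def mult.assoc sum_distrib_left[symmetric] mult.commute[of _ "sum _ _"])
  moreover have "((\<lambda>t. p (t *\<^sub>R x)) has_real_derivative (real k * p x)) (at 1)"
    using h unfolding hom_def by (auto intro!: derivative_eq_intros)
  ultimately show ?thesis by (rule DERIV_unique)
qed

definition harmonic_poly :: "nat \<Rightarrow> (real^5 \<Rightarrow> real) \<Rightarrow> bool" where
  "harmonic_poly k p \<longleftrightarrow> poly_fun p \<and> hom k p \<and> (\<forall>x. euclidean_laplacian p x = 0)"

lemma harmonics_eq: "harmonics k = class_of ` {p. harmonic_poly k p}"
  unfolding harmonics_def harmonic_poly_def hom_def by auto

lemma harmonic_poly_poly: "harmonic_poly k p \<Longrightarrow> poly_fun p"
  by (simp add: harmonic_poly_def)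

lemma laplacian_add:
  assumes p: "poly_fun p" and q: "poly_fun q"
  shows "euclidean_laplacian (\<lambda>x. p x + q x) x = euclidean_laplacian p x + euclidean_laplacian q x"
proof -
  have "pd i (\<lambda>x. p x + q x) = (\<lambda>x. pd i p x + pd i q x)" for i
    by (rule ext, rule pd_add) (auto intro: poly_differentiable p q)
  then show ?thesis
    by (simp add: euclidean_laplacian_pd pd_add poly_pd_differentiable p q sum.distrib)
qed

lemma laplacian_cmult:
  assumes p: "poly_fun p"
  shows "euclidean_laplacian (\<lambda>x. c * p x) x = c * euclidean_laplacian p x"
proof -
  have "pd i (\<lambda>x. c * p x) = (\<lambda>x. c * pd i p x)" for i
    by (rule ext, rule pd_cmult) (auto intro: poly_differentiable p)
  then show ?thesis
    by (simp add: euclidean_laplacian_pd pd_cmult poly_pd_differentiable p sum_distrib_left)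
qed

lemma laplacian_sum:
  assumes "finite I" "\<And>a. a \<in> I \<Longrightarrow> poly_fun (f a)"
  shows "euclidean_laplacian (\<lambda>x. \<Sum>a\<in>I. f a x) x = (\<Sum>a\<in>I. euclidean_laplacian (f a) x)"
  using assms
proof (induction I arbitrary: x rule: finite_induct)
  case empty
  then show ?case by (simp add: euclidean_laplacian_pd)
next
  case (insert a I)
  then show ?case
    using laplacian_add[of "f a" "\<lambda>x. \<Sum>a\<in>I. f a x" x] by (auto simp: real_polynomial_function_sum)
qed

lemma laplacian_coord_mult:
  assumes p: "poly_fun p"
  shows "euclidean_laplacian (\<lambda>x. x $ i * p x) x = 2 * pd i p x + x $ i * euclidean_laplacian p x"
proof -
  have "pd j (\<lambda>x. x $ i * p x) = (\<lambda>x. x $ i * pd j p x + (if j = i then 1 else 0) * p x)" for j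
    by (rule ext) (simp only: pd_mult[OF coord_differentiable poly_differentiable[OF p]] pd_coord)
  moreover have "pd j (\<lambda>x. x $ i * pd j p x + (if j = i then 1 else 0) * p x) x
      = x $ i * pd j (pd j p) x + (if j = i then 2 * pd j p x else 0)" for j
    by (subst pd_add) (auto simp: pd_mult pd_coord p poly_pd_differentiable poly_differentiable
        intro!: differentiable_mult)
  ultimately show ?thesis
    by (simp add: euclidean_laplacian_pd sum.distrib sum_distrib_left)
qed

lemma laplacian_pd:
  assumes p: "poly_fun p"
  shows "euclidean_laplacian (pd i p) x = pd i (euclidean_laplacian p) x"
proof -
  have "pd i (euclidean_laplacian p) x = (\<Sum>j\<in>UNIV. pd i (pd j (pd j p)) x)"
    unfolding euclidean_laplacian_pd[abs_def]
    by (rule pd_sum) (auto intro: poly_pd_differentiable poly_pd p)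
  also have "\<dots> = (\<Sum>j\<in>UNIV. pd j (pd j (pd i p)) x)"
    by (simp add: pd_commute[of "pd _ p" i] pd_commute[of p i] poly_pd p)
  finally show ?thesis by (simp add: euclidean_laplacian_pd)
qed

lemma harmonic_poly_zero: "harmonic_poly k (\<lambda>x. 0)"
  by (auto simp: harmonic_poly_def hom_def euclidean_laplacian_pd intro: poly_const)

lemma harmonic_poly_add: "harmonic_poly k p \<Longrightarrow> harmonic_poly k q \<Longrightarrow> harmonic_poly k (\<lambda>x. p x + q x)"
  by (auto simp: harmonic_poly_def hom_def laplacian_add algebra_simps)

lemma harmonic_poly_cmult: "harmonic_poly k p \<Longrightarrow> harmonic_poly k (\<lambda>x. c * p x)"
  by (auto simp: harmonic_poly_def hom_def laplacian_cmult)

text \<open>The truncated difference is harmless: for k = 0 the derivative is the zero polynomial,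
  which is harmonic of every degree.\<close>

lemma harmonic_poly_pd:
  assumes "harmonic_poly k p"
  shows "harmonic_poly (k - 1) (pd i p)"
proof (cases k)
  case 0
  then show ?thesis using assms hom_0_pd[of p i] harmonic_poly_zero[of 0]
    by (auto simp: harmonic_poly_def)
next
  case (Suc m)
  have "euclidean_laplacian p = (\<lambda>x. 0)" using assms by (auto simp: harmonic_poly_def)
  then show ?thesis
    using assms Suc hom_pd[of p m i] by (auto simp: harmonic_poly_def poly_pd laplacian_pd)
qed

lemma rot_deriv_poly:
  "poly_fun p \<Longrightarrow> rot_deriv i j p = (\<lambda>x. x $ i * pd j p x - x $ j * pd i p x)"
  by (rule ext, rule rot_deriv_pd, rule poly_differentiable)

lemma poly_rot_deriv: "poly_fun p \<Longrightarrow> poly_fun (rot_deriv i j p)"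
  by (simp add: rot_deriv_poly real_polynomial_function_diff poly_mult poly_pd)

lemma hom_coord_pd: "poly_fun p \<Longrightarrow> hom k p \<Longrightarrow> hom k (\<lambda>x. x $ i * pd j p x)"
proof (cases k)
  case 0
  assume "hom k p"
  with 0 show ?thesis by (simp add: hom_0_pd hom_def)
next
  case (Suc m)
  assume "poly_fun p" "hom k p"
  with Suc have "hom m (pd j p)" by (simp add: hom_pd)
  with Suc show ?thesis by (simp add: hom_def)
qed

text \<open>Rotation fields commute with the Laplacian: it produces 2 d_i d_j p from one product and
  2 d_j d_i p from the other, and these cancel.\<close>

lemma harmonic_poly_rot_deriv:
  assumes "harmonic_poly k p"
  shows "harmonic_poly k (rot_deriv i j p)"
proof -
  have p: "poly_fun p" "hom k p" and lap: "euclidean_laplacian p = (\<lambda>x. 0)"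
    using assms by (auto simp: harmonic_poly_def)
  have "hom k (rot_deriv i j p)"
    using hom_coord_pd[OF p, of i j] hom_coord_pd[OF p, of j i]
    unfolding hom_def rot_deriv_poly[OF p(1)] by (metis right_diff_distrib)
  moreover have "euclidean_laplacian (rot_deriv i j p) x = 0" for x
  proof -
    have 1: "poly_fun (\<lambda>x. x $ i * pd j p x)" for i j
      using p by (auto intro: poly_pd)
    have "euclidean_laplacian (rot_deriv i j p) x =
      euclidean_laplacian (\<lambda>x. x $ i * pd j p x + (- 1) * (x $ j * pd i p x)) x"
      by (simp add: rot_deriv_poly p)
    also have "\<dots> = euclidean_laplacian (\<lambda>x. x $ i * pd j p x) x
        + (- 1) * euclidean_laplacian (\<lambda>x. x $ j * pd i p x) x"
      using laplacian_add[OF 1[of i j] poly_mult[OF poly_const[of "-1"] 1[of j i]], of x]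
        laplacian_cmult[OF 1[of j i], of "-1" x] by (simp only:)
    also have "\<dots> = 0"
      by (simp add: laplacian_coord_mult poly_pd p laplacian_pd lap pd_commute[of p i j])
    finally show ?thesis .
  qed
  ultimately show ?thesis by (simp add: harmonic_poly_def poly_rot_deriv p)
qed

text \<open>For harmonic p of degree k this is the harmonic part of degree k + 1 of
  \<open>x $ i * p x\<close>, namely x_i p - |x|^2 d_i p / (2k + 3). The Laplacian of x_i p is 2 d_i
  p, and that of |x|^2 q is (10 + 4 (k - 1)) q for harmonic q of degree k - 1; half of 4k + 6 is the
  divisor. The square |x|^2 is spelt out through double coordinate factors, so that the rule for one
  coordinate factor applies twice.\<close>

definition lift :: "5 \<Rightarrow> nat \<Rightarrow> (real^5 \<Rightarrow> real) \<Rightarrow> real^5 \<Rightarrow> real" where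
  "lift i k p x = x $ i * p x + (- (1 / (2 * real k + 3))) * (\<Sum>j\<in>UNIV. x $ j * (x $ j * pd i p x))"

lemma harmonic_poly_lift:
  assumes "harmonic_poly k p"
  shows "harmonic_poly (Suc k) (lift i k p)"
proof -
  have p: "poly_fun p" "hom k p" and lap: "euclidean_laplacian p = (\<lambda>x. 0)"
    using assms by (auto simp: harmonic_poly_def)
  have q: "poly_fun (pd i p)" "euclidean_laplacian (pd i p) = (\<lambda>x. 0)" "hom (k - 1) (pd i p)"
    using harmonic_poly_pd[OF assms, of i] by (auto simp: harmonic_poly_def)
  have "hom (Suc k) (lift i k p)"
    unfolding hom_def
  proof (intro allI)
    fix t :: real and x
    \<comment> \<open>The extra factor t avoids the exponent k - 1, which is truncated when k =
      0.\<close>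
    have "t * pd i p (t *\<^sub>R x) = t ^ k * pd i p x"
    proof (cases k)
      case 0 then show ?thesis using p by (simp add: hom_0_pd)
    next
      case (Suc m) then show ?thesis using q by (simp add: hom_def)
    qed
    then have "(t *\<^sub>R x) $ j * ((t *\<^sub>R x) $ j * pd i p (t *\<^sub>R x)) = t ^ Suc k * (x $ j * (x $ j * pd i p x))" for j
      by simp
    moreover have "(t *\<^sub>R x) $ i * p (t *\<^sub>R x) = t ^ Suc k * (x $ i * p x)"
      using p(2) by (simp add: hom_def)
    ultimately show "lift i k p (t *\<^sub>R x) = t ^ Suc k * lift i k p x"
      unfolding lift_def by (simp only: sum_distrib_left[symmetric])
        (simp only: distrib_left mult.left_commute[of "t ^ Suc k"])
  qed
  moreover have "euclidean_laplacian (lift i k p) x = 0" for x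
  proof -
    have ps: "poly_fun (\<lambda>x. x $ j * pd i p x)" "poly_fun (\<lambda>x. x $ j * (x $ j * pd i p x))" for j
      by (intro poly_mult poly_coord q)+
    have ps': "poly_fun (\<lambda>x. \<Sum>j\<in>UNIV. x $ j * (x $ j * pd i p x))"
      using ps by (intro real_polynomial_function_sum) auto
    have 1: "euclidean_laplacian (\<lambda>x. x $ j * (x $ j * pd i p x)) x = 2 * pd i p x + 4 * (x $ j * pd j (pd i p) x)" for j
      using q by (simp add: laplacian_coord_mult ps pd_mult poly_differentiable pd_coord algebra_simps)
    have "euclidean_laplacian (lift i k p) x
      = 2 * pd i p x + (- (1 / (2 * real k + 3))) * (\<Sum>j\<in>UNIV. 2 * pd i p x + 4 * (x $ j * pd j (pd i p) x))"
      unfolding lift_def laplacian_add[OF poly_mult[OF poly_coord p(1)] poly_mult[OF poly_const ps']]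
        laplacian_cmult[OF ps']
      by (simp add: laplacian_sum ps 1 laplacian_coord_mult lap p)
    also have "(\<Sum>j\<in>UNIV. 2 * pd i p x + 4 * (x $ j * pd j (pd i p) x)) = 10 * pd i p x + 4 * (real (k - 1) * pd i p x)"
      unfolding sum.distrib sum_distrib_left[symmetric] euler[OF q(1,3)] by simp
    also have "2 * pd i p x + (- (1 / (2 * real k + 3))) * (10 * pd i p x + 4 * (real (k - 1) * pd i p x)) = 0"
    proof (cases k)
      case 0 then show ?thesis using p by (simp add: hom_0_pd)
    next
      case (Suc m) then show ?thesis by (simp add: field_simps)
    qed
    finally show ?thesis .
  qed
  moreover have "poly_fun (lift i k p)"
    unfolding lift_def[abs_def] using p q
    by (intro poly_add poly_mult poly_const
        real_polynomial_function_sum poly_coord) auto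
  ultimately show ?thesis by (simp add: harmonic_poly_def)
qed

lemma sum_coord_sq: "norm x = 1 \<Longrightarrow> (\<Sum>j\<in>UNIV. x $ j * (x $ j * c)) = (c::real)" for x :: "real^5"
proof -
  assume "norm x = 1"
  then have "(\<Sum>j\<in>UNIV. x $ j * x $ j) = 1"
    using power2_norm_eq_inner[of x] by (simp add: inner_vec_def)
  then show ?thesis by (simp add: mult.assoc[symmetric] sum_distrib_right[symmetric])
qed

text \<open>On the sphere |x|^2 = 1, so for harmonic p multiplication by a coordinate splits into a
  harmonic of degree k + 1 and one of degree k - 1.\<close>

lemma coord_mult_decomp:
  "norm x = 1 \<Longrightarrow> x $ i * p x = lift i k p x + 1 / (2 * real k + 3) * pd i p x"
  by (simp add: lift_def sum_coord_sq)

section \<open>The spherical Laplacian\<close>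

lemma sum_pairs_symmetric:
  fixes F :: "'i::{finite,linorder} \<Rightarrow> 'i \<Rightarrow> real"
  assumes "\<And>i j. F i j = F j i"
  shows "(\<Sum>(i, j)\<in>{(i, j). i < j}. F i j) = ((\<Sum>i\<in>UNIV. \<Sum>j\<in>UNIV. F i j) - (\<Sum>i\<in>UNIV. F i i)) / 2"
proof -
  let ?F = "\<lambda>(i, j). F i j"
  have swap: "sum ?F {(i, j). j < i} = sum ?F {(i, j). i < j}"
    by (rule sum.reindex_bij_witness[of _ prod.swap prod.swap]) (auto simp: assms)
  have diag: "sum ?F {(i, j). i = j} = (\<Sum>i\<in>UNIV. F i i)"
    by (rule sum.reindex_bij_witness[of _ "\<lambda>i. (i, i)" fst]) auto
  have "(\<Sum>i\<in>UNIV. \<Sum>j\<in>UNIV. F i j) = sum ?F UNIV"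
    by (simp add: sum.cartesian_product)
  also have "(UNIV :: ('i \<times> 'i) set) = {(i, j). i < j} \<union> ({(i, j). j < i} \<union> {(i, j). i = j})"
    by auto
  also have "sum ?F \<dots> = sum ?F {(i, j). i < j} + (sum ?F {(i, j). j < i} + sum ?F {(i, j). i = j})"
    by (subst sum.union_disjoint, simp, simp, fastforce, subst sum.union_disjoint) auto
  finally show ?thesis by (simp add: swap diag)
qed

lemma sum_rot_deriv_squares:
  fixes f :: "real^5 \<Rightarrow> real"
  assumes S: "open S" "x \<in> S" and f: "\<And>y. y \<in> S \<Longrightarrow> f differentiable (at y)"
    and pd: "\<And>i. pd i f differentiable (at x)"
  shows "(\<Sum>(i, j)\<in>{(i, j). i < j}. rot_deriv i j (rot_deriv i j f) x) =
    inner x x * euclidean_laplacian f x - 4 * (\<Sum>i\<in>UNIV. x $ i * pd i f x)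
      - (\<Sum>i\<in>UNIV. \<Sum>j\<in>UNIV. x $ i * (x $ j * pd i (pd j f) x))"
proof -
  \<comment> \<open>The expanded square for i distinct from j, with both orders of the mixed
    derivative kept, so that it is symmetric without interchanging them. On the diagonal it is -2
    x_i d_i f instead of 0; subtracting the diagonal sum corrects this and turns the coefficient 5
    of the Euler field into 4.\<close>
  define F where "F i j = x $ i * (x $ i * pd j (pd j f) x) + x $ j * (x $ j * pd i (pd i f) x)
    - x $ i * pd i f x - x $ j * pd j f x
    - (x $ i * (x $ j * pd i (pd j f) x) + x $ j * (x $ i * pd j (pd i f) x))" for i j
  have rot: "rot_deriv i j (rot_deriv i j f) x = F i j" if "i \<noteq> j" for i j
  proof -
    have d: "(\<lambda>y. y $ i * pd j f y - y $ j * pd i f y) differentiable (at x)"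
      by (intro differentiable_diff differentiable_mult coord_differentiable pd)
    have "frechet_derivative (rot_deriv i j f) (at x)
        = frechet_derivative (\<lambda>y. y $ i * pd j f y - y $ j * pd i f y) (at x)"
      using rot_deriv_pd f
      by (intro frechet_derivative_transform_within_open[symmetric, OF d S]) auto
    then have "rot_deriv i j (rot_deriv i j f) x = rot_deriv i j (\<lambda>y. y $ i * pd j f y - y $ j * pd i f y) x"
      by (simp add: rot_deriv_def[of _ _ "rot_deriv i j f"] rot_deriv_def[of _ _ "\<lambda>y. y $ i * pd j f y - y $ j * pd i f y"])
    also have "\<dots> = F i j"
      using that unfolding rot_deriv_pd[OF d]
      by (simp add: pd_diff pd_mult differentiable_mult pd pd_coord F_def algebra_simps)
    finally show ?thesis .
  qed
  have "(\<Sum>(i, j)\<in>{(i, j). i < j}. rot_deriv i j (rot_deriv i j f) x) = (\<Sum>(i, j)\<in>{(i, j). i < j}. F i j)"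
    by (rule sum.cong) (auto simp: rot)
  also have "\<dots> = ((\<Sum>i\<in>UNIV. \<Sum>j\<in>UNIV. F i j) - (\<Sum>i\<in>UNIV. F i i)) / 2"
    by (rule sum_pairs_symmetric) (simp add: F_def)
  also have "(\<Sum>i\<in>UNIV. F i i) = - 2 * (\<Sum>i\<in>UNIV. x $ i * pd i f x)"
    by (simp add: F_def sum_distrib_left sum_negf[symmetric])
  also have "(\<Sum>i\<in>UNIV. \<Sum>j\<in>UNIV. F i j) = 2 * (inner x x * euclidean_laplacian f x)
      - 10 * (\<Sum>i\<in>UNIV. x $ i * pd i f x) - 2 * (\<Sum>i\<in>UNIV. \<Sum>j\<in>UNIV. x $ i * (x $ j * pd i (pd j f) x))"
  proof -
    have a: "(\<Sum>i\<in>UNIV. \<Sum>j\<in>UNIV. x $ i * (x $ i * pd j (pd j f) x)) = inner x x * euclidean_laplacian f x"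
      by (simp add: inner_vec_def euclidean_laplacian_pd sum_product mult.assoc)
    have b: "(\<Sum>i\<in>UNIV. \<Sum>j\<in>UNIV. x $ j * (x $ j * pd i (pd i f) x)) = inner x x * euclidean_laplacian f x"
      by (subst sum.swap) (rule a)
    have c: "(\<Sum>i\<in>UNIV. \<Sum>j\<in>(UNIV::5 set). x $ i * pd i f x) = 5 * (\<Sum>i\<in>UNIV. x $ i * pd i f x)"
      by (simp add: sum_distrib_left)
    have d: "(\<Sum>i\<in>UNIV. \<Sum>j\<in>UNIV. x $ j * (x $ i * pd j (pd i f) x)) = (\<Sum>i\<in>UNIV. \<Sum>j\<in>UNIV. x $ i * (x $ j * pd i (pd j f) x))"
      by (rule sum.swap)
    show ?thesis
      unfolding F_def sum_subtractf sum.distrib a b c d by simp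
  qed
  finally show ?thesis by simp
qed

text \<open>For a function constant along rays: differentiate the vanishing of the Euler field by
  d_i, multiply by x_i and sum. The first order terms form the Euler field again.\<close>

lemma pd_pd_euler:
  fixes f :: "real^5 \<Rightarrow> real"
  assumes S: "open S" "x \<in> S" and e: "\<And>y. y \<in> S \<Longrightarrow> (\<Sum>j\<in>UNIV. y $ j * pd j f y) = 0"
    and pd: "\<And>i. pd i f differentiable (at x)"
  shows "(\<Sum>i\<in>UNIV. \<Sum>j\<in>UNIV. x $ i * (x $ j * pd i (pd j f) x)) = 0"
proof -
  have d: "(\<lambda>y. \<Sum>j\<in>UNIV. y $ j * pd j f y) differentiable (at x)"
    by (intro differentiable_sum) (auto intro!: differentiable_mult pd)
  have "pd i f x + (\<Sum>j\<in>UNIV. x $ j * pd i (pd j f) x) = 0" for i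
  proof -
    have "frechet_derivative (\<lambda>y. \<Sum>j\<in>UNIV. y $ j * pd j f y) (at x) = frechet_derivative (\<lambda>y. 0) (at x)"
      using e by (intro frechet_derivative_transform_within_open[OF d S]) auto
    then have "pd i (\<lambda>y. \<Sum>j\<in>UNIV. y $ j * pd j f y) x = 0"
      by (simp add: pd_def)
    moreover have "pd i (\<lambda>y. \<Sum>j\<in>UNIV. y $ j * pd j f y) x = (\<Sum>j\<in>UNIV. x $ j * pd i (pd j f) x + (if j = i then pd j f x else 0))"
      by (subst pd_sum) (auto simp: pd differentiable_mult pd_mult pd_coord intro!: sum.cong)
    ultimately show ?thesis by (simp add: sum.distrib add.commute)
  qed
  then have "(\<Sum>i\<in>UNIV. x $ i * (pd i f x + (\<Sum>j\<in>UNIV. x $ j * pd i (pd j f) x))) = 0" by simp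
  then have "(\<Sum>j\<in>UNIV. x $ j * pd j f x) + (\<Sum>i\<in>UNIV. \<Sum>j\<in>UNIV. x $ i * (x $ j * pd i (pd j f) x)) = 0"
    by (simp add: distrib_left sum.distrib sum_distrib_left)
  then show ?thesis using e S by simp
qed

text \<open>Euler's identity for p and for its derivatives evaluates the Euler field as k p and the
  second radial part as k (k - 1) p, and 4 k + k (k - 1) = k (k + 3).\<close>

lemma harmonic_poly_casimir:
  assumes "harmonic_poly k p"
  shows "(\<Sum>(i, j)\<in>{(i, j). i < j}. rot_deriv i j (rot_deriv i j p) x) = - real (k * (k + 3)) * p x"
proof -
  have p: "poly_fun p" "hom k p" and lap: "euclidean_laplacian p x = 0"
    using assms by (auto simp: harmonic_poly_def)
  have "(\<Sum>i\<in>UNIV. \<Sum>j\<in>UNIV. x $ i * (x $ j * pd i (pd j p) x))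
      = (\<Sum>j\<in>UNIV. x $ j * (\<Sum>i\<in>UNIV. x $ i * pd i (pd j p) x))"
    by (subst sum.swap) (simp add: sum_distrib_left mult.left_commute)
  also have "\<dots> = (\<Sum>j\<in>UNIV. x $ j * (real (k - 1) * pd j p x))"
    using harmonic_poly_pd[OF assms] by (simp add: euler[of _ "k - 1"] harmonic_poly_def)
  also have "\<dots> = real (k - 1) * (real k * p x)"
    by (simp add: euler[OF p, symmetric] sum_distrib_left mult.left_commute)
  finally have 1: "(\<Sum>i\<in>UNIV. \<Sum>j\<in>UNIV. x $ i * (x $ j * pd i (pd j p) x)) = real (k - 1) * (real k * p x)" .
  have "(\<Sum>(i, j)\<in>{(i, j). i < j}. rot_deriv i j (rot_deriv i j p) x)
     = inner x x * euclidean_laplacian p x - 4 * (\<Sum>i\<in>UNIV. x $ i * pd i p x)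
      - (\<Sum>i\<in>UNIV. \<Sum>j\<in>UNIV. x $ i * (x $ j * pd i (pd j p) x))"
    by (rule sum_rot_deriv_squares[of UNIV]) (auto intro: poly_differentiable poly_pd_differentiable p)
  also have "\<dots> = - real (k * (k + 3)) * p x"
    unfolding 1 lap euler[OF p] by (cases k) (simp_all add: algebra_simps)
  finally show ?thesis .
qed

section \<open>Functions extended constantly along rays\<close>

abbreviation normalize :: "real^5 \<Rightarrow> real^5" where
  "normalize x \<equiv> x /\<^sub>R norm x"

lemma has_derivative_normalize:
  assumes "x \<noteq> 0"
  shows "(normalize has_derivative (\<lambda>h. (1 / norm x) *\<^sub>R (h - inner (normalize x) h *\<^sub>R normalize x))) (at x)"
proof -
  have n: "(norm has_derivative (\<lambda>h. inner h (sgn x))) (at x)"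
    using has_derivative_norm[OF assms] .
  have "(normalize has_derivative (\<lambda>h. inverse (norm x) *\<^sub>R h + (- (inverse (norm x) * inner h (sgn x) * inverse (norm x))) *\<^sub>R x)) (at x)"
    by (rule has_derivative_scaleR[OF Deriv.has_derivative_inverse[OF _ n] has_derivative_ident])
      (use assms in simp)
  also have "(\<lambda>h. inverse (norm x) *\<^sub>R h + (- (inverse (norm x) * inner h (sgn x) * inverse (norm x))) *\<^sub>R x)
    = (\<lambda>h. (1 / norm x) *\<^sub>R (h - inner (normalize x) h *\<^sub>R normalize x))"
    using assms by (simp add: fun_eq_iff sgn_div_norm inner_commute scaleR_diff_right divide_inverse mult.assoc)
  finally show ?thesis .
qed

lemma differentiable_radial:
  assumes "f differentiable (at (normalize x))" "x \<noteq> 0"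
  shows "(\<lambda>x. f (normalize x)) differentiable (at x)"
    and "frechet_derivative (\<lambda>x. f (normalize x)) (at x) v
      = frechet_derivative f (at (normalize x)) ((1 / norm x) *\<^sub>R (v - inner (normalize x) v *\<^sub>R normalize x))"
proof -
  have D: "((\<lambda>x. f (normalize x)) has_derivative (\<lambda>v. frechet_derivative f (at (normalize x))
      ((1 / norm x) *\<^sub>R (v - inner (normalize x) v *\<^sub>R normalize x)))) (at x)"
    using has_derivative_compose[OF has_derivative_normalize[OF assms(2)], of f "frechet_derivative f (at (normalize x))"] assms(1)
    by (simp add: frechet_derivative_works)
  show "(\<lambda>x. f (normalize x)) differentiable (at x)"
    using D by (rule differentiableI)
  show "frechet_derivative (\<lambda>x. f (normalize x)) (at x) v
      = frechet_derivative f (at (normalize x)) ((1 / norm x) *\<^sub>R (v - inner (normalize x) v *\<^sub>R normalize x))"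
    using fun_cong[OF frechet_derivative_at[OF D], of v] by simp
qed

lemma normalize_nonzero: "x \<noteq> 0 \<Longrightarrow> normalize x \<noteq> 0"
  by simp

text \<open>Rotation fields are tangent to spheres, so the radial correction in the derivative of
  the normalisation drops out, and they scale like x itself.\<close>

lemma rot_deriv_radial:
  assumes "f differentiable (at (normalize x))" "x \<noteq> 0"
  shows "rot_deriv i j (\<lambda>x. f (normalize x)) x = rot_deriv i j f (normalize x)"
proof -
  have "inner x (x $ i *\<^sub>R axis j 1 - x $ j *\<^sub>R axis i 1) = 0"
    by (simp add: inner_diff_right inner_axis)
  then show ?thesis
    unfolding rot_deriv_def differentiable_radial(2)[OF assms]
    by (intro arg_cong[where f = "frechet_derivative f (at (normalize x))"])
      (simp add: scaleR_diff_right divide_inverse)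
qed

abbreviation "C2 \<equiv> Ck_on (Suc (Suc 0)) (- {0})"

lemma C2_C1: "C2 f \<Longrightarrow> C1 f"
  unfolding Ck_on.simps
  by (blast intro: continuous_at_imp_continuous_on differentiable_imp_continuous_within)

lemma C2_C1_frechet: "C2 f \<Longrightarrow> C1 (\<lambda>x. frechet_derivative f (at x) v)"
  unfolding Ck_on.simps(2)[of "Suc 0"] by blast

lemma C1_cong_punctured:
  assumes f: "C1 f" and eq: "\<And>x. x \<noteq> 0 \<Longrightarrow> g x = f x"
  shows "C1 g"
proof -
  have S: "open (- {0::real^5})" by (simp add: open_Compl)
  have "frechet_derivative g (at x) = frechet_derivative f (at x)" if "x \<noteq> 0" for x
    using C1_differentiable[OF f that] that eq
    by (intro frechet_derivative_transform_within_open[symmetric, OF _ S]) auto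
  moreover have "g differentiable (at x)" if x: "x \<noteq> 0" for x
  proof -
    have "(g has_derivative frechet_derivative f (at x)) (at x)"
      using C1_differentiable[OF f x, unfolded frechet_derivative_works] S
      by (rule has_derivative_transform_within_open) (use x eq in auto)
    then show ?thesis by (rule differentiableI)
  qed
  ultimately show ?thesis
    using f continuous_on_eq[of "- {0}" "\<lambda>x. frechet_derivative f (at x) v" "\<lambda>x. frechet_derivative g (at x) v" for v]
    unfolding Ck_on.simps by (metis ComplD insertI1)
qed

lemma C2_rot_deriv:
  assumes f: "C2 f" shows "C1 (rot_deriv i j f)"
proof -
  have pd: "C1 (pd i f)" for i
    unfolding pd_def[abs_def] by (rule C2_C1_frechet[OF f])
  have "C1 (\<lambda>x. x $ i * pd j f x - x $ j * pd i f x)" (is "C1 ?g")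
    unfolding Ck_on.simps
  proof (intro conjI ballI allI)
    fix x :: "real^5" assume "x \<in> - {0}"
    then show "?g differentiable (at x)"
      by (intro differentiable_diff differentiable_mult coord_differentiable C1_differentiable[OF pd]) auto
  next
    fix v
    have "frechet_derivative ?g (at x) v = v $ i * pd j f x + x $ i * frechet_derivative (pd j f) (at x) v
      - (v $ j * pd i f x + x $ j * frechet_derivative (pd i f) (at x) v)" if "x \<noteq> 0" for x
    proof -
      have "(?g has_derivative (\<lambda>v. x $ i * frechet_derivative (pd j f) (at x) v + v $ i * pd j f x
        - (x $ j * frechet_derivative (pd i f) (at x) v + v $ j * pd i f x))) (at x)"
        using C1_differentiable[OF pd that]
        by (intro has_derivative_diff has_derivative_mult coord_has_derivative)
          (simp_all add: frechet_derivative_works)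
      from fun_cong[OF frechet_derivative_at[OF this], of v] show ?thesis by simp
    qed
    moreover have "continuous_on (- {0}) (\<lambda>x. v $ i * pd j f x + x $ i * frechet_derivative (pd j f) (at x) v
      - (v $ j * pd i f x + x $ j * frechet_derivative (pd i f) (at x) v))"
      using pd C1_continuous[OF pd] unfolding Ck_on.simps
      by (intro continuous_intros) auto
    ultimately show "continuous_on (- {0}) (\<lambda>x. frechet_derivative ?g (at x) v)"
      by (subst continuous_on_cong[OF refl]) auto
  qed
  then show ?thesis
    by (rule C1_cong_punctured) (rule rot_deriv_pd[OF C1_differentiable[OF C2_C1[OF f]]])
qed

text \<open>For the extension constant along rays the Euler field and the second radial part vanish,
  leaving |x|^2 times its Laplacian, while the rotation fields see only values near the sphere. The
  factor \<open>inner x x\<close> reflects homogeneity of degree -2.\<close>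

lemma smooth_laplacian_eq:
  assumes f: "C2 f" and x: "x \<noteq> 0"
  shows "inner x x * smooth_laplacian f x = (\<Sum>(i, j)\<in>{(i, j). i < j}. rot_deriv i j (rot_deriv i j f) (normalize x))"
proof -
  define F where "F = (\<lambda>x. f (normalize x))"
  have S: "open (- {0::real^5})" "x \<in> - {0}" using x by (auto simp: open_Compl)
  have df: "f differentiable (at (normalize y))" if "y \<noteq> 0" for y
    using C1_differentiable[OF C2_C1[OF f] normalize_nonzero[OF that]] .
  have dF: "F differentiable (at y)" if "y \<noteq> 0" for y
    unfolding F_def by (rule differentiable_radial(1)[OF df[OF that] that])
  have pd: "C1 (pd i f)" for i
    unfolding pd_def[abs_def] by (rule C2_C1_frechet[OF f])
  \<comment> \<open>The chain rule is written out because second derivatives of \<open>F\<close> are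
    needed: the explicit formula shows that the first ones are differentiable.\<close>
  have pdF: "pd i F y = (\<Sum>c\<in>UNIV. ((1 / norm y) *\<^sub>R (axis i 1 - inner (normalize y) (axis i 1) *\<^sub>R normalize y)) $ c * pd c f (normalize y))"
    if "y \<noteq> 0" for y i
    unfolding F_def pd_def[of i] differentiable_radial(2)[OF df[OF that] that]
    by (rule frechet_derivative_pd[OF df[OF that]])
  have dpd: "pd i F differentiable (at x)" for i
  proof -
    have "(\<lambda>y. \<Sum>c\<in>UNIV. ((1 / norm y) *\<^sub>R (axis i 1 - inner (normalize y) (axis i 1) *\<^sub>R normalize y)) $ c * pd c f (normalize y)) differentiable (at x)"
    proof (intro differentiable_sum differentiable_mult ballI)
      fix c :: 5
      show "(\<lambda>y. pd c f (normalize y)) differentiable (at x)"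
        by (rule differentiable_radial(1)[OF C1_differentiable[OF pd normalize_nonzero[OF x]] x])
      have n: "norm differentiable (at x)" "normalize differentiable (at x)"
        using x has_derivative_norm[OF x] has_derivative_normalize[OF x] by (auto intro: differentiableI)
      have "(\<lambda>y. 1 / norm y * (axis i 1 $ c - inner (normalize y) (axis i 1) * (normalize y $ c))) differentiable (at x)"
      proof (intro differentiable_mult differentiable_diff differentiable_divide differentiable_const n)
        show "(\<lambda>y. inner (normalize y) (axis i 1)) differentiable (at x)"
          using differentiable_compose[OF _ n(2), of "\<lambda>y. inner y (axis i 1)"]
          by (simp add: bounded_linear_imp_differentiable bounded_linear_inner_left)
        show "(\<lambda>y. normalize y $ c) differentiable (at x)"
          using differentiable_compose[OF _ n(2), of "\<lambda>y. y $ c"] by simp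
      qed (use x in auto)
      then show "(\<lambda>y. ((1 / norm y) *\<^sub>R (axis i 1 - inner (normalize y) (axis i 1) *\<^sub>R normalize y)) $ c) differentiable (at x)"
        by (simp add: mult.assoc)
    qed auto
    then have "(\<lambda>y. \<Sum>c\<in>UNIV. ((1 / norm y) *\<^sub>R (axis i 1 - inner (normalize y) (axis i 1) *\<^sub>R normalize y)) $ c * pd c f (normalize y)) differentiable (at x within - {0})"
      by (rule differentiable_at_withinI)
    then have "pd i F differentiable (at x within - {0})"
      by (rule differentiable_transform_within[of _ _ _ 1]) (use x pdF in auto)
    then show ?thesis by (simp only: at_within_open[OF S(2) S(1)])
  qed
  have e: "(\<Sum>j\<in>UNIV. y $ j * pd j F y) = 0" if "y \<noteq> 0" for y
  proof -
    have "(\<Sum>j\<in>UNIV. y $ j * pd j F y) = frechet_derivative F (at y) y"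
      by (rule frechet_derivative_pd[symmetric, OF dF[OF that]])
    also have "\<dots> = frechet_derivative f (at (normalize y)) 0"
      unfolding F_def differentiable_radial(2)[OF df[OF that] that]
      using that by (intro arg_cong[where f = "frechet_derivative f (at (normalize y))"])
        (simp add: dot_square_norm power2_eq_square mult.assoc[symmetric])
    also have "\<dots> = 0" by (simp add: frechet_derivative_pd[OF df[OF that]])
    finally show ?thesis .
  qed
  have "(\<Sum>(i, j)\<in>{(i, j). i < j}. rot_deriv i j (rot_deriv i j F) x) = inner x x * euclidean_laplacian F x"
    using sum_rot_deriv_squares[OF S, of F] pd_pd_euler[OF S, of F] dF dpd e x by simp
  moreover have "rot_deriv i j (rot_deriv i j F) x = rot_deriv i j (rot_deriv i j f) (normalize x)" for i j
  proof -
    have d: "(\<lambda>y. rot_deriv i j f (normalize y)) differentiable (at x)"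
      "rot_deriv i j f differentiable (at (normalize x))"
      using C1_differentiable[OF C2_rot_deriv[OF f] normalize_nonzero[OF x]] differentiable_radial(1)[OF _ x] by auto
    have "frechet_derivative (rot_deriv i j F) (at x) = frechet_derivative (\<lambda>y. rot_deriv i j f (normalize y)) (at x)"
      using rot_deriv_radial[OF df] unfolding F_def
      by (intro frechet_derivative_transform_within_open[symmetric, OF d(1) S]) auto
    then have "rot_deriv i j (rot_deriv i j F) x = rot_deriv i j (\<lambda>y. rot_deriv i j f (normalize y)) x"
      by (simp add: rot_deriv_def[of _ _ "rot_deriv i j F"] rot_deriv_def[of _ _ "\<lambda>y. rot_deriv i j f (normalize y)"])
    also have "\<dots> = rot_deriv i j (rot_deriv i j f) (normalize x)"
      by (rule rot_deriv_radial[OF d(2) x])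
    finally show ?thesis .
  qed
  ultimately show ?thesis by (simp add: smooth_laplacian_def F_def)
qed

section \<open>The decomposition into spherical harmonics\<close>

lemma square_integrable_coord_mult:
  "square_integrable f \<Longrightarrow> square_integrable (\<lambda>x. x $ i * f x)"
proof (rule square_integrable_bounded_mult[of _ _ 1])
  show "(\<lambda>x::real^5. x $ i) \<in> borel_measurable borel" by measurable
  show "\<bar>x $ i\<bar> \<le> 1" if "norm x = 1" for x :: "real^5"
    using component_le_norm_cart[of x i] that by simp
qed

definition coord_mult :: "5 \<Rightarrow> l2_S4 \<Rightarrow> l2_S4" where
  "coord_mult i \<Phi> = class_of (\<lambda>x. x $ i * rep_l2_S4 \<Phi> x)"

lemma coord_mult_class:
  assumes f: "square_integrable f"
  shows "coord_mult i (class_of f) = class_of (\<lambda>x. x $ i * f x)"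
  unfolding coord_mult_def
proof (rule class_eqI)
  show "AE x in surf. x $ i * rep_l2_S4 (class_of f) x = x $ i * f x"
    using rep_class[OF f] by eventually_elim simp
qed (intro square_integrable_coord_mult square_integrable_rep f)+

lemma linear_coord_mult: "linear (coord_mult i)"
proof (rule linearI)
  fix \<Phi> \<Psi> :: l2_S4 and c
  obtain f g where f: "square_integrable f" "\<Phi> = class_of f" and g: "square_integrable g" "\<Psi> = class_of g"
    using class_rep square_integrable_rep by metis
  show "coord_mult i (\<Phi> + \<Psi>) = coord_mult i \<Phi> + coord_mult i \<Psi>"
    using f g by (simp add: class_add[symmetric] coord_mult_class square_integrable_add
        square_integrable_coord_mult distrib_left)
  show "coord_mult i (c *\<^sub>R \<Phi>) = c *\<^sub>R coord_mult i \<Phi>"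
    using f by (simp add: class_scale[symmetric] coord_mult_class square_integrable_scale
        square_integrable_coord_mult mult.left_commute)
qed

lemma harmonic_class: "harmonic_poly k p \<Longrightarrow> class_of p \<in> harmonics k"
  by (auto simp: harmonics_eq)

lemma harmonicsE:
  assumes "Y \<in> harmonics k" obtains p where "harmonic_poly k p" "Y = class_of p"
  using assms by (auto simp: harmonics_eq)

lemma harmonic_square_integrable: "harmonic_poly k p \<Longrightarrow> square_integrable p"
  by (simp add: poly_square_integrable harmonic_poly_poly)

lemma subspace_harmonics: "subspace (harmonics k)"
proof (rule subspaceI)
  show "0 \<in> harmonics k"
    using harmonic_class[OF harmonic_poly_zero] by (simp add: class_zero)
  fix Y Z c assume Y: "Y \<in> harmonics k"
  then obtain p where p: "harmonic_poly k p" "Y = class_of p" by (rule harmonicsE)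
  show "c *\<^sub>R Y \<in> harmonics k"
    using harmonic_class[OF harmonic_poly_cmult[OF p(1), of c]] p
    by (simp add: class_scale harmonic_square_integrable)
  assume "Z \<in> harmonics k"
  then obtain q where q: "harmonic_poly k q" "Z = class_of q" by (rule harmonicsE)
  show "Y + Z \<in> harmonics k"
    using harmonic_class[OF harmonic_poly_add[OF p(1) q(1)]] p q
    by (simp add: class_add harmonic_square_integrable)
qed

lemma coord_mult_harmonic:
  assumes "harmonic_poly k p"
  shows "coord_mult i (class_of p) = class_of (lift i k p) + (1 / (2 * real k + 3)) *\<^sub>R class_of (pd i p)"
proof -
  have sq: "square_integrable p" "square_integrable (lift i k p)" "square_integrable (pd i p)"
    using assms harmonic_poly_lift[OF assms] harmonic_poly_pd[OF assms]
    by (auto intro: harmonic_square_integrable)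
  have "class_of (\<lambda>x. x $ i * p x) = class_of (\<lambda>x. lift i k p x + 1 / (2 * real k + 3) * pd i p x)"
    by (intro class_eqI square_integrable_coord_mult square_integrable_add square_integrable_scale sq
        AE_surf_sphereI coord_mult_decomp)
  then show ?thesis
    by (simp only: coord_mult_class class_add square_integrable_scale sq class_scale)
qed

lemma euler_class:
  assumes "harmonic_poly k p"
  shows "(\<Sum>i\<in>UNIV. coord_mult i (class_of (pd i p))) = real k *\<^sub>R class_of p"
proof -
  have sq: "square_integrable p" "square_integrable (pd i p)" for i
    using assms harmonic_poly_pd[OF assms] by (auto intro: harmonic_square_integrable)
  have "(\<Sum>i\<in>UNIV. coord_mult i (class_of (pd i p))) = (\<Sum>i\<in>UNIV. class_of (\<lambda>x. x $ i * pd i p x))"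
    by (simp add: coord_mult_class sq)
  also have "\<dots> = class_of (\<lambda>x. \<Sum>i\<in>UNIV. x $ i * pd i p x)"
    using class_sum[of UNIV "\<lambda>i x. x $ i * pd i p x"] by (simp add: square_integrable_coord_mult sq)
  also have "\<dots> = class_of (\<lambda>x. real k * p x)"
    using assms by (simp add: euler[of p k] harmonic_poly_def)
  finally show ?thesis by (simp add: class_scale sq)
qed

text \<open>Euler's identity writes a harmonic of degree k + 1 as a combination of the x_i d_i p,
  with d_i p harmonic of degree k.\<close>

lemma harmonics_Suc_subset:
  "harmonics (Suc k) \<subseteq> span (\<Union>i. coord_mult i ` harmonics k)"
proof
  fix Y assume "Y \<in> harmonics (Suc k)"
  then obtain p where p: "harmonic_poly (Suc k) p" "Y = class_of p" by (rule harmonicsE)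
  have "(\<Sum>i\<in>UNIV. coord_mult i (class_of (pd i p))) \<in> span (\<Union>i. coord_mult i ` harmonics k)"
    using harmonic_poly_pd[OF p(1)] by (intro span_sum span_base) (auto intro: harmonic_class)
  then have "(1 / real (Suc k)) *\<^sub>R (\<Sum>i\<in>UNIV. coord_mult i (class_of (pd i p))) \<in> span (\<Union>i. coord_mult i ` harmonics k)"
    by (rule span_scale)
  then show "Y \<in> span (\<Union>i. coord_mult i ` harmonics k)"
    unfolding euler_class[OF p(1)] p(2) by simp
qed

lemma harmonic_poly_one: "harmonic_poly 0 (\<lambda>x. 1)"
  by (simp add: harmonic_poly_def hom_def euclidean_laplacian_pd poly_const)

lemma harmonics_0: "harmonics 0 = span {class_of (\<lambda>x. 1)}"
proof
  show "span {class_of (\<lambda>x. 1)} \<subseteq> harmonics 0"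
    by (rule span_minimal) (auto intro: harmonic_class harmonic_poly_one subspace_harmonics)
  show "harmonics 0 \<subseteq> span {class_of (\<lambda>x. 1)}"
  proof
    fix Y assume "Y \<in> harmonics 0"
    then obtain p where p: "harmonic_poly 0 p" "Y = class_of p" by (rule harmonicsE)
    have "p = (\<lambda>x. p 0 * 1)"
      using hom_0_const[of p] p(1) by (simp add: harmonic_poly_def)
    then have "Y = p 0 *\<^sub>R class_of (\<lambda>x. 1)"
      using p(2) class_scale[OF harmonic_square_integrable[OF harmonic_poly_one], of "p 0"] by metis
    then show "Y \<in> span {class_of (\<lambda>x. 1)}" by (simp add: span_base span_scale)
  qed
qed

text \<open>Induction on the degree encloses the space in the span of finitely many classes; a
  maximal independent subset is then finite. No dimension formula enters.\<close>

lemma harmonics_finite: "\<exists>B. finite B \<and> harmonics k = span B"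
proof -
  have "\<exists>B. finite B \<and> harmonics k \<subseteq> span B"
  proof (induction k)
    case 0
    then show ?case using harmonics_0 by blast
  next
    case (Suc k)
    then obtain B where B: "finite B" "harmonics k \<subseteq> span B" by blast
    have "coord_mult i ` harmonics k \<subseteq> span (\<Union>i. coord_mult i ` B)" for i
    proof -
      have "coord_mult i ` harmonics k \<subseteq> span (coord_mult i ` B)"
        using B linear_span_image[OF linear_coord_mult, of i B] by blast
      also have "\<dots> \<subseteq> span (\<Union>i. coord_mult i ` B)"
        by (rule span_mono) auto
      finally show ?thesis .
    qed
    then have "span (\<Union>i. coord_mult i ` harmonics k) \<subseteq> span (\<Union>i. coord_mult i ` B)"
      by (intro span_minimal subspace_span) auto
    then show ?case
      using B harmonics_Suc_subset[of k] by (intro exI[of _ "\<Union>i. coord_mult i ` B"]) auto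
  qed
  then obtain B where B: "finite B" "harmonics k \<subseteq> span B" by blast
  obtain C where C: "C \<subseteq> harmonics k" "independent C" "harmonics k \<subseteq> span C"
    using maximal_independent_subset[of "harmonics k"] by blast
  have "finite C"
    using independent_span_bound[OF B(1) C(2)] C(1) B(2) by blast
  moreover have "harmonics k = span C"
    using C span_minimal[OF C(1) subspace_harmonics] by blast
  ultimately show ?thesis by blast
qed

lemma inner_rot_deriv_poly:
  assumes "poly_fun p" "poly_fun q"
  shows "inner (class_of p) (class_of (rot_deriv i j q)) = - inner (class_of (rot_deriv i j p)) (class_of q)"
  using assms by (intro rot_deriv_by_parts_class poly_Ck)

lemma casimir_class:
  assumes "harmonic_poly k p"
  shows "(\<Sum>(i, j)\<in>{(i, j). i < j}. class_of (rot_deriv i j (rot_deriv i j p))) = - real (k * (k + 3)) *\<^sub>R class_of p"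
proof -
  have sq: "square_integrable (rot_deriv i j (rot_deriv i j p))" for i j
    using harmonic_poly_rot_deriv[OF harmonic_poly_rot_deriv[OF assms]] by (rule harmonic_square_integrable)
  have "(\<Sum>(i, j)\<in>{(i, j). i < j}. class_of (rot_deriv i j (rot_deriv i j p)))
    = class_of (\<lambda>x. \<Sum>(i, j)\<in>{(i, j). i < j}. rot_deriv i j (rot_deriv i j p) x)"
    using class_sum[of "{(i, j). i < j}" "\<lambda>(i, j). rot_deriv i j (rot_deriv i j p)"] sq
    by (simp add: case_prod_unfold)
  also have "\<dots> = class_of (\<lambda>x. - real (k * (k + 3)) * p x)"
    by (simp only: harmonic_poly_casimir[OF assms])
  finally show ?thesis
    by (simp only: class_scale harmonic_square_integrable[OF assms])
qed

text \<open>Moving one rotation derivative across yields minus the sum of squares, which acts on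
  \<open>p\<close> as a scalar. As \<open>q\<close> is an arbitrary polynomial, two harmonics can
  exchange roles, which makes distinct degrees orthogonal; \<open>q = p\<close> is the Dirichlet
  form.\<close>

lemma sum_inner_rot_deriv:
  assumes p: "harmonic_poly k p" and q: "poly_fun q"
  shows "(\<Sum>(i, j)\<in>{(i, j). i < j}. inner (class_of (rot_deriv i j p)) (class_of (rot_deriv i j q)))
    = real (k * (k + 3)) * inner (class_of p) (class_of q)"
proof -
  have "(\<Sum>(i, j)\<in>{(i, j). i < j}. inner (class_of (rot_deriv i j p)) (class_of (rot_deriv i j q)))
    = - inner (\<Sum>(i, j)\<in>{(i, j). i < j}. class_of (rot_deriv i j (rot_deriv i j p))) (class_of q)"
    by (simp add: inner_rot_deriv_poly poly_rot_deriv harmonic_poly_poly[OF p] q inner_sum_left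
        case_prod_unfold sum_negf)
  then show ?thesis by (simp add: casimir_class[OF p])
qed

lemma eigenvalue_inj: "k * (k + 3) = m * (m + 3) \<longleftrightarrow> k = (m::nat)"
proof
  assume eq: "k * (k + 3) = m * (m + 3)"
  show "k = m"
  proof (rule linorder_cases[of k m])
    assume "k < m" then have "k * (k + 3) < m * (m + 3)" by (intro mult_strict_mono) auto
    with eq show ?thesis by simp
  next
    assume "m < k" then have "m * (m + 3) < k * (k + 3)" by (intro mult_strict_mono) auto
    with eq show ?thesis by simp
  qed
qed simp

lemma harmonics_orthogonal:
  assumes "Y \<in> harmonics k" "Z \<in> harmonics m" "k \<noteq> m"
  shows "inner Y Z = 0"
proof -
  obtain p q where p: "harmonic_poly k p" "Y = class_of p" and q: "harmonic_poly m q" "Z = class_of q"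
    using assms by (meson harmonicsE)
  have "real (k * (k + 3)) * inner Y Z = real (m * (m + 3)) * inner Z Y"
    using sum_inner_rot_deriv[OF p(1) harmonic_poly_poly[OF q(1)]]
      sum_inner_rot_deriv[OF q(1) harmonic_poly_poly[OF p(1)]]
    by (simp only: p(2) q(2)) (simp only: inner_commute)
  then have "(real (k * (k + 3)) - real (m * (m + 3))) * inner Y Z = 0"
    by (simp add: inner_commute algebra_simps)
  then show ?thesis
    using assms(3) eigenvalue_inj[of k m] by (metis mult_eq_0_iff of_nat_eq_iff right_minus_eq)
qed

text \<open>The span of all harmonics contains 1 and is stable under multiplication by coordinates,
  by the splitting into neighbouring degrees.\<close>

lemma class_poly_in_span: "poly_fun p \<Longrightarrow> class_of p \<in> span (\<Union>k. harmonics k)"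
proof -
  define W where "W = span (\<Union>k. harmonics k)"
  define G where "G = {f. square_integrable f \<and> class_of f \<in> W}"
  have "coord_mult i ` (\<Union>k. harmonics k) \<subseteq> W" for i
  proof safe
    fix k Y assume "Y \<in> harmonics k"
    then obtain p where p: "harmonic_poly k p" "Y = class_of p" by (rule harmonicsE)
    show "coord_mult i Y \<in> W"
      unfolding p(2) coord_mult_harmonic[OF p(1)] W_def
      using harmonic_class[OF harmonic_poly_lift[OF p(1)]] harmonic_class[OF harmonic_poly_pd[OF p(1)]]
      by (intro span_add span_scale) (blast intro: span_base)+
  qed
  then have W: "coord_mult i ` W \<subseteq> W" for i
    using span_minimal[of "coord_mult i ` (\<Union>k. harmonics k)" W]
    unfolding W_def linear_span_image[OF linear_coord_mult] by auto
  have coord: "(\<lambda>x. x $ i * f x) \<in> G" if "f \<in> G" for f i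
    using that W[of i] coord_mult_class[of f i]
    by (auto simp: G_def intro: square_integrable_coord_mult)
  have G_add: "(\<lambda>x. f x + g x) \<in> G" if "f \<in> G" "g \<in> G" for f g
    using that by (auto simp: G_def class_add square_integrable_add W_def intro: span_add)
  have scale: "(\<lambda>x. c * f x) \<in> G" if "f \<in> G" for f c
    using that by (auto simp: G_def class_scale square_integrable_scale W_def intro: span_scale)
  have sum: "(\<lambda>x. \<Sum>i\<in>I. f i x) \<in> G" if "finite I" "\<And>i. i \<in> I \<Longrightarrow> f i \<in> G" for f and I :: "5 set"
    using that
  proof (induction I rule: finite_induct)
    case empty
    then show ?case by (simp add: G_def class_zero W_def span_zero square_integrable_zero)
  qed (auto intro: G_add)
  \<comment> \<open>Multiplication by \<open>p\<close> is shown to preserve \<open>G\<close>, rather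
    than \<open>p\<close> to belong to \<open>G\<close>, so that the product case is a
    composition.\<close>
  have "(\<lambda>x. p x * f x) \<in> G" if "poly_fun p" "f \<in> G" for p f
    using that
  proof (induction p arbitrary: f rule: real_polynomial_function.induct)
    case (linear p)
    then have lin: "linear p" by (simp add: bounded_linear.linear)
    have "p x * f x = (\<Sum>i\<in>UNIV. p (axis i 1) * (x $ i * f x))" for x
    proof -
      have "p x = p (\<Sum>i\<in>UNIV. x $ i *\<^sub>R axis i 1)"
        using basis_expansion[of x] by (simp add: scalar_mult_eq_scaleR)
      also have "\<dots> = (\<Sum>i\<in>UNIV. x $ i * p (axis i 1))"
        by (simp add: linear_sum[OF lin] linear_scale[OF lin])
      finally show ?thesis by (simp add: sum_distrib_left mult_ac)
    qed
    then show ?case using sum[of UNIV "\<lambda>i x. p (axis i 1) * (x $ i * f x)"] scale[OF coord[OF linear(2)]] by simp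
  next
    case (const c)
    then show ?case by (intro scale)
  next
    case (add p q)
    then show ?case using G_add[of "\<lambda>x. p x * f x" "\<lambda>x. q x * f x"] by (simp add: distrib_right)
  next
    case (mult p q)
    from mult.IH(1)[OF mult.IH(2)[OF mult.prems]] show ?case by (simp add: ab_semigroup_mult_class.mult_ac(1))
  qed
  moreover have "(\<lambda>x. 1) \<in> G"
    using harmonic_class[OF harmonic_poly_one] harmonic_square_integrable[OF harmonic_poly_one]
    by (auto simp: G_def W_def intro: span_base)
  ultimately show "poly_fun p \<Longrightarrow> class_of p \<in> span (\<Union>k. harmonics k)"
    by (force simp: G_def W_def)
qed

text \<open>Stone-Weierstrass extends orthogonality from polynomials to continuous functions,
  cut-offs by the distance extend it to indicators of closed sets, and these generate the Borel
  sets: the positive and negative parts of \<open>f\<close> define the same measure.\<close>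

lemma orthogonal_poly_imp_zero:
  assumes f: "square_integrable f" and orth: "\<And>p. poly_fun p \<Longrightarrow> (\<integral>x. f x * p x \<partial>surf) = 0"
  shows "AE x in surf. f x = 0"
proof -
  have int: "integrable surf f" by (rule integrable_square_integrable[OF f])
  have [measurable]: "f \<in> borel_measurable borel"
    using borel_measurable_integrable[OF int] by simp
  have int_bdd: "integrable surf (\<lambda>x. f x * g x)"
    if "g \<in> borel_measurable borel" "\<And>x. norm x = 1 \<Longrightarrow> \<bar>g x\<bar> \<le> B" for g B
    using integrable_square_integrable[OF square_integrable_bounded_mult[OF f that]]
    by (simp add: mult.commute)
  have cont: "(\<integral>x. f x * g x \<partial>surf) = 0" if g: "continuous_on UNIV g" for g
  proof (rule ccontr)
    define I where "I = (\<integral>x. \<bar>f x\<bar> \<partial>surf)"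
    assume neq: "(\<integral>x. f x * g x \<partial>surf) \<noteq> 0"
    have I: "I \<ge> 0" by (simp add: I_def)
    \<comment> \<open>Replacing \<open>g\<close> by a polynomial within \<open>e\<close> changes the
      integral by at most \<open>I * e\<close>, less than half its absolute value. The summand 1
      covers I = 0.\<close>
    define e where "e = \<bar>\<integral>x. f x * g x \<partial>surf\<bar> / (2 * (I + 1))"
    have e: "e > 0" using neq I by (simp add: e_def)
    obtain p where p: "poly_fun p" "\<And>x. x \<in> sphere 0 1 \<Longrightarrow> \<bar>g x - p x\<bar> < e"
      using Stone_Weierstrass_real_polynomial_function[of "sphere 0 1" g e]
        continuous_on_subset[OF g] e by auto
    have c: "continuous_on (- {0}) g" "continuous_on (- {0}) p"
      using continuous_on_subset[OF g] poly_continuous[OF p(1)] by auto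
    have ig: "integrable surf (\<lambda>x. f x * g x)"
      using bounded_on_sphere[OF c(1)] int_bdd[OF measurable_continuous_punctured[OF c(1)]] by metis
    have ip: "integrable surf (\<lambda>x. f x * p x)"
      using bounded_on_sphere[OF c(2)] int_bdd[OF measurable_continuous_punctured[OF c(2)]] by metis
    have "\<bar>\<integral>x. f x * g x \<partial>surf\<bar> = \<bar>\<integral>x. f x * g x - f x * p x \<partial>surf\<bar>"
      by (simp add: Bochner_Integration.integral_diff[OF ig ip] orth[OF p(1)])
    also have "\<dots> \<le> (\<integral>x. \<bar>f x * g x - f x * p x\<bar> \<partial>surf)"
      by (rule integral_abs_bound)
    also have "\<dots> \<le> (\<integral>x. \<bar>f x\<bar> * e \<partial>surf)"
    proof (rule integral_mono_AE)
      show "AE x in surf. \<bar>f x * g x - f x * p x\<bar> \<le> \<bar>f x\<bar> * e"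
      proof (rule AE_surf_sphereI)
        fix x :: "real^5" assume "norm x = 1"
        then have "\<bar>g x - p x\<bar> \<le> e" using p(2)[of x] by simp
        then show "\<bar>f x * g x - f x * p x\<bar> \<le> \<bar>f x\<bar> * e"
          by (simp add: right_diff_distrib[symmetric] abs_mult mult_left_mono)
      qed
    qed (use ig ip int in auto)
    also have "\<dots> = I * e" by (simp add: I_def)
    also have "\<dots> < 2 * (I + 1) * e" using I e by (intro mult_strict_right_mono) auto
    also have "\<dots> = \<bar>\<integral>x. f x * g x \<partial>surf\<bar>" using I by (simp add: e_def field_simps)
    finally show False by simp
  qed
  have closed: "(\<integral>x. f x * indicator C x \<partial>surf) = 0" if C: "closed C" for C
  proof (cases "C = {}")
    case False
    define g where "g n x = max 0 (1 - real n * infdist x C)" for n x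
    have gc: "continuous_on UNIV (g n)" for n
      unfolding g_def by (intro continuous_intros)
    have [measurable]: "g n \<in> borel_measurable borel" for n
      using gc by (rule borel_measurable_continuous_onI)
    have gb: "0 \<le> g n x" "g n x \<le> 1" for n x
      by (auto simp: g_def infdist_nonneg)
    have "(\<lambda>n. \<integral>x. f x * g n x \<partial>surf) \<longlonglongrightarrow> (\<integral>x. f x * indicator C x \<partial>surf)"
    proof (rule integral_dominated_convergence[where w = "\<lambda>x. \<bar>f x\<bar>"])
      show "AE x in surf. norm (f x * g n x) \<le> \<bar>f x\<bar>" for n
        using gb by (auto simp: abs_mult intro!: mult_left_le)
      have "(\<lambda>n. g n x) \<longlonglongrightarrow> indicator C x" for x
      proof (cases "x \<in> C")
        case True
        then show ?thesis by (simp add: g_def)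
      next
        case x: False
        then have d: "infdist x C > 0"
          using in_closed_iff_infdist_zero[OF C False] infdist_nonneg[of x C] by force
        obtain N where N: "1 / infdist x C < real N" using reals_Archimedean2 by blast
        have "g n x = 0" if "n \<ge> N" for n
        proof -
          have "1 < real N * infdist x C" using N d by (simp add: divide_less_eq)
          also have "\<dots> \<le> real n * infdist x C" using that d by simp
          finally show ?thesis by (simp add: g_def)
        qed
        then show ?thesis
          using x by (auto intro!: tendsto_eventually eventually_sequentiallyI[of N])
      qed
      then show "AE x in surf. (\<lambda>n. f x * g n x) \<longlonglongrightarrow> f x * indicator C x"
        by (intro AE_I2 tendsto_mult tendsto_const)
      show "(\<lambda>x. f x * indicator C x) \<in> borel_measurable surf"
        using C by (intro borel_measurable_times borel_measurable_indicator) (auto intro: borel_closed)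
    qed (use int in auto)
    then show ?thesis
      by (simp add: cont[OF gc] LIMSEQ_const_iff)
  qed simp
  have dens: "density surf (\<lambda>x. ennreal (f x)) = density surf (\<lambda>x. ennreal (- f x))"
  proof (rule measure_eqI_generator_eq[where E = "Collect closed" and \<Omega> = UNIV and A = "\<lambda>_. UNIV"])
    show "Int_stable (Collect closed)" by (auto simp: Int_stable_def)
    fix C :: "(real^5) set" assume "C \<in> Collect closed"
    then have C: "closed C" and [measurable]: "C \<in> sets borel" by auto
    have 1: "integrable surf (\<lambda>x. max 0 (f x) * indicator C x)" "integrable surf (\<lambda>x. max 0 (- f x) * indicator C x)"
      using int by (auto intro!: integrable_real_mult_indicator)
    have "f x * indicator C x = max 0 (f x) * indicator C x - max 0 (- f x) * indicator C x" for x
      by (auto simp: indicator_def max_def)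
    then have "(\<integral>x. max 0 (f x) * indicator C x \<partial>surf) = (\<integral>x. max 0 (- f x) * indicator C x \<partial>surf)"
      using closed[OF C] 1 by simp
    moreover have "emeasure (density surf (\<lambda>x. ennreal (f x))) C = ennreal (\<integral>x. max 0 (f x) * indicator C x \<partial>surf)"
    proof -
      have "emeasure (density surf (\<lambda>x. ennreal (f x))) C = (\<integral>\<^sup>+x. ennreal (max 0 (f x) * indicator C x) \<partial>surf)"
        by (subst emeasure_density) (auto intro!: nn_integral_cong simp: indicator_def max_def ennreal_neg)
      then show ?thesis using nn_integral_eq_integral[OF 1(1)] by simp
    qed
    moreover have "emeasure (density surf (\<lambda>x. ennreal (- f x))) C = ennreal (\<integral>x. max 0 (- f x) * indicator C x \<partial>surf)"
    proof -
      have "emeasure (density surf (\<lambda>x. ennreal (- f x))) C = (\<integral>\<^sup>+x. ennreal (max 0 (- f x) * indicator C x) \<partial>surf)"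
        by (subst emeasure_density) (auto intro!: nn_integral_cong simp: indicator_def max_def ennreal_neg)
      then show ?thesis using nn_integral_eq_integral[OF 1(2)] by simp
    qed
    ultimately show "emeasure (density surf (\<lambda>x. ennreal (f x))) C = emeasure (density surf (\<lambda>x. ennreal (- f x))) C"
      by simp
  next
    have "(\<integral>\<^sup>+x. ennreal (f x) \<partial>surf) \<le> (\<integral>\<^sup>+x. ennreal (norm (f x)) \<partial>surf)"
      by (intro nn_integral_mono ennreal_leI) auto
    also have "\<dots> < \<infinity>" using int by (simp add: integrable_iff_bounded)
    finally show "emeasure (density surf (\<lambda>x. ennreal (f x))) UNIV \<noteq> \<infinity>"
      by (simp add: emeasure_density)
  qed (auto simp: borel_eq_closed sets_density)
  \<comment> \<open>\<open>ennreal\<close> sends negative numbers to 0, so the two sides are the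
    positive and the negative part, which agree only if both vanish.\<close>
  have "AE x in surf. ennreal (f x) = ennreal (- f x)"
    using surf.density_unique[OF _ _ dens] by simp
  then show ?thesis
  proof eventually_elim
    case (elim x)
    then show ?case by (cases "f x \<ge> 0") (auto simp: ennreal_neg ennreal_eq_0_iff)
  qed
qed

lemma harmonics_total:
  assumes "\<And>k Y. Y \<in> harmonics k \<Longrightarrow> inner \<Phi> Y = 0"
  shows "\<Phi> = 0"
proof -
  obtain f where f: "square_integrable f" "\<Phi> = class_of f"
    using class_rep square_integrable_rep by metis
  have "(\<integral>x. f x * p x \<partial>surf) = 0" if p: "poly_fun p" for p
  proof -
    have "orthogonal \<Phi> (class_of p)"
      using assms by (intro orthogonal_to_span[OF class_poly_in_span[OF p]]) (auto simp: orthogonal_def)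
    then show ?thesis
      using inner_class[OF f(1) poly_square_integrable[OF p]] by (simp add: orthogonal_def f)
  qed
  then have "AE x in surf. f x = 0"
    by (rule orthogonal_poly_imp_zero[OF f(1)])
  then have "class_of f = class_of (\<lambda>x. 0)"
    by (intro class_eqI f square_integrable_zero)
  then show ?thesis by (simp add: f class_zero)
qed

interpretation S4: orth_decomp harmonics
  by unfold_locales (auto intro: harmonics_finite harmonics_orthogonal harmonics_total)

lemma one_neq_zero: "class_of (\<lambda>x. 1) \<noteq> 0"
proof
  assume "class_of (\<lambda>x. 1) = 0"
  moreover have "(norm (class_of (\<lambda>x. 1)))\<^sup>2 = 8 * pi\<^sup>2 / 3"
    using norm_class[OF harmonic_square_integrable[OF harmonic_poly_one]] by (simp add: measure_surf_UNIV)
  ultimately show False by simp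
qed

lemma coord_mult_sq:
  assumes "square_integrable f"
  shows "(\<Sum>i\<in>UNIV. coord_mult i (coord_mult i (class_of f))) = class_of f"
proof -
  have "(\<Sum>i\<in>UNIV. coord_mult i (coord_mult i (class_of f))) = class_of (\<lambda>x. \<Sum>i\<in>UNIV. x $ i * (x $ i * f x))"
    using class_sum[of UNIV "\<lambda>i x. x $ i * (x $ i * f x)"]
    by (simp add: coord_mult_class assms square_integrable_coord_mult)
  also have "\<dots> = class_of f"
    using class_sum[of UNIV "\<lambda>i x. x $ i * (x $ i * f x)"] assms
    by (intro class_eqI AE_surf_sphereI) (auto simp: square_integrable_coord_mult sum_coord_sq)
  finally show ?thesis .
qed

text \<open>If all \<open>lift i k p\<close> vanished on the sphere, multiplying the splitting by
  x_i and summing would give p = (k / (2k + 3)) p there, although the factor is below 1.\<close>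

lemma harmonics_nontrivial: "\<exists>Y\<in>harmonics k. Y \<noteq> 0"
proof (induction k)
  case 0
  then show ?case using harmonic_class[OF harmonic_poly_one] one_neq_zero by blast
next
  case (Suc k)
  then obtain p where p: "harmonic_poly k p" "class_of p \<noteq> 0"
    by (metis harmonicsE)
  show ?case
  proof (rule ccontr)
    assume "\<not> ?case"
    then have "class_of (lift i k p) = 0" for i
      using harmonic_class[OF harmonic_poly_lift[OF p(1)]] by blast
    then have "coord_mult i (class_of p) = (1 / (2 * real k + 3)) *\<^sub>R class_of (pd i p)" for i
      by (simp add: coord_mult_harmonic[OF p(1)])
    then have "class_of p = (1 / (2 * real k + 3)) *\<^sub>R (\<Sum>i\<in>UNIV. coord_mult i (class_of (pd i p)))"
      using coord_mult_sq[OF harmonic_square_integrable[OF p(1)]]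
      by (simp add: linear_scale[OF linear_coord_mult] scaleR_sum_right)
    also have "\<dots> = (real k / (2 * real k + 3)) *\<^sub>R class_of p"
      by (simp add: euler_class[OF p(1)])
    finally have "(1 - real k / (2 * real k + 3)) *\<^sub>R class_of p = 0"
      by (simp add: scaleR_diff_left)
    then show False using p(2) by (simp add: field_simps)
  qed
qed

lemma harmonics_1: "harmonics 1 = span (range (\<lambda>i. class_of (\<lambda>x. x $ i)))"
proof
  have "harmonic_poly 1 (\<lambda>x. x $ i)" for i
  proof -
    have "pd j (\<lambda>x. x $ i) = (\<lambda>x. if j = i then 1 else 0)" for j
      by (rule ext) (rule pd_coord)
    then show ?thesis by (simp add: harmonic_poly_def hom_def euclidean_laplacian_pd)
  qed
  then show "span (range (\<lambda>i. class_of (\<lambda>x. x $ i))) \<subseteq> harmonics 1"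
    by (intro span_minimal subspace_harmonics) (auto intro: harmonic_class)
  show "harmonics 1 \<subseteq> span (range (\<lambda>i. class_of (\<lambda>x. x $ i)))"
  proof -
    have c: "coord_mult i (class_of (\<lambda>x. 1)) = class_of (\<lambda>x. x $ i)" for i
      by (simp add: coord_mult_class harmonic_square_integrable[OF harmonic_poly_one])
    have "coord_mult i ` harmonics 0 \<subseteq> span (range (\<lambda>i. class_of (\<lambda>x. x $ i)))" for i
      unfolding harmonics_0 linear_span_image[OF linear_coord_mult, symmetric]
      by (rule span_mono) (auto simp: c)
    then have "span (\<Union>i. coord_mult i ` harmonics 0) \<subseteq> span (range (\<lambda>i. class_of (\<lambda>x. x $ i)))"
      by (intro span_minimal subspace_span) auto
    then show ?thesis using harmonics_Suc_subset[of 0] by auto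
  qed
qed

section \<open>Sobolev spaces and the Paneitz operator\<close>

text \<open>The eigenvalue of minus the Laplacian in degree k.\<close>

definition lam :: "nat \<Rightarrow> real" where
  "lam k = real (k * (k + 3))"

lemma lam_nonneg [simp]: "0 \<le> lam k"
  by (simp add: lam_def)

lemma lam_0 [simp]: "lam 0 = 0"
  by (simp add: lam_def)

lemma lam_ge_4: "k \<noteq> 0 \<Longrightarrow> 4 \<le> lam k"
proof -
  assume "k \<noteq> 0"
  then have "1 * 4 \<le> k * (k + 3)" by (intro mult_le_mono) auto
  then show ?thesis unfolding lam_def by linarith
qed

lemma smooth_C1: "smooth f \<Longrightarrow> C1 f" and smooth_C2: "smooth f \<Longrightarrow> C2 f"
  unfolding smooth_def by blast+

text \<open>Harmonics are admissible test functions and are total in L^2.\<close>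

lemma weak_rot_deriv_unique:
  assumes "has_weak_rot_deriv i j \<Phi> \<Psi>" "has_weak_rot_deriv i j \<Phi> \<Psi>'"
  shows "\<Psi> = \<Psi>'"
proof -
  have "inner (\<Psi> - \<Psi>') Y = 0" if Y: "Y \<in> harmonics k" for k Y
  proof -
    obtain p where "harmonic_poly k p" "Y = class_of p" using Y by (rule harmonicsE)
    then show ?thesis
      using assms poly_smooth[OF harmonic_poly_poly] unfolding has_weak_rot_deriv_def
      by (metis inner_diff_left neg_equal_iff_equal right_minus_eq)
  qed
  then have "\<Psi> - \<Psi>' = 0" by (rule harmonics_total)
  then show ?thesis by simp
qed

lemma weak_rot_deriv_eqI: "has_weak_rot_deriv i j \<Phi> \<Psi> \<Longrightarrow> weak_rot_deriv i j \<Phi> = \<Psi>"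
  unfolding weak_rot_deriv_def by (rule the_equality) (auto intro: weak_rot_deriv_unique)

lemma has_weak_rot_deriv_C1: "C1 f \<Longrightarrow> has_weak_rot_deriv i j (class_of f) (class_of (rot_deriv i j f))"
  unfolding has_weak_rot_deriv_def by (blast intro: rot_deriv_by_parts_class smooth_C1)

lemma weak_rot_deriv_poly: "poly_fun p \<Longrightarrow> weak_rot_deriv i j (class_of p) = class_of (rot_deriv i j p)"
  by (intro weak_rot_deriv_eqI has_weak_rot_deriv_C1 poly_Ck)

lemma weak_rot_deriv_harmonics: "Y \<in> harmonics k \<Longrightarrow> weak_rot_deriv i j Y \<in> harmonics k"
  by (elim harmonicsE) (simp add: weak_rot_deriv_poly harmonic_poly_poly harmonic_class harmonic_poly_rot_deriv)

lemma inner_weak_rot_deriv: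
  assumes "Y \<in> harmonics k" "Z \<in> harmonics m"
  shows "inner Y (weak_rot_deriv i j Z) = - inner (weak_rot_deriv i j Y) Z"
proof -
  obtain p q where p: "harmonic_poly k p" "Y = class_of p" and q: "harmonic_poly m q" "Z = class_of q"
    using assms by (meson harmonicsE)
  then show ?thesis by (simp add: weak_rot_deriv_poly harmonic_poly_poly inner_rot_deriv_poly)
qed

lemma norm_weak_rot_deriv:
  assumes "Y \<in> harmonics k"
  shows "(\<Sum>(i, j)\<in>{(i, j). i < j}. (norm (weak_rot_deriv i j Y))\<^sup>2) = lam k * (norm Y)\<^sup>2"
proof -
  obtain p where p: "harmonic_poly k p" "Y = class_of p" using assms by (rule harmonicsE)
  show ?thesis
    using sum_inner_rot_deriv[OF p(1) harmonic_poly_poly[OF p(1)]] harmonic_poly_poly[OF p(1)]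
    by (simp add: power2_norm_eq_inner weak_rot_deriv_poly p(2) lam_def)
qed

lemma sum_norm_weak_rot_deriv:
  assumes "Y \<in> harmonics k"
  shows "(\<Sum>(i, j)\<in>{(i, j). i < j}. c * (norm (weak_rot_deriv i j Y))\<^sup>2) = c * (lam k * (norm Y)\<^sup>2)"
  unfolding norm_weak_rot_deriv[OF assms, symmetric] sum_distrib_left by (rule sum.cong) auto

text \<open>The Dirichlet identity runs over pairs with i < j; the other pairs, over which
  \<open>sobolev\<close> also quantifies, follow since exchanging i and j changes only the
  sign.\<close>

lemma norm_weak_rot_deriv_le:
  assumes "Y \<in> harmonics k"
  shows "(norm (weak_rot_deriv i j Y))\<^sup>2 \<le> lam k * (norm Y)\<^sup>2"
proof -
  have less: "(norm (weak_rot_deriv i j Y))\<^sup>2 \<le> lam k * (norm Y)\<^sup>2" if "i < j" for i j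
    using member_le_sum[of "(i, j)" "{(i, j). i < j}" "\<lambda>(i, j). (norm (weak_rot_deriv i j Y))\<^sup>2"] that
    unfolding norm_weak_rot_deriv[OF assms] by auto
  obtain p where p: "harmonic_poly k p" "Y = class_of p" using assms by (rule harmonicsE)
  note pp = harmonic_poly_poly[OF p(1)]
  consider "i < j" | "i = j" | "j < i" by fastforce
  then show ?thesis
  proof cases
    case 2
    have "rot_deriv i i p = (\<lambda>x. 0)" unfolding rot_deriv_poly[OF pp] by simp
    then have "weak_rot_deriv i j Y = 0"
      unfolding p(2) weak_rot_deriv_poly[OF pp] 2 by (simp only: class_zero)
    then show ?thesis by simp
  next
    case 3
    have "rot_deriv i j p = (\<lambda>x. - rot_deriv j i p x)"
      unfolding rot_deriv_poly[OF pp] by simp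
    then have "weak_rot_deriv i j Y = - weak_rot_deriv j i Y"
      unfolding p(2) weak_rot_deriv_poly[OF pp]
      by (simp only: class_minus[OF poly_square_integrable[OF poly_rot_deriv[OF pp]]])
    then show ?thesis using less[OF 3] by simp
  qed (rule less)
qed

lemma has_weak_rot_deriv_projD:
  assumes "has_weak_rot_deriv i j \<Phi> \<Psi>"
  shows "S4.proj k \<Psi> = weak_rot_deriv i j (S4.proj k \<Phi>)"
proof (rule S4.proj_eqI)
  show "weak_rot_deriv i j (S4.proj k \<Phi>) \<in> harmonics k"
    by (rule weak_rot_deriv_harmonics) simp
  fix Z assume Z: "Z \<in> harmonics k"
  then obtain q where q: "harmonic_poly k q" "Z = class_of q" by (rule harmonicsE)
  have "inner \<Psi> Z = - inner \<Phi> (weak_rot_deriv i j Z)"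
    using assms poly_smooth[OF harmonic_poly_poly[OF q(1)]]
    by (simp add: has_weak_rot_deriv_def q weak_rot_deriv_poly harmonic_poly_poly[OF q(1)])
  also have "\<dots> = - inner (S4.proj k \<Phi>) (weak_rot_deriv i j Z)"
    by (simp add: S4.inner_proj weak_rot_deriv_harmonics Z)
  also have "\<dots> = inner (weak_rot_deriv i j (S4.proj k \<Phi>)) Z"
    by (simp add: inner_weak_rot_deriv[OF S4.proj_in Z])
  finally show "inner \<Psi> Z = inner (weak_rot_deriv i j (S4.proj k \<Phi>)) Z" .
qed

text \<open>Rotation derivatives preserve each space of harmonics, so by Parseval the weak
  formulation against a smooth \<open>f\<close> splits into degrees. Together with the converse
  above, a weak derivative is exactly a componentwise one.\<close>

lemma has_weak_rot_derivI:
  assumes "\<And>k. S4.proj k \<Psi> = weak_rot_deriv i j (S4.proj k \<Phi>)"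
  shows "has_weak_rot_deriv i j \<Phi> \<Psi>"
  unfolding has_weak_rot_deriv_def
proof (intro allI impI)
  fix f assume f: "smooth f"
  define F where "F = class_of f"
  define F' where "F' = class_of (rot_deriv i j f)"
  have F': "S4.proj k F' = weak_rot_deriv i j (S4.proj k F)" for k
    unfolding F_def F'_def by (intro has_weak_rot_deriv_projD has_weak_rot_deriv_C1 smooth_C1 f)
  have "inner (S4.proj k \<Phi>) (S4.proj k F') = - inner (S4.proj k \<Psi>) (S4.proj k F)" for k
    unfolding F' assms by (rule inner_weak_rot_deriv[OF S4.proj_in S4.proj_in])
  then have "(\<lambda>k. - inner (S4.proj k \<Psi>) (S4.proj k F)) sums inner \<Phi> F'"
    using S4.inner_sums[of \<Phi> F'] by simp
  moreover have "(\<lambda>k. - inner (S4.proj k \<Psi>) (S4.proj k F)) sums (- inner \<Psi> F)"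
    by (intro sums_minus S4.inner_sums)
  ultimately show "inner \<Phi> (class_of (rot_deriv i j f)) = - inner \<Psi> (class_of f)"
    unfolding F_def F'_def by (rule sums_unique2)
qed

text \<open>Summing the squared norms of the derivatives over i < j multiplies the contribution of
  degree k by \<open>lam k\<close>; each order of differentiability thus amounts to one factor of
  the weight.\<close>

lemma sobolev_iff: "\<Phi> \<in> sobolev m \<longleftrightarrow> summable (\<lambda>k. (1 + lam k) ^ m * (norm (S4.proj k \<Phi>))\<^sup>2)"
proof (induction m arbitrary: \<Phi>)
  case 0
  show ?case by (simp add: S4.summable_proj)
next
  case (Suc m)
  show ?case
  proof
    assume "\<Phi> \<in> sobolev (Suc m)"
    then have ex: "\<exists>\<Psi>. \<Psi> \<in> sobolev m \<and> has_weak_rot_deriv i j \<Phi> \<Psi>" for i j by auto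
    have *: "summable (\<lambda>k. (1 + lam k) ^ m * (norm (weak_rot_deriv i j (S4.proj k \<Phi>)))\<^sup>2)" for i j
    proof -
      obtain \<Psi> where \<Psi>: "\<Psi> \<in> sobolev m" "has_weak_rot_deriv i j \<Phi> \<Psi>" using ex by blast
      show ?thesis
        using \<Psi>(1) unfolding Suc has_weak_rot_deriv_projD[OF \<Psi>(2)] .
    qed
    have "summable (\<lambda>k. \<Sum>(i, j)\<in>{(i, j). i < j}. (1 + lam k) ^ m * (norm (weak_rot_deriv i j (S4.proj k \<Phi>)))\<^sup>2)"
      by (rule summable_sum) (auto intro: *)
    also have "(\<lambda>k. \<Sum>(i, j)\<in>{(i, j). i < j}. (1 + lam k) ^ m * (norm (weak_rot_deriv i j (S4.proj k \<Phi>)))\<^sup>2)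
        = (\<lambda>k. (1 + lam k) ^ m * (lam k * (norm (S4.proj k \<Phi>))\<^sup>2))"
      by (simp only: sum_norm_weak_rot_deriv[OF S4.proj_in])
    finally have s: "summable (\<lambda>k. 2 * ((1 + lam k) ^ m * (lam k * (norm (S4.proj k \<Phi>))\<^sup>2)))"
      by (rule summable_mult)
    show "summable (\<lambda>k. (1 + lam k) ^ Suc m * (norm (S4.proj k \<Phi>))\<^sup>2)"
    \<comment> \<open>The comparison starts at k = 1: in degree 0 the derivatives carry no
      information, while afterwards \<open>4 \<le> lam k\<close> gives
      \<open>1 + lam k \<le> 2 * lam k\<close>.\<close>
    proof (rule summable_comparison_test'[OF s, of 1])
      fix k :: nat assume "1 \<le> k"
      then have "1 + lam k \<le> 2 * lam k" using lam_ge_4[of k] by simp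
      then have "(1 + lam k) * ((1 + lam k) ^ m * (norm (S4.proj k \<Phi>))\<^sup>2)
          \<le> (2 * lam k) * ((1 + lam k) ^ m * (norm (S4.proj k \<Phi>))\<^sup>2)"
        by (intro mult_right_mono) auto
      then show "norm ((1 + lam k) ^ Suc m * (norm (S4.proj k \<Phi>))\<^sup>2)
          \<le> 2 * ((1 + lam k) ^ m * (lam k * (norm (S4.proj k \<Phi>))\<^sup>2))"
        by (simp add: mult_ac)
    qed
  next
    assume s: "summable (\<lambda>k. (1 + lam k) ^ Suc m * (norm (S4.proj k \<Phi>))\<^sup>2)"
    have "\<exists>\<Psi>\<in>sobolev m. has_weak_rot_deriv i j \<Phi> \<Psi>" for i j
    proof -
      have le: "(1 + lam k) ^ n * (norm (weak_rot_deriv i j (S4.proj k \<Phi>)))\<^sup>2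
          \<le> (1 + lam k) ^ Suc m * (norm (S4.proj k \<Phi>))\<^sup>2" if "n \<le> m" for n k
      proof -
        have "(norm (weak_rot_deriv i j (S4.proj k \<Phi>)))\<^sup>2 \<le> (1 + lam k) * (norm (S4.proj k \<Phi>))\<^sup>2"
          using norm_weak_rot_deriv_le[OF S4.proj_in, of i j k \<Phi>] by (simp add: distrib_right add_increasing)
        then have "(1 + lam k) ^ n * (norm (weak_rot_deriv i j (S4.proj k \<Phi>)))\<^sup>2
            \<le> (1 + lam k) ^ m * ((1 + lam k) * (norm (S4.proj k \<Phi>))\<^sup>2)"
          using that by (intro mult_mono power_increasing) auto
        then show ?thesis by (simp add: mult_ac)
      qed
      have "summable (\<lambda>k. (norm (weak_rot_deriv i j (S4.proj k \<Phi>)))\<^sup>2)"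
        using le[of 0] by (intro summable_comparison_test'[OF s, of 0]) auto
      then obtain \<Psi> where \<Psi>: "\<And>k. S4.proj k \<Psi> = weak_rot_deriv i j (S4.proj k \<Phi>)"
        using S4.synthesis[of "\<lambda>k. weak_rot_deriv i j (S4.proj k \<Phi>)"] weak_rot_deriv_harmonics by auto
      have "summable (\<lambda>k. (1 + lam k) ^ m * (norm (S4.proj k \<Psi>))\<^sup>2)"
        unfolding \<Psi> using le[of m] by (intro summable_comparison_test'[OF s, of 0]) auto
      then show ?thesis using Suc has_weak_rot_derivI[OF \<Psi>] by blast
    qed
    then show "\<Phi> \<in> sobolev (Suc m)" by simp
  qed
qed

lemma sobolev_2: "sobolev 2 = S4.diag_dom (\<lambda>k. 1 + lam k)"
  and sobolev_4: "sobolev 4 = S4.diag_dom (\<lambda>k. (1 + lam k)\<^sup>2)"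
  by (auto simp: sobolev_iff S4.diag_dom_def power_mult_distrib power_mult[symmetric])

lemma weak_rot_deriv_sobolev:
  assumes "\<Phi> \<in> sobolev (Suc m)"
  shows "weak_rot_deriv i j \<Phi> \<in> sobolev m"
    and "S4.proj k (weak_rot_deriv i j \<Phi>) = weak_rot_deriv i j (S4.proj k \<Phi>)"
proof -
  obtain \<Psi> where \<Psi>: "\<Psi> \<in> sobolev m" "has_weak_rot_deriv i j \<Phi> \<Psi>" using assms by auto
  show "weak_rot_deriv i j \<Phi> \<in> sobolev m"
    using \<Psi> weak_rot_deriv_eqI by blast
  show "S4.proj k (weak_rot_deriv i j \<Phi>) = weak_rot_deriv i j (S4.proj k \<Phi>)"
    using \<Psi> weak_rot_deriv_eqI has_weak_rot_deriv_projD by metis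
qed

text \<open>The recursive norm has the exact weight 1 + lam + ... + lam^m, because passing from m to
  m + 1 multiplies by lam and adds 1.\<close>

lemma sobolev_norm_sq_sums:
  "\<Phi> \<in> sobolev m \<Longrightarrow> (\<lambda>k. (\<Sum>n\<le>m. lam k ^ n) * (norm (S4.proj k \<Phi>))\<^sup>2) sums sobolev_norm_sq m \<Phi>"
proof (induction m arbitrary: \<Phi>)
  case 0
  then show ?case using S4.norm_sums[of \<Phi>] by simp
next
  case (Suc m)
  have "(\<lambda>k. \<Sum>(i, j)\<in>{(i, j). i < j}. (\<Sum>n\<le>m. lam k ^ n) * (norm (S4.proj k (weak_rot_deriv i j \<Phi>)))\<^sup>2)
    sums (\<Sum>(i, j)\<in>{(i, j). i < j}. sobolev_norm_sq m (weak_rot_deriv i j \<Phi>))"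
    using Suc.IH weak_rot_deriv_sobolev(1)[OF Suc.prems]
    by (intro sums_sum) (auto simp: case_prod_unfold)
  also have "(\<lambda>k. \<Sum>(i, j)\<in>{(i, j). i < j}. (\<Sum>n\<le>m. lam k ^ n) * (norm (S4.proj k (weak_rot_deriv i j \<Phi>)))\<^sup>2)
    = (\<lambda>k. (\<Sum>n\<le>m. lam k ^ n) * (lam k * (norm (S4.proj k \<Phi>))\<^sup>2))"
    by (simp only: weak_rot_deriv_sobolev(2)[OF Suc.prems] sum_norm_weak_rot_deriv[OF S4.proj_in])
  finally have "(\<lambda>k. (norm (S4.proj k \<Phi>))\<^sup>2 + (\<Sum>n\<le>m. lam k ^ n) * (lam k * (norm (S4.proj k \<Phi>))\<^sup>2))
    sums sobolev_norm_sq (Suc m) \<Phi>"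
    unfolding sobolev_norm_sq.simps by (intro sums_add S4.norm_sums)
  also have "(\<lambda>k. (norm (S4.proj k \<Phi>))\<^sup>2 + (\<Sum>n\<le>m. lam k ^ n) * (lam k * (norm (S4.proj k \<Phi>))\<^sup>2))
    = (\<lambda>k. (\<Sum>n\<le>Suc m. lam k ^ n) * (norm (S4.proj k \<Phi>))\<^sup>2)"
  proof
    fix k
    have "(\<Sum>n\<le>Suc m. lam k ^ n) = 1 + lam k * (\<Sum>n\<le>m. lam k ^ n)"
      by (simp only: sum.atMost_Suc_shift sum_distrib_left power_0 power_Suc)
    then show "(norm (S4.proj k \<Phi>))\<^sup>2 + (\<Sum>n\<le>m. lam k ^ n) * (lam k * (norm (S4.proj k \<Phi>))\<^sup>2)
      = (\<Sum>n\<le>Suc m. lam k ^ n) * (norm (S4.proj k \<Phi>))\<^sup>2"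
      by (simp add: algebra_simps del: sum.atMost_Suc)
  qed
  finally show ?case .
qed

section \<open>The distributional Laplacian and the Paneitz operator\<close>

lemma smooth_laplacian_class:
  assumes f: "C2 f"
  shows "class_of (smooth_laplacian f) = (\<Sum>(i, j)\<in>{(i, j). i < j}. class_of (rot_deriv i j (rot_deriv i j f)))"
proof -
  have c: "continuous_on (- {0}) (rot_deriv i j (rot_deriv i j f))" for i j
    by (intro C1_rot_deriv C2_rot_deriv f)
  have n: "continuous_on (- {0}) normalize"
    by (intro continuous_intros) auto
  have "continuous_on (- {0}) (\<lambda>x. (\<Sum>(i, j)\<in>{(i, j). i < j}. rot_deriv i j (rot_deriv i j f) (normalize x)) / inner x x)"
    unfolding case_prod_unfold
    by (intro continuous_on_divide continuous_on_sum continuous_on_compose2[OF c n] continuous_intros) auto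
  then have cl: "continuous_on (- {0}) (smooth_laplacian f)"
    by (rule continuous_on_eq) (simp add: smooth_laplacian_eq[OF f, symmetric])
  have s: "square_integrable (\<lambda>x. \<Sum>(i, j)\<in>{(i, j). i < j}. rot_deriv i j (rot_deriv i j f) x) \<and>
    class_of (\<lambda>x. \<Sum>(i, j)\<in>{(i, j). i < j}. rot_deriv i j (rot_deriv i j f) x)
      = (\<Sum>(i, j)\<in>{(i, j). i < j}. class_of (rot_deriv i j (rot_deriv i j f)))"
    using class_sum[of "{(i, j). i < j}" "\<lambda>(i, j). rot_deriv i j (rot_deriv i j f)"] square_integrable_continuous[OF c]
    by (simp add: case_prod_unfold)
  have "class_of (smooth_laplacian f) = class_of (\<lambda>x. \<Sum>(i, j)\<in>{(i, j). i < j}. rot_deriv i j (rot_deriv i j f) x)"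
  proof (rule class_eqI)
    show "AE x in surf. smooth_laplacian f x = (\<Sum>(i, j)\<in>{(i, j). i < j}. rot_deriv i j (rot_deriv i j f) x)"
    proof (rule AE_surf_sphereI)
      fix x :: "real^5" assume x: "norm x = 1"
      then have "x \<noteq> 0" "inner x x = 1" by (auto simp: dot_square_norm)
      then show "smooth_laplacian f x = (\<Sum>(i, j)\<in>{(i, j). i < j}. rot_deriv i j (rot_deriv i j f) x)"
        using smooth_laplacian_eq[OF f, of x] x by simp
    qed
  qed (use s square_integrable_continuous[OF cl] in auto)
  then show ?thesis using s by simp
qed

text \<open>Both derivatives are moved onto a harmonic test polynomial, where the sum of squares is
  the scalar \<open>- lam k\<close>.\<close>

lemma proj_smooth_laplacian:
  assumes f: "C2 f"
  shows "S4.proj k (class_of (smooth_laplacian f)) = - lam k *\<^sub>R S4.proj k (class_of f)"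
proof (rule S4.proj_eqI)
  show "- lam k *\<^sub>R S4.proj k (class_of f) \<in> harmonics k"
    by (intro subspace_scale subspace_harmonics S4.proj_in)
  fix Z assume Z: "Z \<in> harmonics k"
  then obtain q where q: "harmonic_poly k q" "Z = class_of q" by (rule harmonicsE)
  note qC = poly_Ck[OF harmonic_poly_poly[OF q(1)]] poly_Ck[OF poly_rot_deriv[OF harmonic_poly_poly[OF q(1)]]]
  have "inner (class_of (rot_deriv i j (rot_deriv i j f))) Z = inner (class_of (rot_deriv i j (rot_deriv i j q))) (class_of f)" for i j
    using rot_deriv_by_parts_class[OF qC(1) C2_rot_deriv[OF f], of i j i j]
      rot_deriv_by_parts_class[OF qC(2) C2_C1[OF f], of i j i j]
    by (simp only: q(2) inner_commute[of "class_of (rot_deriv i j (rot_deriv i j f))"] minus_minus)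
  then have "inner (class_of (smooth_laplacian f)) Z
      = inner (\<Sum>(i, j)\<in>{(i, j). i < j}. class_of (rot_deriv i j (rot_deriv i j q))) (class_of f)"
    by (simp add: smooth_laplacian_class[OF f] inner_sum_left case_prod_unfold)
  also have "\<dots> = - lam k * inner (class_of f) Z"
    by (simp add: casimir_class[OF q(1)] lam_def q(2) inner_commute)
  finally show "inner (class_of (smooth_laplacian f)) Z = inner (- lam k *\<^sub>R S4.proj k (class_of f)) Z"
    by (simp add: S4.inner_proj Z)
qed

text \<open>A class with these components represents the distribution by Parseval, and harmonics as
  test functions make it unique. The existence of such a class takes the place of a regularity
  condition.\<close>

lemma laplacian_eqI:
  assumes "\<And>k. S4.proj k \<Psi> = - lam k *\<^sub>R S4.proj k \<Phi>"
  shows "laplacian \<Phi> = \<Psi>"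
  unfolding laplacian_def
proof (rule the_equality)
  show *: "\<forall>f. smooth f \<longrightarrow> inner \<Phi> (class_of (smooth_laplacian f)) = inner \<Psi> (class_of f)"
  proof (intro allI impI)
    fix f assume f: "smooth f"
    have "inner (S4.proj k \<Phi>) (S4.proj k (class_of (smooth_laplacian f))) = inner (S4.proj k \<Psi>) (S4.proj k (class_of f))" for k
      by (simp add: proj_smooth_laplacian[OF smooth_C2[OF f]] assms)
    then show "inner \<Phi> (class_of (smooth_laplacian f)) = inner \<Psi> (class_of f)"
      using S4.inner_sums[of \<Phi> "class_of (smooth_laplacian f)"] S4.inner_sums[of \<Psi> "class_of f"]
      by (simp add: sums_unique2)
  qed
  fix \<Psi>' assume **: "\<forall>f. smooth f \<longrightarrow> inner \<Phi> (class_of (smooth_laplacian f)) = inner \<Psi>' (class_of f)"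
  have "inner (\<Psi>' - \<Psi>) Y = 0" if Y: "Y \<in> harmonics k" for k Y
  proof -
    obtain p where "harmonic_poly k p" "Y = class_of p" using Y by (rule harmonicsE)
    then show ?thesis
      using * ** poly_smooth[OF harmonic_poly_poly] by (simp add: inner_diff_left)
  qed
  then have "\<Psi>' - \<Psi> = 0" by (rule harmonics_total)
  then show "\<Psi>' = \<Psi>" by simp
qed

lemma proj_laplacian:
  assumes "\<Phi> \<in> sobolev 2"
  shows "S4.proj k (laplacian \<Phi>) = - lam k *\<^sub>R S4.proj k \<Phi>"
proof -
  have "\<Phi> \<in> S4.diag_dom (\<lambda>k. - lam k)"
    using assms unfolding sobolev_2 by (rule subsetD[OF S4.diag_dom_mono[of _ 1], rotated]) simp
  then obtain \<Psi> where "\<And>k. S4.proj k \<Psi> = - lam k *\<^sub>R S4.proj k \<Phi>"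
    unfolding S4.diag_dom_ex by blast
  then show ?thesis using laplacian_eqI by metis
qed

text \<open>The outer Laplacian is not evaluated through a Sobolev membership of the inner class:
  the summability in \<open>sobolev 4\<close> provides a class \<open>\<Psi>\<close> with the final
  components, and these identify it.\<close>

lemma proj_paneitz:
  assumes \<Phi>: "\<Phi> \<in> sobolev 4"
  shows "S4.proj k (paneitz \<Phi>) = (lam k * (lam k + 2)) *\<^sub>R S4.proj k \<Phi>"
proof -
  have "\<bar>1 + lam k\<bar> \<le> 1 * (\<bar>(1 + lam k)\<^sup>2\<bar> + 1)" for k
    using lam_nonneg[of k] by (simp add: power2_eq_square algebra_simps)
  then have \<Phi>2: "\<Phi> \<in> sobolev 2"
    using \<Phi> unfolding sobolev_2 sobolev_4 by (rule subsetD[OF S4.diag_dom_mono])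
  define \<Theta> where "\<Theta> = - laplacian \<Phi> + 2 *\<^sub>R \<Phi>"
  have \<Theta>: "S4.proj k \<Theta> = (lam k + 2) *\<^sub>R S4.proj k \<Phi>" for k
    unfolding \<Theta>_def
    by (simp only: S4.proj_add S4.proj_minus S4.proj_scaleR proj_laplacian[OF \<Phi>2] scaleR_add_left scaleR_minus_left minus_minus)
  have "\<bar>- (lam k * (lam k + 2))\<bar> \<le> 1 * (\<bar>(1 + lam k)\<^sup>2\<bar> + 1)" for k
    using lam_nonneg[of k] mult_nonneg_nonneg[OF lam_nonneg[of k] lam_nonneg[of k]]
    by (simp add: power2_eq_square algebra_simps abs_le_iff)
  then have "\<Phi> \<in> S4.diag_dom (\<lambda>k. - (lam k * (lam k + 2)))"
    using \<Phi> unfolding sobolev_4 by (rule subsetD[OF S4.diag_dom_mono])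
  then obtain \<Psi> where \<Psi>: "\<And>k. S4.proj k \<Psi> = - (lam k * (lam k + 2)) *\<^sub>R S4.proj k \<Phi>"
    unfolding S4.diag_dom_ex by blast
  then have "laplacian \<Theta> = \<Psi>" by (intro laplacian_eqI) (simp add: \<Theta>)
  then show ?thesis
    unfolding paneitz_def \<Theta>_def[symmetric] by (simp add: S4.proj_minus \<Psi>)
qed

text \<open>In degree k the Laplacian contributes the square of \<open>lam k\<close> and the
  Dirichlet form contributes \<open>2 * lam k\<close>.\<close>

lemma paneitz_form_sums:
  assumes \<Phi>: "\<Phi> \<in> sobolev 2"
  shows "(\<lambda>k. lam k * (lam k + 2) * (norm (S4.proj k \<Phi>))\<^sup>2) sums paneitz_form \<Phi>"
proof -
  have S: "\<Phi> \<in> sobolev (Suc 1)" using \<Phi> by (simp add: numeral_2_eq_2)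
  have "(\<lambda>k. (norm (S4.proj k (laplacian \<Phi>)))\<^sup>2 + 2 * (\<Sum>(i, j)\<in>{(i, j). i < j}. (norm (S4.proj k (weak_rot_deriv i j \<Phi>)))\<^sup>2))
    sums paneitz_form \<Phi>"
    unfolding paneitz_form_def case_prod_unfold
    by (intro sums_add sums_mult sums_sum S4.norm_sums)
  also have "(\<lambda>k. (norm (S4.proj k (laplacian \<Phi>)))\<^sup>2 + 2 * (\<Sum>(i, j)\<in>{(i, j). i < j}. (norm (S4.proj k (weak_rot_deriv i j \<Phi>)))\<^sup>2))
    = (\<lambda>k. lam k * (lam k + 2) * (norm (S4.proj k \<Phi>))\<^sup>2)"
    by (simp add: proj_laplacian[OF \<Phi>] weak_rot_deriv_sobolev(2)[OF S] norm_weak_rot_deriv[OF S4.proj_in]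
        power_mult_distrib power2_eq_square[of "lam _"] algebra_simps)
  finally show ?thesis .
qed

section \<open>Conformal fields and zonal integrals\<close>

text \<open>On the unit sphere this is the derivative along the conformal field X_i. Writing it
  through rotation fields makes integration by parts available.\<close>

definition conf :: "5 \<Rightarrow> (real^5 \<Rightarrow> real) \<Rightarrow> real^5 \<Rightarrow> real" where
  "conf i f x = (\<Sum>j\<in>UNIV. x $ j * rot_deriv j i f x)"

lemma conf_pd:
  assumes "f differentiable (at x)" "norm x = 1"
  shows "conf i f x = pd i f x - x $ i * (\<Sum>j\<in>UNIV. x $ j * pd j f x)"
proof -
  have "conf i f x = (\<Sum>j\<in>UNIV. x $ j * (x $ j * pd i f x)) - x $ i * (\<Sum>j\<in>UNIV. x $ j * pd j f x)"
    by (simp add: conf_def rot_deriv_pd[OF assms(1)] right_diff_distrib sum_subtractf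
        sum_distrib_left mult.left_commute)
  then show ?thesis by (simp add: sum_coord_sq[OF assms(2)])
qed

lemma continuous_conf: "C1 f \<Longrightarrow> continuous_on (- {0}) (conf i f)"
  unfolding conf_def[abs_def] by (intro continuous_intros C1_rot_deriv)

text \<open>The field has divergence -4 x_i: each of the four j distinct from i contributes once,
  since the rotation derivative of x_j is -x_i.\<close>

lemma integral_conf:
  assumes f: "C1 f"
  shows "(\<integral>x. conf i f x \<partial>surf) = 4 * (\<integral>x. x $ i * f x \<partial>surf)"
proof -
  have c: "continuous_on (- {0}) (\<lambda>x. x $ j * rot_deriv j i f x)" for j
    by (intro continuous_intros C1_rot_deriv f)
  have cf: "continuous_on (- {0}) (\<lambda>x. x $ i * f x)"
    by (intro continuous_intros C1_continuous f)
  have "(\<integral>x. conf i f x \<partial>surf) = (\<Sum>j\<in>UNIV. \<integral>x. x $ j * rot_deriv j i f x \<partial>surf)"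
    unfolding conf_def by (intro Bochner_Integration.integral_sum integrable_surf_continuous c)
  also have "\<dots> = (\<Sum>j\<in>UNIV. if j = i then 0 else (\<integral>x. x $ i * f x \<partial>surf))"
  proof (rule sum.cong[OF refl])
    fix j
    have "rot_deriv j i (\<lambda>x. x $ j) x = (if j = i then 0 else - x $ i)" for x
      by (simp add: rot_deriv_pd pd_coord)
    then show "(\<integral>x. x $ j * rot_deriv j i f x \<partial>surf) = (if j = i then 0 else (\<integral>x. x $ i * f x \<partial>surf))"
      using rot_deriv_by_parts[OF poly_Ck[OF poly_coord] f, of j j i] by auto
  qed
  also have "\<dots> = 4 * (\<integral>x. x $ i * f x \<partial>surf)"
    by (simp add: sum.If_cases Compl_eq_Diff_UNIV)
  finally show ?thesis .
qed

lemma conf_mult: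
  assumes "f differentiable (at x)" "g differentiable (at x)"
  shows "conf i (\<lambda>x. f x * g x) x = f x * conf i g x + conf i f x * g x"
  by (simp add: conf_def rot_deriv_mult[OF assms] sum_distrib_left sum_distrib_right
      sum.distrib[symmetric] algebra_simps)

section \<open>Zonal integrals\<close>

lemma poly_inner: "poly_fun (\<lambda>x. inner \<xi> x)"
  by (rule poly_linear) (rule bounded_linear_inner_right)

lemma pd_inner: "pd i (\<lambda>x. inner \<xi> x) x = \<xi> $ i"
  using pd_eqI[OF bounded_linear_imp_has_derivative[OF bounded_linear_inner_right], of i \<xi> x]
  by (simp add: inner_axis)

lemma pd_compose:
  assumes f: "f differentiable (at x)" and g: "(g has_real_derivative g') (at (f x))"
  shows "(\<lambda>x. g (f x)) differentiable (at x)" "pd i (\<lambda>x. g (f x)) x = g' * pd i f x"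
proof -
  have D: "((\<lambda>x. g (f x)) has_derivative (\<lambda>h. g' * (\<Sum>i\<in>UNIV. h $ i * pd i f x))) (at x)"
    using has_derivative_compose[OF has_derivative_pd[OF f] g[unfolded has_field_derivative_def]] .
  show "(\<lambda>x. g (f x)) differentiable (at x)" using D by (rule differentiableI)
  show "pd i (\<lambda>x. g (f x)) x = g' * pd i f x" using pd_eqI[OF D, of i] by (simp add: sum_axis)
qed

text \<open>Apply the divergence formula to t^m with t = \<open>inner \<xi> x\<close>, in the
  direction \<open>\<xi>\<close>. The derivative of t along that field is 1 - t^2 on the sphere, so
  m times the integral of t^(m-1) - t^(m+1) equals 4 times that of t^(m+1).\<close>

lemma zonal_moment_rec:
  fixes \<xi> :: "real^5"
  assumes \<xi>: "norm \<xi> = 1"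
  shows "real m * (\<integral>x. inner \<xi> x ^ (m - 1) \<partial>surf) = (real m + 4) * (\<integral>x. inner \<xi> x ^ (m + 1) \<partial>surf)"
proof -
  define f where "f = (\<lambda>x. inner \<xi> x ^ m)"
  have f: "poly_fun f" unfolding f_def by (rule real_polynomial_function_power[OF poly_inner])
  have ip: "integrable surf (\<lambda>x. inner \<xi> x ^ n)" for n
    by (intro integrable_surf_continuous continuous_intros)
  have pdf: "pd i f x = real m * inner \<xi> x ^ (m - 1) * \<xi> $ i" for i x
    unfolding f_def
    using pd_compose(2)[of "\<lambda>x. inner \<xi> x" x "\<lambda>t. t ^ m" "real m * inner \<xi> x ^ (m - 1)" i]
    by (auto simp: pd_inner poly_differentiable[OF poly_inner] intro!: derivative_eq_intros)
  have e: "(\<Sum>j\<in>UNIV. x $ j * pd j f x) = real m * inner \<xi> x ^ m" for x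
    using euler[OF f, of m x] by (simp add: f_def hom_def power_mult_distrib)
  have c: "conf i f x = real m * inner \<xi> x ^ (m - 1) * \<xi> $ i - x $ i * (real m * inner \<xi> x ^ m)"
    if "norm x = 1" for i x
    using conf_pd[OF poly_differentiable[OF f] that, of i] unfolding e unfolding pdf .
  have ic: "integrable surf (conf i f)" for i
    by (intro integrable_surf_continuous continuous_conf poly_Ck f)
  have ix: "integrable surf (\<lambda>x. x $ i * f x)" for i
    by (intro integrable_surf_continuous continuous_on_mult poly_continuous f poly_coord)
  have "(\<integral>x. (\<Sum>i\<in>UNIV. \<xi> $ i * conf i f x) \<partial>surf) = (\<Sum>i\<in>UNIV. \<xi> $ i * (\<integral>x. conf i f x \<partial>surf))"
    using ic by (subst Bochner_Integration.integral_sum) auto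
  also have "\<dots> = 4 * (\<Sum>i\<in>UNIV. \<xi> $ i * (\<integral>x. x $ i * f x \<partial>surf))"
    by (simp add: integral_conf[OF poly_Ck[OF f]] sum_distrib_left mult.left_commute)
  also have "(\<Sum>i\<in>UNIV. \<xi> $ i * (\<integral>x. x $ i * f x \<partial>surf)) = (\<integral>x. (\<Sum>i\<in>UNIV. \<xi> $ i * (x $ i * f x)) \<partial>surf)"
    using ix by (subst Bochner_Integration.integral_sum) auto
  also have "\<dots> = (\<integral>x. inner \<xi> x ^ (m + 1) \<partial>surf)"
    by (simp add: f_def inner_vec_def sum_distrib_right mult.assoc)
  also have "(\<integral>x. (\<Sum>i\<in>UNIV. \<xi> $ i * conf i f x) \<partial>surf)
    = (\<integral>x. real m * inner \<xi> x ^ (m - 1) - real m * inner \<xi> x ^ (m + 1) \<partial>surf)"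
  proof (rule integral_cong_AE)
    show "AE x in surf. (\<Sum>i\<in>UNIV. \<xi> $ i * conf i f x) = real m * inner \<xi> x ^ (m - 1) - real m * inner \<xi> x ^ (m + 1)"
    proof (rule AE_surf_sphereI)
      fix x :: "real^5" assume x: "norm x = 1"
      have "(\<Sum>i\<in>UNIV. \<xi> $ i * conf i f x)
        = (\<Sum>i\<in>UNIV. \<xi> $ i * (\<xi> $ i * (real m * inner \<xi> x ^ (m - 1))) - (\<xi> $ i * x $ i) * (real m * inner \<xi> x ^ m))"
        by (simp add: c[OF x] algebra_simps)
      also have "\<dots> = real m * inner \<xi> x ^ (m - 1) - inner \<xi> x * (real m * inner \<xi> x ^ m)"
        by (simp add: sum_subtractf sum_coord_sq[OF \<xi>] inner_vec_def[of \<xi> x] sum_distrib_right)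
      finally show "(\<Sum>i\<in>UNIV. \<xi> $ i * conf i f x) = real m * inner \<xi> x ^ (m - 1) - real m * inner \<xi> x ^ (m + 1)"
        by simp
    qed
  qed (use ic ip in \<open>auto intro!: borel_measurable_integrable\<close>)
  also have "(\<integral>x. real m * inner \<xi> x ^ (m - 1) - real m * inner \<xi> x ^ (m + 1) \<partial>surf)
    = real m * (\<integral>x. inner \<xi> x ^ (m - 1) \<partial>surf) - real m * (\<integral>x. inner \<xi> x ^ (m + 1) \<partial>surf)"
    using ip by (simp only: Bochner_Integration.integral_diff integrable_mult_right integral_mult_right_zero)
  finally show ?thesis by (simp add: distrib_right)
qed

text \<open>The moments of the weight 1 - t^2 on [-1, 1].\<close>

definition beta_moment :: "nat \<Rightarrow> real" where
  "beta_moment m = (if even m then 4 / ((real m + 1) * (real m + 3)) else 0)"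

text \<open>The recursion ascends by two; it starts from the total mass in even degrees and from 0
  in odd ones, which the recursion with index 0 forces.\<close>

lemma zonal_moment:
  fixes \<xi> :: "real^5"
  assumes \<xi>: "norm \<xi> = 1"
  shows "(\<integral>x. inner \<xi> x ^ m \<partial>surf) = 2 * pi\<^sup>2 * beta_moment m"
proof (induction m rule: less_induct)
  case (less m)
  consider "m = 0" | "m = 1" | n where "m = n + 2"
    by (metis One_nat_def add_2_eq_Suc' not0_implies_Suc)
  then show ?case
  proof cases
    case 1
    then show ?thesis by (simp add: measure_surf_UNIV beta_moment_def)
  next
    case 2
    then show ?thesis using zonal_moment_rec[OF \<xi>, of 0] by (simp add: beta_moment_def)
  next
    case 3
    have "(real n + 5) * (\<integral>x. inner \<xi> x ^ m \<partial>surf) = (real n + 1) * (2 * pi\<^sup>2 * beta_moment n)"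
      using zonal_moment_rec[OF \<xi>, of "n + 1"] less[of n] 3 by (simp add: algebra_simps)
    also have "\<dots> = (real n + 5) * (2 * pi\<^sup>2 * beta_moment m)"
    proof -
      have nz: "real n + 1 \<noteq> 0" "real n + 5 \<noteq> 0" by linarith+
      have cancel: "a * (4 / (a * b)) = 4 / b" if "a \<noteq> 0" for a b :: real
        using that by simp
      have "(real n + 1) * beta_moment n = (if even n then 4 / (real n + 3) else 0)"
        using cancel[OF nz(1), of "real n + 3"] unfolding beta_moment_def by (cases "even n") (simp_all only: if_True if_False mult_zero_right)
      moreover have "(real n + 5) * beta_moment m = (if even n then 4 / (real n + 3) else 0)"
        using cancel[OF nz(2), of "real n + 3"] unfolding beta_moment_def 3
        by (simp add: mult.commute add.commute)
      ultimately show ?thesis by (simp add: mult.left_commute)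
    qed
    finally show ?thesis by simp
  qed
qed

lemma beta_moment_integral: "((\<lambda>t. t ^ m * (1 - t\<^sup>2)) has_integral beta_moment m) {- 1..1}"
proof -
  define F where "F t = t ^ (m + 1) / (real m + 1) - t ^ (m + 3) / (real m + 3)" for t :: real
  have "((\<lambda>t. t ^ m * (1 - t\<^sup>2)) has_integral F 1 - F (- 1)) {- 1..1}"
  proof (rule fundamental_theorem_of_calculus)
    fix t :: real assume "t \<in> {- 1..1}"
    have "(F has_real_derivative t ^ m - t ^ (m + 2)) (at t within {- 1..1})"
    proof -
      have d: "((\<lambda>t. t ^ (n + 1) / (real n + 1)) has_real_derivative t ^ n) (at t within {- 1..1})" for n
      proof -
        have "real n + 1 \<noteq> 0" by linarith
        then show ?thesis
          using DERIV_cdivide[OF DERIV_pow[of "Suc n" t "{- 1..1}"], of "real n + 1"] by (simp add: add.commute)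
      qed
      have "((\<lambda>t. t ^ (m + 3) / (real m + 3)) has_real_derivative t ^ (m + 2)) (at t within {- 1..1})"
        using d[of "m + 2"] by (simp add: numeral_3_eq_3 add.commute)
      from DERIV_diff[OF d[of m] this] show ?thesis unfolding F_def .
    qed
    then show "(F has_vector_derivative t ^ m * (1 - t\<^sup>2)) (at t within {- 1..1})"
      by (simp add: has_real_derivative_iff_has_vector_derivative right_diff_distrib power2_eq_square mult_ac)
  qed simp
  also have "F 1 - F (- 1) = beta_moment m"
    by (auto simp: F_def beta_moment_def field_simps)
  finally show ?thesis .
qed

lemma zonal_integral_poly:
  fixes \<xi> :: "real^5"
  assumes \<xi>: "norm \<xi> = 1" and q: "real_polynomial_function q"
  shows "(\<integral>x. q (inner \<xi> x) \<partial>surf) = 2 * pi\<^sup>2 * integral {- 1..1} (\<lambda>t. q t * (1 - t\<^sup>2))"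
proof -
  obtain a n where q: "q = (\<lambda>t. \<Sum>i\<le>n. a i * t ^ i)"
    using q unfolding real_polynomial_function_iff_sum by blast
  have ip: "integrable surf (\<lambda>x. inner \<xi> x ^ n)" for n
    by (intro integrable_surf_continuous continuous_intros)
  have "(\<integral>x. q (inner \<xi> x) \<partial>surf) = (\<Sum>i\<le>n. a i * (2 * pi\<^sup>2 * beta_moment i))"
    unfolding q using ip by (subst Bochner_Integration.integral_sum) (auto simp: zonal_moment[OF \<xi>])
  also have "\<dots> = 2 * pi\<^sup>2 * (\<Sum>i\<le>n. a i * beta_moment i)"
    by (simp add: sum_distrib_left mult_ac)
  also have "((\<lambda>t. \<Sum>i\<le>n. a i * (t ^ i * (1 - t\<^sup>2))) has_integral (\<Sum>i\<le>n. a i * beta_moment i)) {- 1..1}"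
    by (intro has_integral_sum has_integral_mult_right beta_moment_integral) auto
  then have "(\<Sum>i\<le>n. a i * beta_moment i) = integral {- 1..1} (\<lambda>t. q t * (1 - t\<^sup>2))"
    by (simp add: q sum_distrib_right mult.assoc integral_unique)
  finally show ?thesis .
qed

lemma abs_inner_le_1: "norm \<xi> = 1 \<Longrightarrow> norm x = 1 \<Longrightarrow> inner \<xi> x \<in> {- 1..1::real}" for \<xi> x :: "real^5"
  using Cauchy_Schwarz_ineq2[of \<xi> x] by auto

text \<open>Weierstrass approximation on [-1, 1] carries the formula from polynomials to continuous
  functions.\<close>

lemma zonal_integral:
  fixes \<xi> :: "real^5" and g :: "real \<Rightarrow> real"
  assumes \<xi>: "norm \<xi> = 1" and g: "continuous_on UNIV g"
  shows "(\<integral>x. g (inner \<xi> x) \<partial>surf) = 2 * pi\<^sup>2 * integral {- 1..1} (\<lambda>t. g t * (1 - t\<^sup>2))"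
proof (rule ccontr)
  define d where "d = \<bar>(\<integral>x. g (inner \<xi> x) \<partial>surf) - 2 * pi\<^sup>2 * integral {- 1..1} (\<lambda>t. g t * (1 - t\<^sup>2))\<bar>"
  assume "\<not> ?thesis"
  then have d: "d > 0" by (simp add: d_def)
  \<comment> \<open>The masses of both sides added, so that a uniform error \<open>e\<close> changes
    their difference by at most \<open>e * A = d / 2\<close>.\<close>
  define A where "A = 8 * pi\<^sup>2 / 3 + 2 * pi\<^sup>2 * beta_moment 0"
  have A: "A > 0" by (simp add: A_def beta_moment_def add_pos_pos)
  define e where "e = d / (2 * A)"
  have e: "e > 0" using d A by (simp add: e_def)
  obtain q where q: "real_polynomial_function q" "\<And>t. t \<in> {- 1..1} \<Longrightarrow> \<bar>g t - q t\<bar> < e"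
    using Stone_Weierstrass_real_polynomial_function[of "{- 1..1}" g e] continuous_on_subset[OF g] e by auto
  have qc: "continuous_on UNIV q"
    using q(1) by (simp add: continuous_on_polymonial_function real_polynomial_function_eq)
  have int: "integrable surf (\<lambda>x. h (inner \<xi> x))" if "continuous_on UNIV h" for h :: "real \<Rightarrow> real"
    by (intro integrable_surf_continuous continuous_on_compose2[OF that] continuous_intros) auto
  have hk: "(\<lambda>t. h t * (1 - t\<^sup>2)) integrable_on {- 1..1}" if "continuous_on UNIV h" for h :: "real \<Rightarrow> real"
    by (intro integrable_continuous_interval continuous_intros continuous_on_subset[OF that]) auto
  have 1: "\<bar>(\<integral>x. g (inner \<xi> x) \<partial>surf) - (\<integral>x. q (inner \<xi> x) \<partial>surf)\<bar> \<le> e * (8 * pi\<^sup>2 / 3)"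
  proof -
    have "\<bar>(\<integral>x. g (inner \<xi> x) \<partial>surf) - (\<integral>x. q (inner \<xi> x) \<partial>surf)\<bar> = \<bar>\<integral>x. g (inner \<xi> x) - q (inner \<xi> x) \<partial>surf\<bar>"
      by (simp add: Bochner_Integration.integral_diff[OF int[OF g] int[OF qc]])
    also have "\<dots> \<le> (\<integral>x. \<bar>g (inner \<xi> x) - q (inner \<xi> x)\<bar> \<partial>surf)"
      by (rule integral_abs_bound)
    also have "\<dots> \<le> (\<integral>x. e \<partial>surf)"
    proof (rule integral_mono_AE)
      show "AE x in surf. \<bar>g (inner \<xi> x) - q (inner \<xi> x)\<bar> \<le> e"
        using q(2) abs_inner_le_1[OF \<xi>] by (intro AE_surf_sphereI) (auto intro: less_imp_le)
    qed (use int[OF g] int[OF qc] in auto)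
    finally show ?thesis by (simp add: measure_surf_UNIV mult.commute)
  qed
  have 2: "\<bar>integral {- 1..1} (\<lambda>t. g t * (1 - t\<^sup>2)) - integral {- 1..1} (\<lambda>t. q t * (1 - t\<^sup>2))\<bar> \<le> e * beta_moment 0"
  proof -
    have "\<bar>integral {- 1..1} (\<lambda>t. g t * (1 - t\<^sup>2)) - integral {- 1..1} (\<lambda>t. q t * (1 - t\<^sup>2))\<bar>
      = norm (integral {- 1..1} (\<lambda>t. g t * (1 - t\<^sup>2) - q t * (1 - t\<^sup>2)))"
      by (simp add: Henstock_Kurzweil_Integration.integral_diff[OF hk[OF g] hk[OF qc]])
    also have "\<dots> \<le> integral {- 1..1} (\<lambda>t. e * (t ^ 0 * (1 - t\<^sup>2)))"
    proof (rule integral_norm_bound_integral)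
      show "(\<lambda>t. g t * (1 - t\<^sup>2) - q t * (1 - t\<^sup>2)) integrable_on {- 1..1}"
        by (intro integrable_diff hk g qc)
      show "(\<lambda>t. e * (t ^ 0 * (1 - t\<^sup>2))) integrable_on {- 1..1}"
        by (intro integrable_continuous_interval continuous_intros)
      fix t :: real assume t: "t \<in> {- 1..1}"
      then have "t\<^sup>2 \<le> 1" by (simp add: abs_square_le_1 abs_le_iff)
      then have "\<bar>g t - q t\<bar> * (1 - t\<^sup>2) \<le> e * (1 - t\<^sup>2)"
        using q(2)[OF t] by (intro mult_right_mono) auto
      then show "norm (g t * (1 - t\<^sup>2) - q t * (1 - t\<^sup>2)) \<le> e * (t ^ 0 * (1 - t\<^sup>2))"
        using \<open>t\<^sup>2 \<le> 1\<close> by (simp add: left_diff_distrib[symmetric] abs_mult)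
    qed
    also have "\<dots> = e * beta_moment 0"
      using has_integral_mult_right[OF beta_moment_integral, of e 0] by (rule integral_unique)
    finally show ?thesis .
  qed
  have "d \<le> e * (8 * pi\<^sup>2 / 3) + 2 * pi\<^sup>2 * (e * beta_moment 0)"
  proof -
    define x where "x = integral {- 1..1} (\<lambda>t. g t * (1 - t\<^sup>2)) - integral {- 1..1} (\<lambda>t. q t * (1 - t\<^sup>2))"
    have "2 * pi\<^sup>2 * \<bar>x\<bar> \<le> 2 * pi\<^sup>2 * (e * beta_moment 0)"
      using 2 by (intro mult_left_mono) (auto simp: x_def)
    moreover have "d = \<bar>((\<integral>x. g (inner \<xi> x) \<partial>surf) - (\<integral>x. q (inner \<xi> x) \<partial>surf)) - 2 * pi\<^sup>2 * x\<bar>"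
      unfolding d_def x_def zonal_integral_poly[OF \<xi> q(1)] by (simp add: algebra_simps)
    moreover have "\<dots> \<le> \<bar>(\<integral>x. g (inner \<xi> x) \<partial>surf) - (\<integral>x. q (inner \<xi> x) \<partial>surf)\<bar> + 2 * pi\<^sup>2 * \<bar>x\<bar>"
      by (rule order_trans[OF abs_triangle_ineq4]) (simp add: abs_mult)
    ultimately show ?thesis using 1 by linarith
  qed
  also have "\<dots> = e * A" by (simp add: A_def algebra_simps)
  also have "\<dots> = d / 2" using A by (simp add: e_def)
  finally show False using d by simp
qed

section \<open>The Riesz operator\<close>

text \<open>
  For \<open>\<epsilon> > 0\<close> the kernel is smooth, so that integration by parts applies; the singular kernel
  \<open>\<epsilon> = 0\<close> is reached by dominated convergence. On the diagonal the latter has the junk value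
  \<open>0 powr (- b) = 0\<close>, which is harmless since points are null sets.
\<close>

definition ker :: "real \<Rightarrow> real \<Rightarrow> real^5 \<Rightarrow> real^5 \<Rightarrow> real" where
  "ker b \<epsilon> \<xi> \<eta> = (inner (\<xi> - \<eta>) (\<xi> - \<eta>) + \<epsilon>) powr (- b)"

lemma ker_dist: "dist \<xi> \<eta> powr (- \<alpha>) = ker (\<alpha> / 2) 0 \<xi> \<eta>"
proof -
  have "dist \<xi> \<eta> = inner (\<xi> - \<eta>) (\<xi> - \<eta>) powr (1 / 2)"
    by (simp add: dist_norm norm_eq_sqrt_inner powr_half_sqrt)
  then show ?thesis by (simp add: ker_def powr_powr)
qed

lemma ker_commute: "ker b \<epsilon> \<xi> \<eta> = ker b \<epsilon> \<eta> \<xi>"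
  by (simp add: ker_def inner_diff_left inner_diff_right inner_commute algebra_simps)

lemma ker_nonneg [simp]: "0 \<le> ker b \<epsilon> \<xi> \<eta>"
  by (simp add: ker_def)

lemma sphere_dist: "norm \<xi> = 1 \<Longrightarrow> norm \<eta> = 1 \<Longrightarrow> inner (\<xi> - \<eta>) (\<xi> - \<eta>) = 2 - 2 * inner \<xi> (\<eta> :: real^5)"
  using power2_norm_eq_inner[of \<xi>] power2_norm_eq_inner[of \<eta>]
  by (simp add: inner_diff_left inner_diff_right inner_commute)

lemma ker_mono:
  assumes "0 \<le> b" "0 \<le> \<epsilon>" "\<epsilon> \<le> \<epsilon>'" "0 < \<epsilon> \<or> \<xi> \<noteq> \<eta>"
  shows "ker b \<epsilon>' \<xi> \<eta> \<le> ker b \<epsilon> \<xi> \<eta>"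
proof -
  have "0 < inner (\<xi> - \<eta>) (\<xi> - \<eta>) + \<epsilon>"
    using assms by (auto intro: add_nonneg_pos add_pos_nonneg)
  then show ?thesis
    using assms unfolding ker_def by (intro powr_mono2') auto
qed

lemma shift_tendsto:
  fixes u :: real
  assumes "u > 0"
  shows "(\<lambda>n. (u + 1 / real (Suc n)) powr c) \<longlonglongrightarrow> u powr c"
proof -
  have "(\<lambda>n. u + 1 / real (Suc n)) \<longlonglongrightarrow> u + 0"
    by (intro tendsto_add tendsto_const) (use LIMSEQ_inverse_real_of_nat in \<open>simp add: inverse_eq_divide\<close>)
  then show ?thesis
    using assms by (intro tendsto_powr tendsto_const) auto
qed

lemma ker_tendsto: "\<xi> \<noteq> \<eta> \<Longrightarrow> (\<lambda>n. ker b (1 / real (Suc n)) \<xi> \<eta>) \<longlonglongrightarrow> ker b 0 \<xi> \<eta>"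
  unfolding ker_def using shift_tendsto[of "inner (\<xi> - \<eta>) (\<xi> - \<eta>)" "- b"] by simp

lemma continuous_ker: "\<epsilon> > 0 \<Longrightarrow> continuous_on S f \<Longrightarrow> continuous_on S g \<Longrightarrow> continuous_on S (\<lambda>x. ker b \<epsilon> (f x) (g x))"
  unfolding ker_def
  by (intro continuous_on_powr continuous_intros) (auto simp: add_nonneg_eq_0_iff)

lemma ker_measurable [measurable]:
  assumes [measurable]: "f \<in> M \<rightarrow>\<^sub>M borel" "g \<in> M \<rightarrow>\<^sub>M borel"
  shows "(\<lambda>x. ker b \<epsilon> (f x) (g x)) \<in> borel_measurable M"
  unfolding ker_def by measurable

text \<open>The integral over the sphere of the singular kernel |xi - eta|^(-2b), the same for every
  xi; for b = \<alpha>/2 it is the eigenvalue in degree 0.\<close>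

definition ker_mass :: "real \<Rightarrow> real" where
  "ker_mass b = pi\<^sup>2 * 4 powr (2 - b) / ((2 - b) * (3 - b))"

lemma singular_beta_integral:
  assumes b: "0 < b" "b < 2"
  shows "((\<lambda>t. (2 - 2 * t) powr (- b) * (1 - t\<^sup>2)) has_integral ker_mass b / (2 * pi\<^sup>2)) {- 1..1}"
proof -
  \<comment> \<open>The substitution u = 2 - 2 t turns 1 - t^2 into u (4 - u) / 4 and dt into -du /
    2, whence the factor -1/8. As b < 2, the primitive is continuous up to the singular endpoint t =
    1.\<close>
  define F where "F t = - (1/8) * (4 * (2 - 2 * t) powr (2 - b) / (2 - b) - (2 - 2 * t) powr (3 - b) / (3 - b))" for t :: real
  have "((\<lambda>t. (2 - 2 * t) powr (- b) * (1 - t\<^sup>2)) has_integral F 1 - F (- 1)) {- 1..1}"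
  proof (rule fundamental_theorem_of_calculus_interior)
    show "continuous_on {- 1..1} F"
      unfolding F_def using b by (intro continuous_intros continuous_on_powr') auto
    fix t :: real assume t: "t \<in> {- 1<..<1}"
    define u where "u = 2 - 2 * t"
    have u: "u > 0" using t by (simp add: u_def)
    have "((\<lambda>t. (2 - 2 * t) powr c) has_real_derivative (- 2 * c) * u powr (c - 1)) (at t)" for c
      using u unfolding u_def by (auto intro!: derivative_eq_intros)
    note d = this[of "2 - b"] this[of "3 - b"]
    have "(F has_real_derivative - (1/8) * (4 * ((- 2 * (2 - b)) * u powr (2 - b - 1)) / (2 - b)
        - ((- 2 * (3 - b)) * u powr (3 - b - 1)) / (3 - b))) (at t)"
      unfolding F_def by (intro DERIV_cmult DERIV_diff DERIV_cdivide d)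
    also have "- (1/8) * (4 * ((- 2 * (2 - b)) * u powr (2 - b - 1)) / (2 - b)
        - ((- 2 * (3 - b)) * u powr (3 - b - 1)) / (3 - b)) = u powr (- b) * (u * (4 - u) / 4)"
    proof -
      have p: "u powr (2 - b - 1) = u powr (- b) * u" "u powr (3 - b - 1) = u powr (- b) * u * u"
        using u powr_add[of u "- b" 1] powr_add[of u "- b" 2]
        by (simp_all add: powr_numeral power2_eq_square)
      have c: "4 * ((- 2 * (2 - b)) * x) / (2 - b) = - 8 * x" "((- 2 * (3 - b)) * x) / (3 - b) = - 2 * x" for x
        using b by (simp_all add: divide_eq_eq algebra_simps)
      show ?thesis unfolding c p by (simp add: algebra_simps)
    qed
    also have "u * (4 - u) / 4 = 1 - t\<^sup>2" by (simp add: u_def power2_eq_square field_simps)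
    finally show "(F has_vector_derivative (2 - 2 * t) powr (- b) * (1 - t\<^sup>2)) (at t)"
      by (simp add: u_def has_real_derivative_iff_has_vector_derivative)
  qed simp
  also have "F 1 - F (- 1) = ker_mass b / (2 * pi\<^sup>2)"
  proof -
    have "(4::real) powr (3 - b) = 4 * 4 powr (2 - b)"
      using powr_add[of 4 1 "2 - b"] by simp
    then have "F 1 - F (- 1) = 4 powr (2 - b) / 2 * (1 / (2 - b) - 1 / (3 - b))"
      by (simp add: F_def right_diff_distrib)
    also have "1 / (2 - b) - 1 / (3 - b) = 1 / ((2 - b) * (3 - b))"
      using b by (simp add: field_simps)
    finally show ?thesis by (simp add: ker_mass_def)
  qed
  finally show ?thesis .
qed

text \<open>The regularised kernels increase to the singular one off the point \<open>\<xi>\<close>.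
  Their integrals reduce to one dimension, where dominated convergence identifies the limit;
  monotone convergence transfers it back to the sphere.\<close>

lemma integral_ker:
  assumes b: "0 < b" "b < 2" and \<xi>: "norm \<xi> = 1"
  shows "integrable surf (ker b 0 \<xi>)" "(\<integral>\<eta>. ker b 0 \<xi> \<eta> \<partial>surf) = ker_mass b"
proof -
  define e where "e n = 1 / real (Suc n)" for n
  have e: "e n > 0" for n by (simp add: e_def)
  \<comment> \<open>The maximum makes \<open>g n\<close> continuous on the whole line, as the zonal
    formula asks; on [-1, 1] it changes nothing.\<close>
  define g where "g n t = (max 0 (2 - 2 * t) + e n) powr (- b)" for n t
  have max_pos: "max 0 (2 - 2 * t) + e n > 0" for n t using e[of n] by (simp add: add_nonneg_pos)
  have gc: "continuous_on UNIV (g n)" for n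
    unfolding g_def using max_pos by (intro continuous_on_powr continuous_intros) (metis less_irrefl)
  have int: "integrable surf (ker b (e n) \<xi>)" for n
    using integrable_surf_continuous[OF continuous_ker[OF e continuous_on_const continuous_on_id]] .
  have val: "(\<integral>\<eta>. ker b (e n) \<xi> \<eta> \<partial>surf) = 2 * pi\<^sup>2 * integral {- 1..1} (\<lambda>t. g n t * (1 - t\<^sup>2))" for n
  proof -
    have "(\<integral>\<eta>. ker b (e n) \<xi> \<eta> \<partial>surf) = (\<integral>\<eta>. g n (inner \<xi> \<eta>) \<partial>surf)"
    proof (rule integral_cong_AE)
      show "AE \<eta> in surf. ker b (e n) \<xi> \<eta> = g n (inner \<xi> \<eta>)"
        using abs_inner_le_1[OF \<xi>] by (intro AE_surf_sphereI) (simp add: ker_def sphere_dist \<xi> g_def)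
    qed (use borel_measurable_continuous_onI[OF gc] in auto)
    then show ?thesis using zonal_integral[OF \<xi> gc] by simp
  qed
  have "(\<lambda>n. integral {- 1..1} (\<lambda>t. g n t * (1 - t\<^sup>2)))
    \<longlonglongrightarrow> integral {- 1..1} (\<lambda>t. (2 - 2 * t) powr (- b) * (1 - t\<^sup>2))"
  proof (rule dominated_convergence(2))
    show "(\<lambda>t. g n t * (1 - t\<^sup>2)) integrable_on {- 1..1}" for n
      by (intro integrable_continuous_interval continuous_intros continuous_on_subset[OF gc]) auto
    show "(\<lambda>t. (2 - 2 * t) powr (- b) * (1 - t\<^sup>2)) integrable_on {- 1..1}"
      using singular_beta_integral[OF b] by (rule has_integral_integrable)
    fix t :: real assume t: "t \<in> {- 1..1}"
    then have t2: "t\<^sup>2 \<le> 1" by (simp add: abs_square_le_1 abs_le_iff)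
    show "norm (g n t * (1 - t\<^sup>2)) \<le> (2 - 2 * t) powr (- b) * (1 - t\<^sup>2)" for n
    proof (cases "t = 1")
      case False
      then have "g n t \<le> (2 - 2 * t) powr (- b)"
        using t b e[of n] unfolding g_def by (intro powr_mono2') auto
      then show ?thesis using t2 by (simp add: g_def mult_right_mono)
    qed simp
    show "(\<lambda>n. g n t * (1 - t\<^sup>2)) \<longlonglongrightarrow> (2 - 2 * t) powr (- b) * (1 - t\<^sup>2)"
    proof (cases "t = 1")
      case False
      then have "2 - 2 * t > 0" using t by simp
      then show ?thesis
        using shift_tendsto[of "2 - 2 * t" "- b"] by (intro tendsto_mult tendsto_const) (simp add: g_def e_def max_def)
    qed simp
  qed
  then have lim: "(\<lambda>n. \<integral>\<eta>. ker b (e n) \<xi> \<eta> \<partial>surf) \<longlonglongrightarrow> 2 * pi\<^sup>2 * (ker_mass b / (2 * pi\<^sup>2))"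
    unfolding val integral_unique[OF singular_beta_integral[OF b]] by (rule tendsto_mult_left)
  have mono: "AE \<eta> in surf. mono (\<lambda>n. ker b (e n) \<xi> \<eta>)"
  proof (intro AE_I2 monoI)
    fix \<eta> and m n :: nat assume "m \<le> n"
    then have "e n \<le> e m" by (simp add: e_def frac_le)
    then show "ker b (e m) \<xi> \<eta> \<le> ker b (e n) \<xi> \<eta>"
      using e[of n] b by (intro ker_mono) auto
  qed
  have conv: "AE \<eta> in surf. (\<lambda>n. ker b (e n) \<xi> \<eta>) \<longlonglongrightarrow> ker b 0 \<xi> \<eta>"
    using AE_surf_neq[of \<xi>] unfolding e_def by eventually_elim (rule ker_tendsto, rule not_sym)
  have nn: "AE \<eta> in surf. 0 \<le> ker b (e n) \<xi> \<eta>" for n by simp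
  have meas: "ker b 0 \<xi> \<in> borel_measurable surf" by measurable
  show "integrable surf (ker b 0 \<xi>)"
    by (rule integral_monotone_convergence_nonneg(1)[OF int mono nn conv lim meas])
  show "(\<integral>\<eta>. ker b 0 \<xi> \<eta> \<partial>surf) = ker_mass b"
    using integral_monotone_convergence_nonneg(2)[OF int mono nn conv lim meas] by simp
qed

lemma nn_integral_ker:
  assumes b: "0 < b" "b < 2" and \<xi>: "norm \<xi> = 1"
  shows "(\<integral>\<^sup>+\<eta>. ennreal (ker b 0 \<xi> \<eta>) \<partial>surf) = ennreal (ker_mass b)"
  using nn_integral_eq_integral[OF integral_ker(1)[OF assms]] integral_ker(2)[OF assms] by simp

section \<open>The singular kernel on the product of two spheres\<close>

interpretation SS: pair_sigma_finite surf surf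
  by unfold_locales

abbreviation "surf2 \<equiv> surf \<Otimes>\<^sub>M surf"

interpretation SS: finite_measure surf2
  by (rule finite_measure_pair_measure[OF finite_measure_surf finite_measure_surf])

lemma measurable_fst_surf2 [measurable]: "fst \<in> surf2 \<rightarrow>\<^sub>M borel"
  and measurable_snd_surf2 [measurable]: "snd \<in> surf2 \<rightarrow>\<^sub>M borel"
  using measurable_fst[of surf surf] measurable_snd[of surf surf] measurable_cong_sets[OF refl sets_surf]
  by blast+

lemma sets_surf2: "sets surf2 = sets borel"
  unfolding borel_prod[symmetric] by (rule sets_pair_measure_cong[OF sets_surf sets_surf])

text \<open>The diagonal is null in the product because points are null in each slice.\<close>

lemma AE_surf2I:
  assumes [measurable]: "Measurable.pred borel P"
    and P: "\<And>\<xi> \<eta>. norm \<xi> = 1 \<Longrightarrow> norm \<eta> = 1 \<Longrightarrow> \<xi> \<noteq> \<eta> \<Longrightarrow> P (\<xi>, \<eta>)"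
  shows "AE z in surf2. P z"
proof (rule SS.AE_pair_measure)
  show "{x \<in> space surf2. P x} \<in> sets surf2"
    using assms(1) unfolding sets_surf2 pred_def by (simp add: space_pair_measure)
  show "AE x in surf. AE y in surf. P (x, y)"
  proof (rule AE_surf_sphereI)
    fix \<xi> :: "real^5" assume \<xi>: "norm \<xi> = 1"
    show "AE \<eta> in surf. P (\<xi>, \<eta>)"
      using AE_surf_neq[of \<xi>] AE_surf_norm by eventually_elim (auto intro: P \<xi>)
  qed
qed

lemma continuous_surf2_bounded:
  fixes F :: "(real^5) \<times> (real^5) \<Rightarrow> real"
  assumes "continuous_on UNIV F"
  obtains B where "\<And>\<xi> \<eta>. norm \<xi> = 1 \<Longrightarrow> norm \<eta> = 1 \<Longrightarrow> \<bar>F (\<xi>, \<eta>)\<bar> \<le> B"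
proof -
  have "compact (F ` (sphere 0 1 \<times> sphere 0 1))"
    by (intro compact_continuous_image continuous_on_subset[OF assms] compact_Times) auto
  then obtain B where "\<And>y. y \<in> F ` (sphere 0 1 \<times> sphere 0 1) \<Longrightarrow> norm y \<le> B"
    using compact_imp_bounded bounded_iff by metis
  then show ?thesis by (intro that[of B]) force
qed

lemma integrable_surf2_continuous:
  fixes F :: "(real^5) \<times> (real^5) \<Rightarrow> real"
  assumes F: "continuous_on UNIV F"
  shows "integrable surf2 F"
proof -
  have m [measurable]: "F \<in> borel_measurable borel"
    using F by (rule borel_measurable_continuous_onI)
  obtain B where B: "\<And>\<xi> \<eta>. norm \<xi> = 1 \<Longrightarrow> norm \<eta> = 1 \<Longrightarrow> \<bar>F (\<xi>, \<eta>)\<bar> \<le> B"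
    using continuous_surf2_bounded[OF F] by blast
  have "AE z in surf2. norm (F z) \<le> B"
    by (rule AE_surf2I) (auto intro: B)
  then show ?thesis
    using m unfolding measurable_cong_sets[OF sets_surf2 refl, symmetric] by (rule SS.integrable_const_bound)
qed

text \<open>Tonelli, integrating the kernel first: its mass is the same at every point of the
  sphere.\<close>

lemma integrable_ker_square:
  assumes b: "0 < b" "b < 2" and f: "square_integrable f"
  shows "(\<integral>\<^sup>+z. ennreal (ker b 0 (fst z) (snd z) * (f (snd z))\<^sup>2) \<partial>surf2) = ennreal (ker_mass b) * ennreal (\<integral>x. (f x)\<^sup>2 \<partial>surf)"
proof -
  have [measurable]: "f \<in> borel_measurable borel"
    using borel_measurable_integrable[OF integrable_square_integrable[OF f]] by simp
  have "(\<integral>\<^sup>+z. ennreal (ker b 0 (fst z) (snd z) * (f (snd z))\<^sup>2) \<partial>surf2)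
    = (\<integral>\<^sup>+\<eta>. \<integral>\<^sup>+\<xi>. ennreal (ker b 0 \<xi> \<eta> * (f \<eta>)\<^sup>2) \<partial>surf \<partial>surf)"
    by (subst SS.nn_integral_snd[symmetric]) auto
  also have "\<dots> = (\<integral>\<^sup>+\<eta>. ennreal (ker_mass b) * ennreal ((f \<eta>)\<^sup>2) \<partial>surf)"
  proof (rule nn_integral_cong_AE, rule AE_surf_sphereI)
    fix \<eta> :: "real^5" assume "norm \<eta> = 1"
    then show "(\<integral>\<^sup>+\<xi>. ennreal (ker b 0 \<xi> \<eta> * (f \<eta>)\<^sup>2) \<partial>surf) = ennreal (ker_mass b) * ennreal ((f \<eta>)\<^sup>2)"
      using nn_integral_ker[OF b, of \<eta>] by (simp add: ennreal_mult nn_integral_multc ker_commute[of b 0 _ \<eta>])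
  qed
  also have "\<dots> = ennreal (ker_mass b) * ennreal (\<integral>x. (f x)\<^sup>2 \<partial>surf)"
    using f by (simp add: nn_integral_cmult nn_integral_eq_integral square_integrable_def)
  finally show ?thesis .
qed

text \<open>A product is at most the sum of the squares, and each square is integrable against the
  kernel. This is what licenses Fubini in the pairings below.\<close>

lemma integrable_ker_product:
  assumes b: "0 < b" "b < 2" and f: "square_integrable f" and g: "square_integrable g"
  shows "integrable surf2 (\<lambda>(\<xi>, \<eta>). ker b 0 \<xi> \<eta> * f \<eta> * g \<xi>)"
proof -
  have [measurable]: "f \<in> borel_measurable borel" "g \<in> borel_measurable borel"
    using f g borel_measurable_integrable[OF integrable_square_integrable] by auto
  have 1: "integrable surf2 (\<lambda>z. ker b 0 (fst z) (snd z) * (f (snd z))\<^sup>2)" if f: "square_integrable f" for f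
  proof -
    have [measurable]: "f \<in> borel_measurable borel"
      using borel_measurable_integrable[OF integrable_square_integrable[OF f]] by simp
    show ?thesis
    proof (rule integrableI_nonneg)
      show "(\<integral>\<^sup>+z. ennreal (ker b 0 (fst z) (snd z) * (f (snd z))\<^sup>2) \<partial>surf2) < \<infinity>"
        unfolding integrable_ker_square[OF b f] by (simp add: ennreal_mult_less_top)
    qed auto
  qed
  have 2: "integrable surf2 (\<lambda>z. ker b 0 (fst z) (snd z) * (g (fst z))\<^sup>2)"
    using SS.integrable_product_swap[OF 1[OF g]]
    by (simp add: case_prod_unfold ker_commute[of b 0 "snd _"])
  show ?thesis
  proof (rule Bochner_Integration.integrable_bound)
    show "integrable surf2 (\<lambda>z. ker b 0 (fst z) (snd z) * (f (snd z))\<^sup>2 + ker b 0 (fst z) (snd z) * (g (fst z))\<^sup>2)"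
      by (intro Bochner_Integration.integrable_add 1 2 f)
    show "AE z in surf2. norm (case z of (\<xi>, \<eta>) \<Rightarrow> ker b 0 \<xi> \<eta> * f \<eta> * g \<xi>)
      \<le> norm (ker b 0 (fst z) (snd z) * (f (snd z))\<^sup>2 + ker b 0 (fst z) (snd z) * (g (fst z))\<^sup>2)"
    proof (rule AE_I2)
      fix z :: "(real^5) \<times> (real^5)"
      have "\<bar>f (snd z) * g (fst z)\<bar> \<le> (f (snd z))\<^sup>2 + (g (fst z))\<^sup>2"
        using sum_squares_bound[of "\<bar>f (snd z)\<bar>" "\<bar>g (fst z)\<bar>"]
          mult_nonneg_nonneg[OF abs_ge_zero[of "f (snd z)"] abs_ge_zero[of "g (fst z)"]]
        unfolding abs_mult power2_abs mult.assoc by linarith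
      then show "norm (case z of (\<xi>, \<eta>) \<Rightarrow> ker b 0 \<xi> \<eta> * f \<eta> * g \<xi>)
        \<le> norm (ker b 0 (fst z) (snd z) * (f (snd z))\<^sup>2 + ker b 0 (fst z) (snd z) * (g (fst z))\<^sup>2)"
        using mult_left_mono[OF _ ker_nonneg[of b 0 "fst z" "snd z"]]
        by (simp add: case_prod_unfold distrib_left[symmetric] abs_mult mult.assoc)
    qed
  qed (simp add: case_prod_unfold)
qed

text \<open>Schur's test: the kernel is split into square roots, Cauchy-Schwarz is applied, and one
  factor integrates to the constant \<open>ker_mass b\<close>.\<close>

lemma square_integrable_riesz:
  assumes b: "0 < b" "b < 2" and f: "square_integrable f"
  shows "square_integrable (\<lambda>\<xi>. \<integral>\<eta>. ker b 0 \<xi> \<eta> * f \<eta> \<partial>surf)"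
proof -
  have [measurable]: "f \<in> borel_measurable borel"
    using borel_measurable_integrable[OF integrable_square_integrable[OF f]] by simp
  define h where "h = (\<lambda>\<xi>. \<integral>\<eta>. ker b 0 \<xi> \<eta> * f \<eta> \<partial>surf)"
  have [measurable]: "h \<in> borel_measurable surf"
    unfolding h_def by (rule surf.borel_measurable_lebesgue_integral) (simp add: case_prod_unfold)
  have bound: "ennreal ((h \<xi>)\<^sup>2) \<le> ennreal (ker_mass b) * (\<integral>\<^sup>+\<eta>. ennreal (ker b 0 \<xi> \<eta> * (f \<eta>)\<^sup>2) \<partial>surf)" if \<xi>: "norm \<xi> = 1" for \<xi>
  proof (cases "integrable surf (\<lambda>\<eta>. ker b 0 \<xi> \<eta> * f \<eta>)")
    case True
    have "ennreal \<bar>h \<xi>\<bar> \<le> (\<integral>\<^sup>+\<eta>. ennreal \<bar>ker b 0 \<xi> \<eta> * f \<eta>\<bar> \<partial>surf)"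
      using integral_norm_bound_ennreal[OF True] by (simp add: h_def)
    also have "\<dots> = (\<integral>\<^sup>+\<eta>. ennreal (sqrt (ker b 0 \<xi> \<eta>)) * ennreal (sqrt (ker b 0 \<xi> \<eta>) * \<bar>f \<eta>\<bar>) \<partial>surf)"
      by (intro nn_integral_cong) (simp add: ennreal_mult'[symmetric] abs_mult mult.assoc[symmetric])
    finally have "(ennreal \<bar>h \<xi>\<bar>)\<^sup>2 \<le> (\<integral>\<^sup>+\<eta>. ennreal (sqrt (ker b 0 \<xi> \<eta>)) * ennreal (sqrt (ker b 0 \<xi> \<eta>) * \<bar>f \<eta>\<bar>) \<partial>surf)\<^sup>2"
      by (rule power_mono) simp
    also have "\<dots> \<le> (\<integral>\<^sup>+\<eta>. (ennreal (sqrt (ker b 0 \<xi> \<eta>)))\<^sup>2 \<partial>surf) * (\<integral>\<^sup>+\<eta>. (ennreal (sqrt (ker b 0 \<xi> \<eta>) * \<bar>f \<eta>\<bar>))\<^sup>2 \<partial>surf)"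
      by (rule Cauchy_Schwarz_nn_integral) measurable
    also have "\<dots> = ennreal (ker_mass b) * (\<integral>\<^sup>+\<eta>. ennreal (ker b 0 \<xi> \<eta> * (f \<eta>)\<^sup>2) \<partial>surf)"
      by (simp add: ennreal_power power_mult_distrib nn_integral_ker[OF b \<xi>])
    finally show ?thesis by (simp add: ennreal_power)
  next
    case False
    \<comment> \<open>A divergent inner integral is 0 by convention, so the bound is trivial
      there.\<close>
    then show ?thesis by (simp add: h_def not_integrable_integral_eq)
  qed
  have "(\<integral>\<^sup>+\<xi>. ennreal ((h \<xi>)\<^sup>2) \<partial>surf) \<le> (\<integral>\<^sup>+\<xi>. ennreal (ker_mass b) * (\<integral>\<^sup>+\<eta>. ennreal (ker b 0 \<xi> \<eta> * (f \<eta>)\<^sup>2) \<partial>surf) \<partial>surf)"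
    by (intro nn_integral_mono_AE AE_surf_sphereI bound)
  also have "\<dots> = ennreal (ker_mass b) * (\<integral>\<^sup>+z. ennreal (ker b 0 (fst z) (snd z) * (f (snd z))\<^sup>2) \<partial>surf2)"
    by (subst nn_integral_cmult, measurable) (subst surf.nn_integral_fst[symmetric], auto)
  also have "\<dots> < \<infinity>"
    unfolding integrable_ker_square[OF b f] by (simp add: ennreal_mult_less_top)
  finally have "integrable surf (\<lambda>\<xi>. (h \<xi>)\<^sup>2)"
    by (intro integrableI_nonneg) auto
  then show ?thesis unfolding square_integrable_def h_def[symmetric] by simp
qed

lemma riesz_class:
  assumes \<alpha>: "0 < \<alpha>" "\<alpha> < 4" and f: "square_integrable f"
  shows "riesz \<alpha> (class_of f) = class_of (\<lambda>\<xi>. \<integral>\<eta>. ker (\<alpha> / 2) 0 \<xi> \<eta> * f \<eta> \<partial>surf)"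
proof -
  have [measurable]: "f \<in> borel_measurable borel" "rep_l2_S4 (class_of f) \<in> borel_measurable borel"
    using borel_measurable_integrable[OF integrable_square_integrable] f square_integrable_rep by auto
  have "(\<integral>\<eta>. ker (\<alpha> / 2) 0 \<xi> \<eta> * rep_l2_S4 (class_of f) \<eta> \<partial>surf) = (\<integral>\<eta>. ker (\<alpha> / 2) 0 \<xi> \<eta> * f \<eta> \<partial>surf)" for \<xi>
  proof (rule integral_cong_AE)
    show "AE \<eta> in surf. ker (\<alpha> / 2) 0 \<xi> \<eta> * rep_l2_S4 (class_of f) \<eta> = ker (\<alpha> / 2) 0 \<xi> \<eta> * f \<eta>"
      using rep_class[OF f] by eventually_elim simp
  qed measurable
  then show ?thesis by (simp add: riesz_def ker_dist)
qed

lemma inner_riesz: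
  assumes \<alpha>: "0 < \<alpha>" "\<alpha> < 4" and f: "square_integrable f" and g: "square_integrable g"
  shows "inner (riesz \<alpha> (class_of f)) (class_of g) = (\<integral>z. (case z of (\<xi>, \<eta>) \<Rightarrow> ker (\<alpha> / 2) 0 \<xi> \<eta> * f \<eta> * g \<xi>) \<partial>surf2)"
proof -
  have b: "0 < \<alpha> / 2" "\<alpha> / 2 < 2" using \<alpha> by auto
  have "inner (riesz \<alpha> (class_of f)) (class_of g) = (\<integral>\<xi>. (\<integral>\<eta>. ker (\<alpha> / 2) 0 \<xi> \<eta> * f \<eta> \<partial>surf) * g \<xi> \<partial>surf)"
    unfolding riesz_class[OF \<alpha> f] by (rule inner_class[OF square_integrable_riesz[OF b f] g])
  also have "\<dots> = (\<integral>\<xi>. (\<integral>\<eta>. ker (\<alpha> / 2) 0 \<xi> \<eta> * f \<eta> * g \<xi> \<partial>surf) \<partial>surf)"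
    by simp
  also have "\<dots> = (\<integral>z. (case z of (\<xi>, \<eta>) \<Rightarrow> ker (\<alpha> / 2) 0 \<xi> \<eta> * f \<eta> * g \<xi>) \<partial>surf2)"
    by (rule SS.integral_fst[OF integrable_ker_product[OF b f g]])
  finally show ?thesis .
qed

lemma riesz_symmetric:
  assumes \<alpha>: "0 < \<alpha>" "\<alpha> < 4"
  shows "inner (riesz \<alpha> \<Phi>) \<Psi> = inner \<Phi> (riesz \<alpha> \<Psi>)"
proof -
  have b: "0 < \<alpha> / 2" "\<alpha> / 2 < 2" using \<alpha> by auto
  obtain f g where f: "square_integrable f" "\<Phi> = class_of f" and g: "square_integrable g" "\<Psi> = class_of g"
    using class_rep square_integrable_rep by metis
  have "inner (riesz \<alpha> \<Psi>) \<Phi> = (\<integral>z. (case z of (\<xi>, \<eta>) \<Rightarrow> ker (\<alpha> / 2) 0 \<xi> \<eta> * g \<eta> * f \<xi>) \<partial>surf2)"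
    unfolding f g by (rule inner_riesz[OF \<alpha> g(1) f(1)])
  also have "\<dots> = (\<integral>z. (case z of (\<xi>, \<eta>) \<Rightarrow> ker (\<alpha> / 2) 0 \<eta> \<xi> * g \<xi> * f \<eta>) \<partial>surf2)"
    using SS.integral_product_swap[OF borel_measurable_integrable[OF integrable_ker_product[OF b g(1) f(1)]]]
    by (simp add: case_prod_unfold)
  also have "\<dots> = inner (riesz \<alpha> \<Phi>) \<Psi>"
    unfolding f g inner_riesz[OF \<alpha> f(1) g(1)] by (simp add: ker_commute mult_ac case_prod_unfold)
  finally show ?thesis by (simp add: inner_commute)
qed

text \<open>Deduced by duality from the symmetry. Adding the defining integrals pointwise would
  require their convergence, which is only available almost everywhere.\<close>

lemma linear_riesz:
  assumes \<alpha>: "0 < \<alpha>" "\<alpha> < 4"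
  shows "linear (riesz \<alpha>)"
proof (rule linearI)
  fix \<Phi> \<Psi> c
  have "inner (riesz \<alpha> (\<Phi> + \<Psi>) - (riesz \<alpha> \<Phi> + riesz \<alpha> \<Psi>)) \<Theta> = 0" for \<Theta>
    by (simp add: inner_diff_left inner_add_left riesz_symmetric[OF \<alpha>])
  then show "riesz \<alpha> (\<Phi> + \<Psi>) = riesz \<alpha> \<Phi> + riesz \<alpha> \<Psi>"
    by (metis inner_eq_zero_iff right_minus_eq)
  have "inner (riesz \<alpha> (c *\<^sub>R \<Phi>) - c *\<^sub>R riesz \<alpha> \<Phi>) \<Theta> = 0" for \<Theta>
    by (simp add: inner_diff_left riesz_symmetric[OF \<alpha>])
  then show "riesz \<alpha> (c *\<^sub>R \<Phi>) = c *\<^sub>R riesz \<alpha> \<Phi>"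
    by (metis inner_eq_zero_iff right_minus_eq)
qed

section \<open>Eigenvalues of the Riesz operator\<close>

lemma C1_mult:
  assumes f: "C1 f" and g: "C1 g"
  shows "C1 (\<lambda>x. f x * g x)"
  unfolding Ck_on.simps
proof (intro conjI ballI allI)
  fix x :: "real^5" assume "x \<in> - {0}"
  then show "(\<lambda>x. f x * g x) differentiable (at x)"
    by (intro differentiable_mult C1_differentiable f g) auto
next
  fix v
  have eq: "frechet_derivative (\<lambda>x. f x * g x) (at x) v
    = f x * frechet_derivative g (at x) v + frechet_derivative f (at x) v * g x" if "x \<noteq> 0" for x
  proof -
    have "((\<lambda>x. f x * g x) has_derivative
        (\<lambda>h. f x * frechet_derivative g (at x) h + frechet_derivative f (at x) h * g x)) (at x)"
      using C1_differentiable[OF f that] C1_differentiable[OF g that]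
      by (intro has_derivative_mult) (simp_all add: frechet_derivative_works[symmetric])
    from fun_cong[OF frechet_derivative_at[OF this], of v] show ?thesis by simp
  qed
  have "continuous_on (- {0}) (\<lambda>x. f x * frechet_derivative g (at x) v + frechet_derivative f (at x) v * g x)"
    using f g C1_continuous[OF f] C1_continuous[OF g] unfolding Ck_on.simps
    by (intro continuous_on_add continuous_on_mult) auto
  then show "continuous_on (- {0}) (\<lambda>x. frechet_derivative (\<lambda>x. f x * g x) (at x) v)"
    by (rule continuous_on_eq) (simp add: eq)
qed

lemma ker_has_derivative:
  assumes "\<epsilon> > 0"
  shows "(ker b \<epsilon> \<xi> has_derivative
    (\<lambda>v. - b * (inner (\<xi> - \<eta>) (\<xi> - \<eta>) + \<epsilon>) powr (- b - 1) * (2 * inner (\<eta> - \<xi>) v))) (at \<eta>)"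
proof -
  define s where "s = (\<lambda>\<eta>. inner (\<xi> - \<eta>) (\<xi> - \<eta>) + \<epsilon>)"
  have pos: "s \<eta> > 0" using assms by (simp add: s_def add_nonneg_pos)
  have "(s has_derivative (\<lambda>v. 2 * inner (\<eta> - \<xi>) v)) (at \<eta>)"
    unfolding s_def
    by (auto intro!: derivative_eq_intros simp: inner_diff_left inner_diff_right inner_commute fun_eq_iff)
  moreover have "((\<lambda>u. u powr (- b)) has_real_derivative - b * s \<eta> powr (- b - 1)) (at (s \<eta>))"
    using has_real_derivative_powr[OF pos, of "- b"] by simp
  ultimately have "((\<lambda>x. s x powr (- b)) has_derivative (\<lambda>v. - b * s \<eta> powr (- b - 1) * (2 * inner (\<eta> - \<xi>) v))) (at \<eta>)"
    unfolding has_field_derivative_def by (rule has_derivative_compose)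
  then show ?thesis unfolding s_def ker_def[abs_def] .
qed

lemma C1_ker:
  assumes e: "\<epsilon> > 0"
  shows "C1 (ker b \<epsilon> \<xi>)"
  unfolding Ck_on.simps
proof (intro conjI ballI allI)
  show "ker b \<epsilon> \<xi> differentiable (at x)" for x
    by (rule differentiableI[OF ker_has_derivative[OF e]])
  fix v
  have pos: "inner (\<xi> - x) (\<xi> - x) + \<epsilon> \<noteq> 0" for x
    using e by (metis add_nonneg_pos inner_ge_zero less_irrefl)
  have "continuous_on (- {0}) (\<lambda>x. - b * (inner (\<xi> - x) (\<xi> - x) + \<epsilon>) powr (- b - 1) * (2 * inner (x - \<xi>) v))"
    using pos by (intro continuous_intros) auto
  then show "continuous_on (- {0}) (\<lambda>x. frechet_derivative (ker b \<epsilon> \<xi>) (at x) v)"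
    by (rule continuous_on_eq) (simp add: fun_cong[OF frechet_derivative_at[OF ker_has_derivative[OF e]], symmetric])
qed

text \<open>For unit \<open>\<eta>\<close> this is the derivative of the regularised kernel in
  \<open>\<eta>\<close> along the conformal field. At \<epsilon> = 0 its singularity on the sphere
  has order 2b + 1, one more than that of the kernel.\<close>

definition dker :: "real \<Rightarrow> real \<Rightarrow> 5 \<Rightarrow> real^5 \<Rightarrow> real^5 \<Rightarrow> real" where
  "dker b \<epsilon> i \<xi> \<eta> = - b * (inner (\<xi> - \<eta>) (\<xi> - \<eta>) + \<epsilon>) powr (- b - 1) * (2 * (inner \<xi> \<eta> * \<eta> $ i - \<xi> $ i))"

lemma conf_ker:
  assumes e: "\<epsilon> > 0" and \<eta>: "norm \<eta> = 1"
  shows "conf i (ker b \<epsilon> \<xi>) \<eta> = dker b \<epsilon> i \<xi> \<eta>"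
proof -
  define c where "c = - b * (inner (\<xi> - \<eta>) (\<xi> - \<eta>) + \<epsilon>) powr (- b - 1)"
  have pd: "pd j (ker b \<epsilon> \<xi>) \<eta> = c * (2 * (\<eta> $ j - \<xi> $ j))" for j
    using pd_eqI[OF ker_has_derivative[OF e]] by (simp add: c_def inner_axis)
  have "conf i (ker b \<epsilon> \<xi>) \<eta> = c * (2 * (\<eta> $ i - \<xi> $ i)) - \<eta> $ i * (\<Sum>j\<in>UNIV. \<eta> $ j * (c * (2 * (\<eta> $ j - \<xi> $ j))))"
    unfolding conf_pd[OF differentiableI[OF ker_has_derivative[OF e]] \<eta>] pd ..
  also have "(\<Sum>j\<in>UNIV. \<eta> $ j * (c * (2 * (\<eta> $ j - \<xi> $ j)))) = 2 * c * (inner \<eta> \<eta> - inner \<xi> \<eta>)"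
    by (simp add: inner_vec_def sum_distrib_left sum_subtractf[symmetric] algebra_simps)
  also have "inner \<eta> \<eta> = 1" using \<eta> by (simp add: dot_square_norm)
  finally show ?thesis by (simp add: dker_def c_def algebra_simps)
qed

lemma poly_conf: "poly_fun f \<Longrightarrow> poly_fun (conf i f)"
  unfolding conf_def[abs_def] by (intro real_polynomial_function_sum poly_mult poly_coord poly_rot_deriv) auto

lemma continuous_dker:
  assumes e: "\<epsilon> > 0" and f: "continuous_on S f" and g: "continuous_on S g"
  shows "continuous_on S (\<lambda>x. dker b \<epsilon> i (f x) (g x))"
proof -
  have "inner (f x - g x) (f x - g x) + \<epsilon> \<noteq> 0" for x
    using e by (metis add_nonneg_pos inner_ge_zero less_irrefl)
  then show ?thesis
    unfolding dker_def by (intro continuous_intros f g) auto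
qed

lemma integral_conf_ker:
  assumes e: "\<epsilon> > 0" and f: "poly_fun f"
  shows "(\<integral>\<eta>. ker b \<epsilon> \<xi> \<eta> * conf i f \<eta> + dker b \<epsilon> i \<xi> \<eta> * f \<eta> - 4 * (\<eta> $ i * (ker b \<epsilon> \<xi> \<eta> * f \<eta>)) \<partial>surf) = 0"
proof -
  let ?h = "\<lambda>\<eta>. ker b \<epsilon> \<xi> \<eta> * f \<eta>"
  have C: "C1 ?h" by (intro C1_mult C1_ker e poly_Ck f)
  have k: "continuous_on (- {0}) (ker b \<epsilon> \<xi>)" "continuous_on (- {0}) (dker b \<epsilon> i \<xi>)"
    using continuous_ker[OF e continuous_on_const continuous_on_id] continuous_dker[OF e continuous_on_const continuous_on_id]
    by auto
  have c1: "continuous_on (- {0}) (\<lambda>\<eta>. ker b \<epsilon> \<xi> \<eta> * conf i f \<eta> + dker b \<epsilon> i \<xi> \<eta> * f \<eta>)"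
    by (intro continuous_on_add continuous_on_mult k poly_continuous f poly_conf)
  have c2: "continuous_on (- {0}) (\<lambda>\<eta>. \<eta> $ i * (ker b \<epsilon> \<xi> \<eta> * f \<eta>))"
    by (intro continuous_on_mult k poly_continuous f poly_coord)
  have "(\<integral>\<eta>. ker b \<epsilon> \<xi> \<eta> * conf i f \<eta> + dker b \<epsilon> i \<xi> \<eta> * f \<eta> \<partial>surf) = (\<integral>\<eta>. conf i ?h \<eta> \<partial>surf)"
  proof (rule integral_cong_AE)
    show "AE \<eta> in surf. ker b \<epsilon> \<xi> \<eta> * conf i f \<eta> + dker b \<epsilon> i \<xi> \<eta> * f \<eta> = conf i ?h \<eta>"
      using conf_ker[OF e] conf_mult[OF differentiableI[OF ker_has_derivative[OF e]] poly_differentiable[OF f]]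
      by (intro AE_surf_sphereI) simp
    show "(\<lambda>\<eta>. ker b \<epsilon> \<xi> \<eta> * conf i f \<eta> + dker b \<epsilon> i \<xi> \<eta> * f \<eta>) \<in> borel_measurable surf"
      using measurable_continuous_punctured[OF c1] by simp
    show "conf i ?h \<in> borel_measurable surf"
      using measurable_continuous_punctured[OF continuous_conf[OF C]] by simp
  qed
  also have "\<dots> = 4 * (\<integral>\<eta>. \<eta> $ i * ?h \<eta> \<partial>surf)" by (rule integral_conf[OF C])
  finally show ?thesis
    using integrable_surf_continuous[OF c1] integrable_surf_continuous[OF c2] by simp
qed

text \<open>Two divergence identities, one in \<open>\<eta>\<close> weighted by \<open>g\<close> and
  one in \<open>\<xi>\<close> weighted by \<open>f\<close>. Each integrates to 0 in its own
  variable; only their sum brings the two derivatives of the kernel together.\<close>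

definition conf_form ::
    "real \<Rightarrow> real \<Rightarrow> 5 \<Rightarrow> (real^5 \<Rightarrow> real) \<Rightarrow> (real^5 \<Rightarrow> real) \<Rightarrow> (real^5) \<times> (real^5) \<Rightarrow> real" where
  "conf_form b \<epsilon> i f g = (\<lambda>(\<xi>, \<eta>).
      (ker b \<epsilon> \<xi> \<eta> * conf i f \<eta> + dker b \<epsilon> i \<xi> \<eta> * f \<eta> - 4 * (\<eta> $ i * (ker b \<epsilon> \<xi> \<eta> * f \<eta>))) * g \<xi>
    + (ker b \<epsilon> \<eta> \<xi> * conf i g \<xi> + dker b \<epsilon> i \<eta> \<xi> * g \<xi> - 4 * (\<xi> $ i * (ker b \<epsilon> \<eta> \<xi> * g \<xi>))) * f \<eta>)"

lemma integral_conf_form: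
  assumes e: "\<epsilon> > 0" and f: "poly_fun f" and g: "poly_fun g"
  shows "integrable surf2 (conf_form b \<epsilon> i f g)" "(\<integral>z. conf_form b \<epsilon> i f g z \<partial>surf2) = 0"
proof -
  define F where "F f g = (\<lambda>\<xi> \<eta>. (ker b \<epsilon> \<xi> \<eta> * conf i f \<eta> + dker b \<epsilon> i \<xi> \<eta> * f \<eta> - 4 * (\<eta> $ i * (ker b \<epsilon> \<xi> \<eta> * f \<eta>))) * g \<xi>)" for f g
  have cont: "continuous_on UNIV (\<lambda>z. F f g (u z) (v z))" if "poly_fun f" "poly_fun g"
      "continuous_on UNIV u" "continuous_on UNIV v" for f g and u v :: "(real^5) \<times> (real^5) \<Rightarrow> real^5"
    unfolding F_def using that
    by (intro continuous_intros continuous_ker continuous_dker e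
        continuous_on_compose2[OF poly_continuous[OF that(1), of UNIV] that(4)]
        continuous_on_compose2[OF poly_continuous[OF that(2), of UNIV] that(3)]
        continuous_on_compose2[OF poly_continuous[OF poly_conf[OF that(1)], of UNIV] that(4)]) auto
  have int1: "integrable surf2 (\<lambda>(\<xi>, \<eta>). F f g \<xi> \<eta>)"
    unfolding case_prod_unfold by (intro integrable_surf2_continuous cont f g continuous_on_fst continuous_on_snd continuous_on_id)
  have int2: "integrable surf2 (\<lambda>(\<xi>, \<eta>). F g f \<eta> \<xi>)"
    unfolding case_prod_unfold by (intro integrable_surf2_continuous cont f g continuous_on_fst continuous_on_snd continuous_on_id)
  have zero: "(\<integral>\<eta>. F f g \<xi> \<eta> \<partial>surf) = 0" if "poly_fun f" for f g \<xi>
    using integral_conf_ker[OF e that, of b \<xi> i] by (simp add: F_def)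
  have T: "conf_form b \<epsilon> i f g = (\<lambda>z. (case z of (\<xi>, \<eta>) \<Rightarrow> F f g \<xi> \<eta>) + (case z of (\<xi>, \<eta>) \<Rightarrow> F g f \<eta> \<xi>))"
    by (simp add: conf_form_def F_def fun_eq_iff)
  show "integrable surf2 (conf_form b \<epsilon> i f g)" unfolding T by (intro Bochner_Integration.integrable_add int1 int2)
  show "(\<integral>z. conf_form b \<epsilon> i f g z \<partial>surf2) = 0"
    unfolding T Bochner_Integration.integral_add[OF int1 int2]
    using SS.integral_fst[OF int1] SS.integral_snd[OF int2] by (simp add: zero f g)
qed

text \<open>The conformal covariance of the kernel. Each bracket in \<open>dker\<close> vanishes on
  the diagonal only to first order, but the two doubled brackets add up to -|xi - eta|^2 (xi_i +
  eta_i), and this second power compensates the extra exponent -1.\<close>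

lemma dker_sum:
  assumes "norm \<xi> = 1" "norm \<eta> = 1"
  shows "dker b \<epsilon> i \<xi> \<eta> + dker b \<epsilon> i \<eta> \<xi>
    = b * ((inner (\<xi> - \<eta>) (\<xi> - \<eta>) + \<epsilon>) powr (- b - 1) * inner (\<xi> - \<eta>) (\<xi> - \<eta>)) * (\<xi> $ i + \<eta> $ i)"
  using sphere_dist[OF assms] sphere_dist[OF assms(2,1)]
  by (simp add: dker_def inner_commute[of \<eta> \<xi>] algebra_simps)

text \<open>As \<epsilon> tends to 0, the divergence supplies the coefficient 4 and the covariance
  of the kernel takes off b. A multiple of the singular kernel dominates, since \<open>A\<close> and
  \<open>B\<close> are bounded on the product of spheres.\<close>

lemma integral_intertwining:
  assumes b: "0 < b" "b < 2" and f: "poly_fun f" and g: "poly_fun g"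
  shows "(\<integral>z. (case z of (\<xi>, \<eta>) \<Rightarrow> ker b 0 \<xi> \<eta> * (conf i f \<eta> * g \<xi> + f \<eta> * conf i g \<xi>
    - (4 - b) * ((\<eta> $ i + \<xi> $ i) * (f \<eta> * g \<xi>)))) \<partial>surf2) = 0"
    (is "(\<integral>z. ?L z \<partial>surf2) = 0")
proof -
  define e where "e n = 1 / real (Suc n)" for n
  have e: "e n > 0" for n by (simp add: e_def)
  define T where "T n = conf_form b (e n) i f g" for n
  note T_int = integral_conf_form[OF e f g, of b _ i, folded T_def]
  define s where "s = (\<lambda>\<xi> \<eta> :: real^5. inner (\<xi> - \<eta>) (\<xi> - \<eta>))"
  define A where "A = (\<lambda>(\<xi>, \<eta>). conf i f \<eta> * g \<xi> + f \<eta> * conf i g \<xi> - 4 * ((\<eta> $ i + \<xi> $ i) * (f \<eta> * g \<xi>)))"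
  define B where "B = (\<lambda>(\<xi> :: real^5, \<eta> :: real^5). (\<eta> $ i + \<xi> $ i) * (f \<eta> * g \<xi>))"
  have T_eq: "T n (\<xi>, \<eta>) = ker b (e n) \<xi> \<eta> * A (\<xi>, \<eta>) + b * ((s \<xi> \<eta> + e n) powr (- b - 1) * s \<xi> \<eta>) * B (\<xi>, \<eta>)"
    if "norm \<xi> = 1" "norm \<eta> = 1" for n \<xi> \<eta>
  proof -
    have "T n (\<xi>, \<eta>) = ker b (e n) \<xi> \<eta> * A (\<xi>, \<eta>) + (dker b (e n) i \<xi> \<eta> + dker b (e n) i \<eta> \<xi>) * (f \<eta> * g \<xi>)"
      by (simp add: T_def conf_form_def A_def ker_commute[of b _ \<eta> \<xi>] algebra_simps)
    then show ?thesis
      unfolding dker_sum[OF that] by (simp add: s_def B_def algebra_simps)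
  qed
  have L_eq: "?L (\<xi>, \<eta>) = ker b 0 \<xi> \<eta> * A (\<xi>, \<eta>) + b * ker b 0 \<xi> \<eta> * B (\<xi>, \<eta>)" for \<xi> \<eta>
    by (simp add: A_def B_def algebra_simps)
  have pc: "continuous_on UNIV (\<lambda>z. p (fst z))" "continuous_on UNIV (\<lambda>z. p (snd z))" if "poly_fun p"
    for p and z :: "(real^5) \<times> (real^5)"
    by (intro continuous_on_compose2[OF poly_continuous[OF that, of UNIV]] continuous_intros; simp)+
  have cA: "continuous_on UNIV A" and cB: "continuous_on UNIV B"
    unfolding A_def B_def case_prod_unfold
    by (intro continuous_intros pc poly_conf f g)+
  have [measurable]: "A \<in> borel_measurable surf2" "B \<in> borel_measurable surf2"
    using borel_measurable_continuous_onI[OF cA] borel_measurable_continuous_onI[OF cB]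
    unfolding measurable_cong_sets[OF sets_surf2 refl] by auto
  obtain MA where MA: "\<And>\<xi> \<eta>. norm \<xi> = 1 \<Longrightarrow> norm \<eta> = 1 \<Longrightarrow> \<bar>A (\<xi>, \<eta>)\<bar> \<le> MA"
    using continuous_surf2_bounded[OF cA] by blast
  obtain MB where MB: "\<And>\<xi> \<eta>. norm \<xi> = 1 \<Longrightarrow> norm \<eta> = 1 \<Longrightarrow> \<bar>B (\<xi>, \<eta>)\<bar> \<le> MB"
    using continuous_surf2_bounded[OF cB] by blast
  have AE: "AE z in surf2. P (fst z) (snd z)" if P: "\<And>\<xi> \<eta>. norm \<xi> = 1 \<Longrightarrow> norm \<eta> = 1 \<Longrightarrow> \<xi> \<noteq> \<eta> \<Longrightarrow> P \<xi> \<eta>" for P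
  proof -
    have "AE z in surf2. norm (fst z) = 1 \<and> norm (snd z) = 1 \<and> fst z \<noteq> snd z"
      by (rule AE_surf2I) (auto simp: borel_prod[symmetric])
    then show ?thesis by eventually_elim (auto intro: P)
  qed
  have pos: "s \<xi> \<eta> > 0" if "\<xi> \<noteq> \<eta>" for \<xi> \<eta> using that by (simp add: s_def)
  have ks: "s \<xi> \<eta> powr (- b - 1) * s \<xi> \<eta> = ker b 0 \<xi> \<eta>" if "\<xi> \<noteq> \<eta>" for \<xi> \<eta>
    using powr_add[of "s \<xi> \<eta>" "- b - 1" 1] pos[OF that] by (simp add: ker_def s_def)
  have "(\<lambda>n. \<integral>z. T n z \<partial>surf2) \<longlonglongrightarrow> (\<integral>z. ?L z \<partial>surf2)"
  proof (rule integral_dominated_convergence)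
    show "T n \<in> borel_measurable surf2" for n using T_int(1)[of n] by (rule borel_measurable_integrable)
    have "(\<lambda>z. ker b 0 (fst z) (snd z) * A z + b * ker b 0 (fst z) (snd z) * B z) \<in> borel_measurable surf2"
      by measurable
    moreover have "?L = (\<lambda>z. ker b 0 (fst z) (snd z) * A z + b * ker b 0 (fst z) (snd z) * B z)"
      using L_eq by (auto simp: fun_eq_iff)
    ultimately show "?L \<in> borel_measurable surf2" by simp
    have "AE z in surf2. (\<lambda>n. T n (fst z, snd z)) \<longlonglongrightarrow> ?L (fst z, snd z)"
    proof (rule AE)
      fix \<xi> \<eta> :: "real^5" assume n: "norm \<xi> = 1" "norm \<eta> = 1" and neq: "\<xi> \<noteq> \<eta>"
      have "(\<lambda>n. (s \<xi> \<eta> + e n) powr (- b - 1) * s \<xi> \<eta>) \<longlonglongrightarrow> s \<xi> \<eta> powr (- b - 1) * s \<xi> \<eta>"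
        unfolding e_def by (intro tendsto_mult tendsto_const shift_tendsto pos neq)
      moreover have "(\<lambda>n. ker b (e n) \<xi> \<eta>) \<longlonglongrightarrow> ker b 0 \<xi> \<eta>"
        unfolding e_def by (rule ker_tendsto[OF neq])
      ultimately show "(\<lambda>n. T n (\<xi>, \<eta>)) \<longlonglongrightarrow> ?L (\<xi>, \<eta>)"
        unfolding T_eq[OF n] L_eq ks[OF neq] by (intro tendsto_intros)
    qed
    then show "AE z in surf2. (\<lambda>n. T n z) \<longlonglongrightarrow> ?L z" by simp
    have "square_integrable (\<lambda>x. 1)" using harmonic_square_integrable[OF harmonic_poly_one] .
    from integrable_ker_product[OF b this this]
    show "integrable surf2 (\<lambda>z. (MA + b * MB) * ker b 0 (fst z) (snd z))"
      by (intro integrable_mult_right) (simp add: case_prod_unfold)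
    fix n
    have "AE z in surf2. norm (T n (fst z, snd z)) \<le> (MA + b * MB) * ker b 0 (fst z) (snd z)"
    proof (rule AE)
      fix \<xi> \<eta> :: "real^5" assume nm: "norm \<xi> = 1" "norm \<eta> = 1" and neq: "\<xi> \<noteq> \<eta>"
      have k: "ker b (e n) \<xi> \<eta> \<le> ker b 0 \<xi> \<eta>"
        using e[of n] b neq by (intro ker_mono) auto
      have "(s \<xi> \<eta> + e n) powr (- b - 1) * s \<xi> \<eta> \<le> s \<xi> \<eta> powr (- b - 1) * s \<xi> \<eta>"
        using pos[OF neq] e[of n] b by (intro mult_right_mono powr_mono2') auto
      then have q: "(s \<xi> \<eta> + e n) powr (- b - 1) * s \<xi> \<eta> \<le> ker b 0 \<xi> \<eta>"
        unfolding ks[OF neq] .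
      have q0: "0 \<le> (s \<xi> \<eta> + e n) powr (- b - 1) * s \<xi> \<eta>"
        using pos[OF neq] by simp
      have "norm (T n (\<xi>, \<eta>)) \<le> ker b (e n) \<xi> \<eta> * \<bar>A (\<xi>, \<eta>)\<bar> + b * ((s \<xi> \<eta> + e n) powr (- b - 1) * s \<xi> \<eta>) * \<bar>B (\<xi>, \<eta>)\<bar>"
        unfolding T_eq[OF nm] using b q0 pos[OF neq]
        by (auto intro!: order_trans[OF abs_triangle_ineq] simp: abs_mult)
      also have "\<dots> \<le> ker b 0 \<xi> \<eta> * MA + b * ker b 0 \<xi> \<eta> * MB"
        using b q q0 k MA[OF nm] MB[OF nm] by (intro add_mono mult_mono) auto
      finally show "norm (T n (\<xi>, \<eta>)) \<le> (MA + b * MB) * ker b 0 \<xi> \<eta>"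
        by (simp add: algebra_simps)
    qed
    then show "AE z in surf2. norm (T n z) \<le> (MA + b * MB) * ker b 0 (fst z) (snd z)" by simp
  qed
  then show ?thesis by (simp add: T_int(2) LIMSEQ_const_iff)
qed

lemma riesz_intertwining:
  assumes \<alpha>: "0 < \<alpha>" "\<alpha> < 4" and f: "poly_fun f" and g: "poly_fun g"
  shows "inner (riesz \<alpha> (class_of (conf i f))) (class_of g) + inner (riesz \<alpha> (class_of f)) (class_of (conf i g))
    = (4 - \<alpha> / 2) * (inner (riesz \<alpha> (coord_mult i (class_of f))) (class_of g)
        + inner (riesz \<alpha> (class_of f)) (coord_mult i (class_of g)))"
proof -
  have b: "0 < \<alpha> / 2" "\<alpha> / 2 < 2" using \<alpha> by auto
  have sq: "square_integrable f" "square_integrable g" "square_integrable (conf i f)" "square_integrable (conf i g)"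
    "square_integrable (\<lambda>x. x $ i * f x)" "square_integrable (\<lambda>x. x $ i * g x)"
    by (intro poly_square_integrable f g poly_conf poly_mult poly_coord)+
  note int = integrable_ker_product[OF b sq(3,2)] integrable_ker_product[OF b sq(1,4)]
    integrable_ker_product[OF b sq(5,2)] integrable_ker_product[OF b sq(1,6)]
  have "(\<integral>z. (case z of (\<xi>, \<eta>) \<Rightarrow> ker (\<alpha> / 2) 0 \<xi> \<eta> * conf i f \<eta> * g \<xi>)
      + (case z of (\<xi>, \<eta>) \<Rightarrow> ker (\<alpha> / 2) 0 \<xi> \<eta> * f \<eta> * conf i g \<xi>)
      - (4 - \<alpha> / 2) * ((case z of (\<xi>, \<eta>) \<Rightarrow> ker (\<alpha> / 2) 0 \<xi> \<eta> * (\<eta> $ i * f \<eta>) * g \<xi>)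
        + (case z of (\<xi>, \<eta>) \<Rightarrow> ker (\<alpha> / 2) 0 \<xi> \<eta> * f \<eta> * (\<xi> $ i * g \<xi>))) \<partial>surf2) = 0" (is "?I = 0")
    by (rule trans[OF Bochner_Integration.integral_cong[OF refl] integral_intertwining[OF b f g, of i]])
      (auto simp: algebra_simps)
  moreover have "?I = (inner (riesz \<alpha> (class_of (conf i f))) (class_of g) + inner (riesz \<alpha> (class_of f)) (class_of (conf i g)))
    - (4 - \<alpha> / 2) * (inner (riesz \<alpha> (coord_mult i (class_of f))) (class_of g)
        + inner (riesz \<alpha> (class_of f)) (coord_mult i (class_of g)))"
    unfolding coord_mult_class[OF sq(1)] coord_mult_class[OF sq(2)] inner_riesz[OF \<alpha> sq(3,2)]
      inner_riesz[OF \<alpha> sq(1,4)] inner_riesz[OF \<alpha> sq(5,2)] inner_riesz[OF \<alpha> sq(1,6)]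
    using int by (simp only: Bochner_Integration.integral_diff Bochner_Integration.integral_add
        Bochner_Integration.integrable_add integrable_mult_right integral_mult_right_zero)
  ultimately show ?thesis by simp
qed

text \<open>Product rule and divergence formula; in other words, the adjoint of X_i is 4 x_i -
  X_i.\<close>

lemma inner_conf:
  assumes f: "poly_fun f" and g: "poly_fun g"
  shows "inner (class_of f) (class_of (conf i g))
    = 4 * inner (coord_mult i (class_of f)) (class_of g) - inner (class_of (conf i f)) (class_of g)"
proof -
  have sq: "square_integrable f" "square_integrable g" "square_integrable (conf i f)" "square_integrable (conf i g)"
    "square_integrable (\<lambda>x. x $ i * f x)"
    by (intro poly_square_integrable f g poly_conf poly_mult poly_coord)+
  have "(\<integral>x. f x * conf i g x + conf i f x * g x \<partial>surf) = (\<integral>x. conf i (\<lambda>x. f x * g x) x \<partial>surf)"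
    by (simp add: conf_mult[OF poly_differentiable[OF f] poly_differentiable[OF g]])
  also have "\<dots> = 4 * (\<integral>x. x $ i * (f x * g x) \<partial>surf)"
    by (rule integral_conf[OF poly_Ck[OF poly_mult[OF f g]]])
  finally have "(\<integral>x. f x * conf i g x \<partial>surf) + (\<integral>x. conf i f x * g x \<partial>surf) = 4 * (\<integral>x. x $ i * f x * g x \<partial>surf)"
    by (simp add: integrable_mult_square_integrable sq mult.assoc)
  then show ?thesis
    by (simp add: coord_mult_class inner_class sq)
qed

lemma conf_harmonic:
  assumes p: "harmonic_poly k p"
  shows "class_of (conf i p) = class_of (pd i p) - real k *\<^sub>R coord_mult i (class_of p)"
proof -
  have pp: "poly_fun p" "hom k p" using p by (auto simp: harmonic_poly_def)
  have sq: "square_integrable p" "square_integrable (pd i p)" "square_integrable (conf i p)" "square_integrable (\<lambda>x. x $ i * p x)"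
    by (intro poly_square_integrable pp poly_conf poly_mult poly_coord poly_pd)+
  have "class_of (conf i p) = class_of (\<lambda>x. pd i p x - real k * (x $ i * p x))"
  proof (rule class_eqI)
    show "AE x in surf. conf i p x = pd i p x - real k * (x $ i * p x)"
      using conf_pd[OF poly_differentiable[OF pp(1)]] by (intro AE_surf_sphereI) (simp add: euler[OF pp])
  qed (intro square_integrable_diff square_integrable_scale sq)+
  then show ?thesis by (simp add: class_diff class_scale sq coord_mult_class square_integrable_scale)
qed

text \<open>The intertwining relation also puts X_i on the test function. As
  \<open>riesz \<alpha>\<close> acts on \<open>p\<close> as a scalar, X_i can be moved back by the
  adjoint formula, and the coefficient on the right becomes 4 - (4 - \<alpha>/2) =
  \<alpha>/2.\<close>

lemma riesz_conf:
  assumes \<alpha>: "0 < \<alpha>" "\<alpha> < 4" and p: "poly_fun p" and eig: "riesz \<alpha> (class_of p) = \<mu> *\<^sub>R class_of p"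
  shows "riesz \<alpha> (class_of (conf i p) - (4 - \<alpha> / 2) *\<^sub>R coord_mult i (class_of p))
    = \<mu> *\<^sub>R (class_of (conf i p) - (\<alpha> / 2) *\<^sub>R coord_mult i (class_of p))" (is "?l = ?r")
proof -
  have "inner (?l - ?r) Z = 0" if Z: "Z \<in> harmonics m" for m Z
  proof -
    obtain q where q: "harmonic_poly m q" "Z = class_of q" using Z by (rule harmonicsE)
    note qq = harmonic_poly_poly[OF q(1)]
    have sq: "square_integrable p" "square_integrable q" "square_integrable (\<lambda>x. x $ i * p x)" "square_integrable (\<lambda>x. x $ i * q x)"
      by (intro poly_square_integrable p qq poly_mult poly_coord)+
    have sym: "inner (class_of p) (coord_mult i Z) = inner (coord_mult i (class_of p)) Z"
      unfolding q(2) coord_mult_class[OF sq(1)] coord_mult_class[OF sq(2)] inner_class[OF sq(1,4)] inner_class[OF sq(3,2)]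
      by (simp add: mult_ac)
    have lin: "inner ?l Z = inner (riesz \<alpha> (class_of (conf i p))) Z - (4 - \<alpha> / 2) * inner (riesz \<alpha> (coord_mult i (class_of p))) Z"
      by (simp add: linear_diff[OF linear_riesz[OF \<alpha>]] linear_scale[OF linear_riesz[OF \<alpha>]] inner_diff_left)
    have "inner (riesz \<alpha> (class_of (conf i p))) Z + \<mu> * inner (class_of p) (class_of (conf i q))
      = (4 - \<alpha> / 2) * (inner (riesz \<alpha> (coord_mult i (class_of p))) Z + \<mu> * inner (coord_mult i (class_of p)) Z)"
      using riesz_intertwining[OF \<alpha> p qq, of i] by (simp only: eig inner_scaleR_left q(2)[symmetric] sym)
    then show ?thesis
      unfolding inner_diff_left[of ?l ?r] lin inner_conf[OF p qq] q(2)[symmetric]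
      by (simp add: inner_diff_left algebra_simps)
  qed
  then have "?l - ?r = 0" by (rule harmonics_total)
  then show ?thesis by simp
qed

section \<open>The eigenvalue recursion\<close>

lemma mu_0:
  assumes \<alpha>: "0 < \<alpha>" "\<alpha> < 4"
  shows "mu \<alpha> 0 = ker_mass (\<alpha> / 2)"
proof -
  define b where "b = \<alpha> / 2"
  have b: "0 < b" "b < 2" "\<alpha> = 2 * b" using \<alpha> by (auto simp: b_def)
  have "Gamma (4 - b) = (3 - b) * ((2 - b) * Gamma (2 - b))"
    using Gamma_plus1[of "3 - b"] Gamma_plus1[of "2 - b"] b nonpos_Ints_nonpos[of "3 - b"] nonpos_Ints_nonpos[of "2 - b"] by fastforce
  moreover have "Gamma (2 - b) > 0" "Gamma b > 0" using b by (auto intro: Gamma_real_pos)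
  moreover have "2 powr (4 - \<alpha>) = 4 powr (2 - b)"
    using powr_powr[of 2 2 "2 - b"] b(3) by (simp add: powr_numeral)
  ultimately show ?thesis
    unfolding mu_def ker_mass_def b_def[symmetric] by (simp add: mult_ac)
qed

text \<open>The functional equation of Gamma; it is the recursion that the intertwining relation
  imposes on the eigenvalues.\<close>

lemma mu_Suc:
  assumes \<alpha>: "0 < \<alpha>" "\<alpha> < 4"
  shows "(real k + 4 - \<alpha> / 2) * mu \<alpha> (Suc k) = (real k + \<alpha> / 2) * mu \<alpha> k"
proof -
  have p: "real k + \<alpha> / 2 > 0" "real k + 4 - \<alpha> / 2 > 0" using \<alpha> by auto
  have "Gamma (real (Suc k) + \<alpha> / 2) = (real k + \<alpha> / 2) * Gamma (real k + \<alpha> / 2)"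
    using Gamma_plus1[of "real k + \<alpha> / 2"] p nonpos_Ints_nonpos[of "real k + \<alpha> / 2"] by (fastforce simp: algebra_simps)
  moreover have "Gamma (real (Suc k) + 4 - \<alpha> / 2) = (real k + 4 - \<alpha> / 2) * Gamma (real k + 4 - \<alpha> / 2)"
    using Gamma_plus1[of "real k + 4 - \<alpha> / 2"] p nonpos_Ints_nonpos[of "real k + 4 - \<alpha> / 2"] by (fastforce simp: algebra_simps)
  ultimately show ?thesis
    using p unfolding mu_def by simp
qed

text \<open>The relation for a harmonic of degree m ties degree m + 1 to the degrees m and m - 1, so
  the induction assumes all smaller degrees.\<close>

lemma riesz_harmonics:
  assumes \<alpha>: "0 < \<alpha>" "\<alpha> < 4"
  shows "Y \<in> harmonics k \<Longrightarrow> riesz \<alpha> Y = mu \<alpha> k *\<^sub>R Y"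
proof (induction k arbitrary: Y rule: less_induct)
  case (less k)
  note lin = linear_add[OF linear_riesz[OF \<alpha>]] linear_diff[OF linear_riesz[OF \<alpha>]]
    linear_scale[OF linear_riesz[OF \<alpha>]] linear_sum[OF linear_riesz[OF \<alpha>]]
  have b: "0 < \<alpha> / 2" "\<alpha> / 2 < 2" using \<alpha> by auto
  show ?case
  proof (cases k)
    case 0
    have one: "square_integrable (\<lambda>x. 1)" by (rule harmonic_square_integrable[OF harmonic_poly_one])
    have "riesz \<alpha> (class_of (\<lambda>x. 1)) = class_of (\<lambda>\<xi>. \<integral>\<eta>. ker (\<alpha> / 2) 0 \<xi> \<eta> * 1 \<partial>surf)"
      by (rule riesz_class[OF \<alpha> one])
    also have "\<dots> = class_of (\<lambda>x. mu \<alpha> 0 * 1)"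
      using integral_ker(2)[OF b]
      by (intro class_eqI AE_surf_sphereI square_integrable_riesz[OF b one] square_integrable_scale one)
        (simp add: mu_0[OF \<alpha>])
    finally have 1: "riesz \<alpha> (class_of (\<lambda>x. 1)) = mu \<alpha> 0 *\<^sub>R class_of (\<lambda>x. 1)"
      by (simp only: class_scale[OF one])
    have "Y \<in> span {class_of (\<lambda>x. 1)}" using less.prems 0 harmonics_0 by simp
    then obtain c where "Y = c *\<^sub>R class_of (\<lambda>x. 1)"
      unfolding span_singleton by auto
    then show ?thesis by (simp add: lin 1 0)
  next
    case (Suc m)
    obtain P where P: "harmonic_poly (Suc m) P" "Y = class_of P"
      using less.prems unfolding Suc by (rule harmonicsE)
    have lift: "riesz \<alpha> (class_of (lift i m p)) = mu \<alpha> k *\<^sub>R class_of (lift i m p)" if p: "harmonic_poly m p" for i p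
    proof -
      define U where "U = class_of (lift i m p)"
      define V where "V = (1 / (2 * real m + 3)) *\<^sub>R class_of (pd i p)"
      have M: "coord_mult i (class_of p) = U + V"
        unfolding U_def V_def by (rule coord_mult_harmonic[OF p])
      have "class_of (pd i p) = (2 * real m + 3) *\<^sub>R V" by (simp add: V_def)
      then have cf: "class_of (conf i p) = (2 * real m + 3) *\<^sub>R V - real m *\<^sub>R (U + V)"
        using conf_harmonic[OF p, of i] by (simp add: M)
      \<comment> \<open>The recursion at degree m - 1, kept in multiplied form. For m = 0 the factor
        on the left may vanish, but then V = 0.\<close>
      have RV: "(real m - 1 + \<alpha> / 2) *\<^sub>R riesz \<alpha> V = (mu \<alpha> m * (real m + 3 - \<alpha> / 2)) *\<^sub>R V"
      proof (cases m)
        case 0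
        have "pd i p = (\<lambda>x. 0)" using p 0 hom_0_pd[of p i] by (simp add: harmonic_poly_def)
        then have "V = 0" by (simp add: V_def class_zero)
        then show ?thesis using lin(3)[of 0 0] by simp
      next
        case (Suc n)
        have "class_of (pd i p) \<in> harmonics n"
          using harmonic_class[OF harmonic_poly_pd[OF p, of i]] Suc by simp
        then have "V \<in> harmonics n"
          unfolding V_def by (intro subspace_scale subspace_harmonics)
        then have "riesz \<alpha> V = mu \<alpha> n *\<^sub>R V"
          using less.IH[of n] \<open>k = Suc m\<close> Suc by simp
        then show ?thesis using mu_Suc[OF \<alpha>, of n] Suc by (simp add: algebra_simps)
      qed
      have "riesz \<alpha> (class_of p) = mu \<alpha> m *\<^sub>R class_of p"
        using less.IH[of m] harmonic_class[OF p] Suc by simp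
      from riesz_conf[OF \<alpha> harmonic_poly_poly[OF p] this, of i]
      have *: "riesz \<alpha> ((real m - 1 + \<alpha> / 2) *\<^sub>R V - (real m + 4 - \<alpha> / 2) *\<^sub>R U)
        = mu \<alpha> m *\<^sub>R ((real m + 3 - \<alpha> / 2) *\<^sub>R V - (real m + \<alpha> / 2) *\<^sub>R U)"
      proof -
        have comb: "x *\<^sub>R V - y *\<^sub>R (U + V) - z *\<^sub>R (U + V) = (x - y - z) *\<^sub>R V - (y + z) *\<^sub>R U" for x y z
          by (simp add: algebra_simps)
        have 1: "class_of (conf i p) - (4 - \<alpha> / 2) *\<^sub>R coord_mult i (class_of p)
          = (real m - 1 + \<alpha> / 2) *\<^sub>R V - (real m + 4 - \<alpha> / 2) *\<^sub>R U"
          unfolding cf M comb by (intro arg_cong2[of _ _ _ _ minus] arg_cong2[of _ _ _ _ scaleR] refl) simp_all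
        have 2: "class_of (conf i p) - (\<alpha> / 2) *\<^sub>R coord_mult i (class_of p)
          = (real m + 3 - \<alpha> / 2) *\<^sub>R V - (real m + \<alpha> / 2) *\<^sub>R U"
          unfolding cf M comb by (intro arg_cong2[of _ _ _ _ minus] arg_cong2[of _ _ _ _ scaleR] refl) simp_all
        show "riesz \<alpha> (class_of (conf i p) - (4 - \<alpha> / 2) *\<^sub>R coord_mult i (class_of p))
          = mu \<alpha> m *\<^sub>R (class_of (conf i p) - (\<alpha> / 2) *\<^sub>R coord_mult i (class_of p)) \<Longrightarrow> ?thesis"
          unfolding 1 2 .
      qed
      \<comment> \<open>The terms in V cancel by \<open>RV\<close>, leaving an equation for U alone,
        with a positive factor.\<close>
      then have "(real m + 4 - \<alpha> / 2) *\<^sub>R riesz \<alpha> U = (mu \<alpha> m * (real m + \<alpha> / 2)) *\<^sub>R U"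
        by (simp add: lin RV scaleR_diff_right)
      also have "\<dots> = (real m + 4 - \<alpha> / 2) *\<^sub>R (mu \<alpha> k *\<^sub>R U)"
        using mu_Suc[OF \<alpha>, of m] Suc by (simp add: mult.commute)
      finally show ?thesis
        unfolding U_def by (rule scaleR_left_imp_eq[rotated]) (use \<alpha> in auto)
    qed
    \<comment> \<open>By Euler's identity a multiple of Y is the sum of the x_i d_i P. Its parts of
      degree m - 1 add up to a multiple of the Laplacian of P and vanish, so Y is a combination of
      lifts.\<close>
    have "real (Suc m) *\<^sub>R Y = (\<Sum>i\<in>UNIV. coord_mult i (class_of (pd i P)))"
      using euler_class[OF P(1)] P(2) by simp
    also have "\<dots> = (\<Sum>i\<in>UNIV. class_of (lift i m (pd i P)))
        + (1 / (2 * real m + 3)) *\<^sub>R (\<Sum>i\<in>UNIV. class_of (pd i (pd i P)))"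
      using coord_mult_harmonic[of m "pd i P" i for i] harmonic_poly_pd[OF P(1)]
      by (simp add: sum.distrib scaleR_sum_right)
    also have "(\<Sum>i\<in>UNIV. class_of (pd i (pd i P))) = 0"
    proof -
      have "square_integrable (pd i (pd i P))" for i
        by (intro poly_square_integrable poly_pd harmonic_poly_poly[OF P(1)])
      then have "(\<Sum>i\<in>UNIV. class_of (pd i (pd i P))) = class_of (\<lambda>x. \<Sum>i\<in>UNIV. pd i (pd i P) x)"
        using class_sum[of UNIV "\<lambda>i. pd i (pd i P)"] by simp
      also have "(\<lambda>x. \<Sum>i\<in>UNIV. pd i (pd i P) x) = (\<lambda>x. 0)"
        using P(1) by (simp add: harmonic_poly_def euclidean_laplacian_pd)
      finally show ?thesis by (simp only: class_zero)
    qed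
    finally have Y: "real (Suc m) *\<^sub>R Y = (\<Sum>i\<in>UNIV. class_of (lift i m (pd i P)))" by simp
    have "real (Suc m) *\<^sub>R riesz \<alpha> Y = riesz \<alpha> (real (Suc m) *\<^sub>R Y)" by (simp only: lin)
    also have "\<dots> = (\<Sum>i\<in>UNIV. riesz \<alpha> (class_of (lift i m (pd i P))))"
      unfolding Y by (simp only: lin)
    also have "\<dots> = (\<Sum>i\<in>UNIV. mu \<alpha> k *\<^sub>R class_of (lift i m (pd i P)))"
      using harmonic_poly_pd[OF P(1)] by (intro sum.cong lift) auto
    also have "\<dots> = mu \<alpha> k *\<^sub>R (real (Suc m) *\<^sub>R Y)"
      unfolding Y scaleR_sum_right ..
    also have "\<dots> = real (Suc m) *\<^sub>R (mu \<alpha> k *\<^sub>R Y)"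
      by (rule scaleR_left_commute)
    finally show ?thesis by (rule scaleR_left_imp_eq[rotated]) simp
  qed
qed

lemma proj_riesz:
  assumes \<alpha>: "0 < \<alpha>" "\<alpha> < 4"
  shows "S4.proj k (riesz \<alpha> \<Phi>) = mu \<alpha> k *\<^sub>R S4.proj k \<Phi>"
proof (rule S4.proj_eqI)
  show "mu \<alpha> k *\<^sub>R S4.proj k \<Phi> \<in> harmonics k"
    by (intro subspace_scale subspace_harmonics S4.proj_in)
  fix Z assume Z: "Z \<in> harmonics k"
  show "inner (riesz \<alpha> \<Phi>) Z = inner (mu \<alpha> k *\<^sub>R S4.proj k \<Phi>) Z"
    by (simp add: riesz_symmetric[OF \<alpha>] riesz_harmonics[OF \<alpha> Z] S4.inner_proj Z)
qed

section \<open>Spectrum of the linearized operator\<close>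

lemma lam_paneitz: "lam k * (lam k + 2) = real (k * (k + 1) * (k + 2) * (k + 3))"
  by (simp add: lam_def algebra_simps)

lemma kappa_eq:
  assumes \<alpha>: "0 < \<alpha>" "\<alpha> < 4"
  shows "kappa \<alpha> = 12 * (8 - \<alpha>) * (6 - \<alpha>) * (4 - \<alpha>) / pi\<^sup>2 * 2 powr (- (8 - \<alpha>))"
proof -
  have "C_const \<alpha> powr (8 - \<alpha>) = 12 * (8 - \<alpha>) * (6 - \<alpha>) * (4 - \<alpha>) / pi\<^sup>2"
    unfolding C_const_def using \<alpha> by (simp add: powr_powr)
  then show ?thesis by (simp add: kappa_def)
qed

lemma kappa_pos: "0 < \<alpha> \<Longrightarrow> \<alpha> < 4 \<Longrightarrow> 0 < kappa \<alpha>"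
  by (simp add: kappa_eq)

text \<open>The exponents combine to 2^(-4), and the denominator (2 - \<alpha>/2) (3 - \<alpha>/2)
  of the kernel mass cancels (4 - \<alpha>) (6 - \<alpha>) in \<open>kappa \<alpha>\<close> up to a
  factor 4, leaving 12 * 4 / 16 = 3 in front of 8 - \<alpha>.\<close>

lemma kappa_mu_0:
  assumes \<alpha>: "0 < \<alpha>" "\<alpha> < 4"
  shows "kappa \<alpha> * mu \<alpha> 0 = 3 * (8 - \<alpha>)"
proof -
  have p: "2 powr (- (8 - \<alpha>)) * 4 powr (2 - \<alpha> / 2) = 1 / (16::real)"
  proof -
    have "4 powr (2 - \<alpha> / 2) = (2::real) powr (4 - \<alpha>)"
      using powr_powr[of 2 2 "2 - \<alpha> / 2"] by (simp add: powr_numeral)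
    then have "2 powr (- (8 - \<alpha>)) * 4 powr (2 - \<alpha> / 2) = (2::real) powr (- 4)"
      using powr_add[of "2::real" "- (8 - \<alpha>)" "4 - \<alpha>"] by simp
    then show ?thesis by (simp add: powr_minus powr_numeral)
  qed
  have nz: "6 - \<alpha> \<noteq> 0" "4 - \<alpha> \<noteq> 0" using \<alpha> by auto
  have d: "(2 - \<alpha> / 2) * (3 - \<alpha> / 2) = (6 - \<alpha>) * (4 - \<alpha>) / 4" by (simp add: field_simps)
  have cancel: "c * A * B / P * p * (P * q / (A * B / 4)) = 4 * c * (p * q)"
    if "A \<noteq> 0" "B \<noteq> 0" "P \<noteq> 0" for c A B P p q :: real
    using that by (simp add: field_simps)
  have pi2: "pi\<^sup>2 \<noteq> 0" by simp
  show ?thesis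
    unfolding kappa_eq[OF \<alpha>] mu_0[OF \<alpha>] ker_mass_def d cancel[OF nz pi2] p by simp
qed

lemma mu_pos: "0 < \<alpha> \<Longrightarrow> \<alpha> < 4 \<Longrightarrow> 0 < mu \<alpha> k"
  unfolding mu_def by (intro divide_pos_pos mult_pos_pos Gamma_real_pos) auto

lemma mu_decreasing:
  assumes \<alpha>: "0 < \<alpha>" "\<alpha> < 4"
  shows "mu \<alpha> (Suc k) < mu \<alpha> k"
proof -
  have "(real k + 4 - \<alpha> / 2) * mu \<alpha> (Suc k) < (real k + 4 - \<alpha> / 2) * mu \<alpha> k"
    unfolding mu_Suc[OF \<alpha>] using \<alpha> mu_pos[OF \<alpha>, of k] by (intro mult_strict_right_mono) auto
  then show ?thesis using \<alpha> by simp
qed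

lemma Lambda_lam: "Lambda \<alpha> k = lam k * (lam k + 2) - kappa \<alpha> * (mu \<alpha> k + mu \<alpha> 0)"
  unfolding Lambda_def lam_paneitz ..

text \<open>The recursion gives (4 - \<alpha>/2) (mu_1 + mu_0) = 4 mu_0, and 12 (8 - \<alpha>) = 24
  (4 - \<alpha>/2).\<close>

lemma kappa_mu_1:
  assumes \<alpha>: "0 < \<alpha>" "\<alpha> < 4"
  shows "kappa \<alpha> * (mu \<alpha> 1 + mu \<alpha> 0) = 24"
proof -
  have "(4 - \<alpha> / 2) * mu \<alpha> 1 = (\<alpha> / 2) * mu \<alpha> 0"
    using mu_Suc[OF \<alpha>, of 0] by simp
  moreover have "d * (c * (x + y)) = 4 * (c * y)" if "d * x = (4 - d) * y" for c d x y :: real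
  proof -
    have "d * (c * (x + y)) = c * (d * x) + c * (d * y)" by (simp add: algebra_simps)
    then show ?thesis unfolding that by (simp add: algebra_simps)
  qed
  ultimately have "(4 - \<alpha> / 2) * (kappa \<alpha> * (mu \<alpha> 1 + mu \<alpha> 0)) = 4 * (kappa \<alpha> * mu \<alpha> 0)"
    by simp
  also have "\<dots> = (4 - \<alpha> / 2) * 24"
    unfolding kappa_mu_0[OF \<alpha>] by (simp add: field_simps)
  finally show ?thesis
    by (rule mult_left_cancel[THEN iffD1, rotated]) (use \<alpha> in auto)
qed

lemma Lambda_0: "0 < \<alpha> \<Longrightarrow> \<alpha> < 4 \<Longrightarrow> Lambda \<alpha> 0 = - 6 * (8 - \<alpha>)"
  using kappa_mu_0[of \<alpha>] by (simp add: Lambda_def distrib_left)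

lemma Lambda_1: "0 < \<alpha> \<Longrightarrow> \<alpha> < 4 \<Longrightarrow> Lambda \<alpha> 1 = 0"
  using kappa_mu_1[of \<alpha>] by (simp add: Lambda_def)

text \<open>Strictness comes from \<open>mu\<close>. It makes the eigenvalues distinct, so that no
  two spaces of harmonics merge into one eigenspace.\<close>

lemma Lambda_strict_mono:
  assumes \<alpha>: "0 < \<alpha>" "\<alpha> < 4"
  shows "strict_mono (Lambda \<alpha>)"
proof (rule strict_monoI_Suc)
  fix k
  have "kappa \<alpha> * (mu \<alpha> (Suc k) + mu \<alpha> 0) < kappa \<alpha> * (mu \<alpha> k + mu \<alpha> 0)"
    using mu_decreasing[OF \<alpha>, of k] kappa_pos[OF \<alpha>] by simp
  moreover have "real (k * (k + 1) * (k + 2) * (k + 3)) \<le> real (Suc k * (Suc k + 1) * (Suc k + 2) * (Suc k + 3))"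
    unfolding of_nat_le_iff by (intro mult_le_mono) auto
  ultimately show "Lambda \<alpha> k < Lambda \<alpha> (Suc k)" unfolding Lambda_def by linarith
qed

lemma kappa_mu_le:
  assumes \<alpha>: "0 < \<alpha>" "\<alpha> < 4"
  shows "k \<ge> 1 \<Longrightarrow> kappa \<alpha> * (mu \<alpha> k + mu \<alpha> 0) \<le> 24"
proof (induction k rule: dec_induct)
  case base
  then show ?case using kappa_mu_1[OF \<alpha>] by simp
next
  case (step k)
  have "kappa \<alpha> * (mu \<alpha> (Suc k) + mu \<alpha> 0) \<le> kappa \<alpha> * (mu \<alpha> k + mu \<alpha> 0)"
    using mu_decreasing[OF \<alpha>, of k] kappa_pos[OF \<alpha>] by simp
  with step show ?case by simp
qed

lemma lam_mono: "i \<le> k \<Longrightarrow> lam i \<le> lam k"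
  unfolding lam_def of_nat_le_iff by (intro mult_le_mono) auto

lemma lam_ge_10: "k \<ge> 2 \<Longrightarrow> 10 \<le> lam k"
  using lam_mono[of 2 k] by (simp add: lam_def)

text \<open>From degree 2 on, \<open>lam k * (lam k + 2)\<close> is at least 10 * 12 = 120, of which
  the subtracted 24 is one fifth.\<close>

lemma Lambda_ge:
  assumes \<alpha>: "0 < \<alpha>" "\<alpha> < 4" and k: "k \<ge> 2"
  shows "4 / 5 * (lam k * (lam k + 2)) \<le> Lambda \<alpha> k"
proof -
  have "10 * 12 \<le> lam k * (lam k + 2)"
    using lam_ge_10[OF k] by (intro mult_mono) auto
  then show ?thesis
    using kappa_mu_le[OF \<alpha>, of k] k unfolding Lambda_lam by simp
qed

section \<open>The linearized operator as a multiplier\<close>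

lemma proj_L_op:
  assumes \<alpha>: "0 < \<alpha>" "\<alpha> < 4" and \<Phi>: "\<Phi> \<in> sobolev 4"
  shows "S4.proj k (L_op \<alpha> \<Phi>) = Lambda \<alpha> k *\<^sub>R S4.proj k \<Phi>"
  by (simp add: L_op_def S4.proj_diff S4.proj_add S4.proj_scaleR proj_paneitz[OF \<Phi>] proj_riesz[OF \<alpha>]
      Lambda_lam scaleR_diff_left scaleR_add_left[symmetric])

text \<open>Both multipliers grow like \<open>(lam k)\<^sup>2\<close>. The constant 25 covers k <=
  1, where \<open>lam k\<close> is at most 4; the constant 48 bounds kappa (mu_k + mu_0), whose
  largest value 6 (8 - \<alpha>) is taken in degree 0.\<close>

lemma diag_dom_Lambda:
  assumes \<alpha>: "0 < \<alpha>" "\<alpha> < 4"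
  shows "S4.diag_dom (Lambda \<alpha>) = sobolev 4"
  unfolding sobolev_4
proof (intro equalityI S4.diag_dom_mono)
  fix k
  show "\<bar>(1 + lam k)\<^sup>2\<bar> \<le> 25 * (\<bar>Lambda \<alpha> k\<bar> + 1)"
  proof (cases "k \<ge> 2")
    case True
    have "(1 + lam k)\<^sup>2 = lam k * (lam k + 2) + 1" by (simp add: power2_eq_square algebra_simps)
    then show ?thesis using Lambda_ge[OF \<alpha> True] by simp
  next
    case False
    then have "lam k \<le> 4" using lam_mono[of k 1] by (simp add: lam_def)
    then have "(1 + lam k)\<^sup>2 \<le> 5\<^sup>2" by (intro power_mono) auto
    then show ?thesis by simp
  qed
  have "0 < kappa \<alpha> * mu \<alpha> k" using kappa_pos[OF \<alpha>] mu_pos[OF \<alpha>] by simp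
  moreover have "kappa \<alpha> * (mu \<alpha> k + mu \<alpha> 0) \<le> 48"
  proof (cases k)
    case 0
    then show ?thesis using kappa_mu_0[OF \<alpha>] \<alpha> by (simp add: distrib_left)
  next
    case (Suc n)
    then show ?thesis using kappa_mu_le[OF \<alpha>, of k] by simp
  qed
  moreover have "0 \<le> kappa \<alpha> * (mu \<alpha> k + mu \<alpha> 0)"
    using kappa_pos[OF \<alpha>] mu_pos[OF \<alpha>, of k] mu_pos[OF \<alpha>, of 0] by simp
  moreover have "(1 + lam k)\<^sup>2 = lam k * (lam k + 2) + 1" by (simp add: power2_eq_square algebra_simps)
  moreover have "0 \<le> lam k * (lam k + 2)" by simp
  moreover have "\<bar>y - x\<bar> \<le> 48 * (\<bar>z\<bar> + 1)" if "x \<le> 48" "0 \<le> x" "z = y + 1" "0 \<le> y" for x y z :: real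
    using that by (auto simp: abs_le_iff)
  ultimately show "\<bar>Lambda \<alpha> k\<bar> \<le> 48 * (\<bar>(1 + lam k)\<^sup>2\<bar> + 1)"
    unfolding Lambda_lam by blast
qed

lemma diag_operator_L_op:
  assumes \<alpha>: "0 < \<alpha>" "\<alpha> < 4"
  shows "diag_operator harmonics (Lambda \<alpha>) (L_op \<alpha>)"
  by unfold_locales (simp add: diag_dom_Lambda[OF \<alpha>] proj_L_op[OF \<alpha>])

text \<open>The gap around the kernel: degree 0 lies below -24, and the degrees from 2 on are at
  least 96.\<close>

lemma Lambda_abs_ge_1:
  assumes \<alpha>: "0 < \<alpha>" "\<alpha> < 4" and k: "k \<noteq> 1"
  shows "1 \<le> \<bar>Lambda \<alpha> k\<bar>"
proof (cases "k = 0")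
  case True
  then show ?thesis using Lambda_0[OF \<alpha>] \<alpha> by simp
next
  case False
  then have k: "k \<ge> 2" using k by simp
  have "10 * 12 \<le> lam k * (lam k + 2)"
    using lam_ge_10[OF k] by (intro mult_mono) auto
  then show ?thesis using Lambda_ge[OF \<alpha> k] by simp
qed

lemma sobolev_weight_le:
  assumes \<alpha>: "0 < \<alpha>" "\<alpha> < 4" and k: "k \<noteq> 1"
  shows "(\<Sum>n\<le>4. lam k ^ n) \<le> (3 * Lambda \<alpha> k)\<^sup>2"
proof (cases "k = 0")
  case True
  have "1\<^sup>2 \<le> (3 * (6 * (8 - \<alpha>)))\<^sup>2" using \<alpha> by (intro power_mono) auto
  also have "\<dots> = (3 * Lambda \<alpha> 0)\<^sup>2"
    unfolding Lambda_0[OF \<alpha>] by (simp add: power2_eq_square algebra_simps)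
  finally show ?thesis using True by (simp add: numeral_eq_Suc)
next
  case False
  then have k: "k \<ge> 2" using k by simp
  note l10 = lam_ge_10[OF k]
  have "lam k ^ n \<le> lam k ^ 4" if "n \<le> 4" for n
    using that l10 by (intro power_increasing) auto
  then have "(\<Sum>n\<le>4. lam k ^ n) \<le> (\<Sum>n\<le>(4::nat). lam k ^ 4)" by (intro sum_mono) auto
  also have "\<dots> = 5 * lam k ^ 4" by simp
  \<comment> \<open>The origin of the constant 3: the five powers are each at most the fourth, and 5
    is below 144/25, the square of 3 times 4/5. Nothing in this depends on \<alpha>.\<close>
  also have "\<dots> \<le> 144 / 25 * lam k ^ 4" by simp
  also have "\<dots> = (3 * (4 / 5 * (lam k * lam k)))\<^sup>2"
    by (simp add: power_mult_distrib power2_eq_square power4_eq_xxxx)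
  also have "\<dots> \<le> (3 * Lambda \<alpha> k)\<^sup>2"
  proof (intro power_mono mult_left_mono)
    have "lam k * lam k \<le> lam k * (lam k + 2)" by (intro mult_left_mono) auto
    then show "4 / 5 * (lam k * lam k) \<le> Lambda \<alpha> k"
      using Lambda_ge[OF \<alpha> k] by simp
  qed auto
  finally show ?thesis .
qed

text \<open>Parseval for both norms reduces the estimate to the weights; degree 1, where the
  eigenvalue vanishes, is removed by the orthogonality.\<close>

lemma sobolev_estimate:
  assumes \<alpha>: "0 < \<alpha>" "\<alpha> < 4" and \<Phi>: "\<Phi> \<in> sobolev 4" "\<Phi> \<in> orthogonal_comp (harmonics 1)"
  shows "sobolev_norm 4 \<Phi> \<le> 3 * norm (L_op \<alpha> \<Phi>)"
proof -
  have "sobolev_norm_sq 4 \<Phi> \<le> 9 * (norm (L_op \<alpha> \<Phi>))\<^sup>2"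
  proof (rule sums_le[OF _ sobolev_norm_sq_sums[OF \<Phi>(1)] sums_mult[OF S4.norm_sums]])
    fix k
    show "(\<Sum>n\<le>4. lam k ^ n) * (norm (S4.proj k \<Phi>))\<^sup>2 \<le> 9 * (norm (S4.proj k (L_op \<alpha> \<Phi>)))\<^sup>2"
    proof (cases "k = 1")
      case True
      then show ?thesis using \<Phi>(2) unfolding S4.orthogonal_comp_iff by simp
    next
      case False
      show ?thesis
        using mult_right_mono[OF sobolev_weight_le[OF \<alpha> False], of "(norm (S4.proj k \<Phi>))\<^sup>2"]
        by (simp add: proj_L_op[OF \<alpha> \<Phi>(1)] power_mult_distrib)
    qed
  qed
  then have "sobolev_norm_sq 4 \<Phi> \<le> (3 * norm (L_op \<alpha> \<Phi>))\<^sup>2"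
    by (simp add: power_mult_distrib)
  from real_sqrt_le_mono[OF this] show ?thesis
    unfolding sobolev_norm_def real_sqrt_abs by simp
qed

text \<open>The two forms are compared degree by degree; the degrees 0 and 1, where the eigenvalue
  is not positive, are absent from \<open>\<Phi>\<close>.\<close>

lemma coercivity:
  assumes \<alpha>: "0 < \<alpha>" "\<alpha> < 4" and \<Phi>: "\<Phi> \<in> sobolev 2"
    and orth: "\<Phi> \<in> orthogonal_comp {Y + Z |Y Z. Y \<in> harmonics 0 \<and> Z \<in> harmonics 1}"
  shows "4 / 5 * paneitz_form \<Phi> \<le> L_form \<alpha> \<Phi>"
proof -
  have "harmonics 0 \<subseteq> {Y + Z |Y Z. Y \<in> harmonics 0 \<and> Z \<in> harmonics 1}"
    "harmonics 1 \<subseteq> {Y + Z |Y Z. Y \<in> harmonics 0 \<and> Z \<in> harmonics 1}"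
    using S4.zero_H[of 0] S4.zero_H[of 1] by force+
  then have "\<Phi> \<in> orthogonal_comp (harmonics 0)" "\<Phi> \<in> orthogonal_comp (harmonics 1)"
    using orth orthogonal_comp_anti_mono by blast+
  then have zero: "S4.proj 0 \<Phi> = 0" "S4.proj 1 \<Phi> = 0"
    unfolding S4.orthogonal_comp_iff by auto
  have "(\<lambda>k. lam k * (lam k + 2) * (norm (S4.proj k \<Phi>))\<^sup>2
      - kappa \<alpha> * (inner (S4.proj k (riesz \<alpha> \<Phi>)) (S4.proj k \<Phi>) + mu \<alpha> 0 * inner (S4.proj k \<Phi>) (S4.proj k \<Phi>)))
    sums L_form \<alpha> \<Phi>"
    unfolding L_form_def
    by (intro sums_diff sums_mult sums_add paneitz_form_sums \<Phi> S4.inner_sums)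
  moreover have "lam k * (lam k + 2) * (norm (S4.proj k \<Phi>))\<^sup>2
      - kappa \<alpha> * (inner (S4.proj k (riesz \<alpha> \<Phi>)) (S4.proj k \<Phi>) + mu \<alpha> 0 * inner (S4.proj k \<Phi>) (S4.proj k \<Phi>))
      = Lambda \<alpha> k * (norm (S4.proj k \<Phi>))\<^sup>2" for k
    unfolding Lambda_lam proj_riesz[OF \<alpha>] inner_scaleR_left power2_norm_eq_inner by (simp add: algebra_simps)
  ultimately have L: "(\<lambda>k. Lambda \<alpha> k * (norm (S4.proj k \<Phi>))\<^sup>2) sums L_form \<alpha> \<Phi>" by simp
  show ?thesis
  proof (rule sums_le[OF _ sums_mult[OF paneitz_form_sums[OF \<Phi>]] L])
    fix k :: nat
    consider "k = 0" | "k = 1" | "k \<ge> 2" by linarith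
    then show "4 / 5 * (lam k * (lam k + 2) * (norm (S4.proj k \<Phi>))\<^sup>2) \<le> Lambda \<alpha> k * (norm (S4.proj k \<Phi>))\<^sup>2"
    proof cases
      case 3
      show ?thesis
        using mult_right_mono[OF Lambda_ge[OF \<alpha> 3], of "(norm (S4.proj k \<Phi>))\<^sup>2"] by simp
    qed (use zero in auto)
  qed
qed

lemma dim_harmonics_0: "dim (harmonics 0) = 1"
proof -
  have "independent {class_of (\<lambda>x. 1)}" using one_neq_zero by simp
  then show ?thesis
    unfolding harmonics_0 dim_span by (simp add: dim_eq_card_independent)
qed

lemma morse_index_L_op:
  assumes \<alpha>: "0 < \<alpha>" "\<alpha> < 4"
  shows "morse_index (sobolev 4) (L_op \<alpha>) = 1"
proof -
  interpret L: diag_operator harmonics "Lambda \<alpha>" "L_op \<alpha>" by (rule diag_operator_L_op[OF \<alpha>])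
  note D = diag_dom_Lambda[OF \<alpha>]
  have inj: "inj (Lambda \<alpha>)" using Lambda_strict_mono[OF \<alpha>] by (rule strict_mono_imp_inj_on)
  have E: "eigenspace (sobolev 4) (L_op \<alpha>) (Lambda \<alpha> k) = harmonics k" for k
    using L.eigenspace_T[OF inj] unfolding D .
  \<comment> \<open>Strict monotonicity and the zero in degree 1 leave degree 0 as the only negative
    one.\<close>
  have neg: "Lambda \<alpha> k < 0 \<longleftrightarrow> k = 0" for k
    using strict_mono_less[OF Lambda_strict_mono[OF \<alpha>], of k 1] Lambda_1[OF \<alpha>] by auto
  have ev: "eigenvalue (sobolev 4) (L_op \<alpha>) (Lambda \<alpha> 0)"
    unfolding eigenvalue_def E using harmonics_nontrivial[of 0] by blast
  have range: "l \<in> range (Lambda \<alpha>)" if "eigenvalue (sobolev 4) (L_op \<alpha>) l" for l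
    using L.eigenvalue_T[of l] that unfolding D by simp
  have N: "{l. l < 0 \<and> eigenvalue (sobolev 4) (L_op \<alpha>) l} = {Lambda \<alpha> 0}"
  proof (intro equalityI subsetI)
    fix l assume l: "l \<in> {l. l < 0 \<and> eigenvalue (sobolev 4) (L_op \<alpha>) l}"
    then obtain k where "l = Lambda \<alpha> k" using range by blast
    then show "l \<in> {Lambda \<alpha> 0}" using l neg by simp
  qed (use neg ev in auto)
  have "\<exists>B. finite B \<and> span B = eigenspace (sobolev 4) (L_op \<alpha>) (Lambda \<alpha> 0)"
    unfolding E harmonics_0 by blast
  then show ?thesis
    unfolding morse_index_def N Let_def by (simp add: E dim_harmonics_0 one_enat_def)
qed

theorem theorem1p2:
  shows "(\<forall>\<alpha>. 0 < \<alpha> \<and> \<alpha> < 4 \<longrightarrow>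
      self_adjoint (sobolev 4) (L_op \<alpha>) \<and>
      compact_resolvent (sobolev 4) (L_op \<alpha>) \<and>
      (\<forall>k. eigenvalue (sobolev 4) (L_op \<alpha>) (Lambda \<alpha> k) \<and>
           eigenspace (sobolev 4) (L_op \<alpha>) (Lambda \<alpha> k) = harmonics k) \<and>
      Lambda \<alpha> 0 = - 6 * (8 - \<alpha>) \<and>
      Lambda \<alpha> 1 = 0 \<and>
      (\<forall>k\<ge>2. Lambda \<alpha> k \<ge> 4 / 5 * real (k * (k + 1) * (k + 2) * (k + 3)) \<and>
              4 / 5 * real (k * (k + 1) * (k + 2) * (k + 3)) > 0) \<and>
      morse_index (sobolev 4) (L_op \<alpha>) = 1 \<and>
      operator_kernel (sobolev 4) (L_op \<alpha>) = harmonics 1 \<and>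
      harmonics 1 = span (range (\<lambda>i. class_of (\<lambda>x. x $ i))) \<and>
      (\<forall>\<Phi>\<in>sobolev 2. \<Phi> \<in> orthogonal_comp {Y + Z |Y Z. Y \<in> harmonics 0 \<and> Z \<in> harmonics 1} \<longrightarrow>
           L_form \<alpha> \<Phi> \<ge> 4 / 5 * paneitz_form \<Phi>) \<and>
      bij_betw (L_op \<alpha>) (sobolev 4 \<inter> orthogonal_comp (harmonics 1)) (orthogonal_comp (harmonics 1))) \<and>
    (\<exists>C>0. \<forall>\<alpha>. 0 < \<alpha> \<and> \<alpha> < 4 \<longrightarrow>
      (\<forall>\<Phi>\<in>sobolev 4 \<inter> orthogonal_comp (harmonics 1).
         sobolev_norm 4 \<Phi> \<le> C * norm (L_op \<alpha> \<Phi>)))"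
proof (intro conjI allI impI)
  fix \<alpha> :: real assume "0 < \<alpha> \<and> \<alpha> < 4"
  then have \<alpha>: "0 < \<alpha>" "\<alpha> < 4" by auto
  interpret L: diag_operator harmonics "Lambda \<alpha>" "L_op \<alpha>" by (rule diag_operator_L_op[OF \<alpha>])
  note D = diag_dom_Lambda[OF \<alpha>]
  have inj: "inj (Lambda \<alpha>)" using Lambda_strict_mono[OF \<alpha>] by (rule strict_mono_imp_inj_on)
  have E: "eigenspace (sobolev 4) (L_op \<alpha>) (Lambda \<alpha> k) = harmonics k" for k
    using L.eigenspace_T[OF inj] unfolding D .
  show "self_adjoint (sobolev 4) (L_op \<alpha>)"
    using L.self_adjoint_T unfolding D .
  show "compact_resolvent (sobolev 4) (L_op \<alpha>)"
    unfolding D[symmetric]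
  proof (rule L.compact_resolvent_T)
    show "Lambda \<alpha> 0 \<le> Lambda \<alpha> k" for k
      using strict_mono_less_eq[OF Lambda_strict_mono[OF \<alpha>]] by simp
    show "filterlim (Lambda \<alpha>) at_top sequentially"
    \<comment> \<open>From degree 2 on the eigenvalue is at least 4/5 times
      \<open>12 * lam k\<close>, and \<open>lam k\<close> is at least k.\<close>
    proof (rule filterlim_at_top_mono[OF filterlim_real_sequentially])
      show "\<forall>\<^sub>F k in sequentially. real k \<le> Lambda \<alpha> k"
        using eventually_ge_at_top[of 2]
      proof eventually_elim
        case (elim k)
        have "real k \<le> lam k" unfolding lam_def of_nat_le_iff by simp
        moreover have "lam k * 12 \<le> lam k * (lam k + 2)"
          using lam_ge_10[OF elim] by (intro mult_left_mono) auto
        ultimately show ?case using Lambda_ge[OF \<alpha> elim] lam_nonneg[of k] by linarith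
      qed
    qed
  qed
  fix k
  show "eigenspace (sobolev 4) (L_op \<alpha>) (Lambda \<alpha> k) = harmonics k" by (rule E)
  show "eigenvalue (sobolev 4) (L_op \<alpha>) (Lambda \<alpha> k)"
    unfolding eigenvalue_def E using harmonics_nontrivial[of k] by blast
next
  fix \<alpha> :: real assume "0 < \<alpha> \<and> \<alpha> < 4"
  then have \<alpha>: "0 < \<alpha>" "\<alpha> < 4" by auto
  interpret L: diag_operator harmonics "Lambda \<alpha>" "L_op \<alpha>" by (rule diag_operator_L_op[OF \<alpha>])
  note D = diag_dom_Lambda[OF \<alpha>]
  show "Lambda \<alpha> 0 = - 6 * (8 - \<alpha>)" by (rule Lambda_0[OF \<alpha>])
  show "Lambda \<alpha> 1 = 0" by (rule Lambda_1[OF \<alpha>])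
  show "morse_index (sobolev 4) (L_op \<alpha>) = 1" by (rule morse_index_L_op[OF \<alpha>])
  have inj: "inj (Lambda \<alpha>)" using Lambda_strict_mono[OF \<alpha>] by (rule strict_mono_imp_inj_on)
  have "operator_kernel (sobolev 4) (L_op \<alpha>) = eigenspace (sobolev 4) (L_op \<alpha>) (Lambda \<alpha> 1)"
    by (simp add: operator_kernel_def eigenspace_def Lambda_1[OF \<alpha>, simplified])
  then show "operator_kernel (sobolev 4) (L_op \<alpha>) = harmonics 1"
    using L.eigenspace_T[OF inj, of 1] unfolding D by simp
  show "harmonics 1 = span (range (\<lambda>i. class_of (\<lambda>x. x $ i)))" by (rule harmonics_1)
  show "\<forall>\<Phi>\<in>sobolev 2. \<Phi> \<in> orthogonal_comp {Y + Z |Y Z. Y \<in> harmonics 0 \<and> Z \<in> harmonics 1} \<longrightarrow>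
      4 / 5 * paneitz_form \<Phi> \<le> L_form \<alpha> \<Phi>"
    using coercivity[OF \<alpha>] by blast
  have "bij_betw (L_op \<alpha>) {x \<in> sobolev 4. \<forall>k\<in>{1}. S4.proj k x = 0} {x. \<forall>k\<in>{1}. S4.proj k x = 0}"
    using L.bij_betw_T[of "{1}" 1] Lambda_abs_ge_1[OF \<alpha>] unfolding D by simp
  moreover have "{x \<in> sobolev 4. \<forall>k\<in>{1}. S4.proj k x = 0} = sobolev 4 \<inter> orthogonal_comp (harmonics 1)"
    "{x. \<forall>k\<in>{1}. S4.proj k x = 0} = orthogonal_comp (harmonics 1)"
    using S4.orthogonal_comp_iff[of _ 1] by auto
  ultimately show "bij_betw (L_op \<alpha>) (sobolev 4 \<inter> orthogonal_comp (harmonics 1)) (orthogonal_comp (harmonics 1))"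
    by simp
  fix k :: nat assume k: "2 \<le> k"
  show "4 / 5 * real (k * (k + 1) * (k + 2) * (k + 3)) \<le> Lambda \<alpha> k"
    using Lambda_ge[OF \<alpha> k] unfolding lam_paneitz .
  have "0 < k * (k + 1) * (k + 2) * (k + 3)" using k by simp
  then have "0 < real (k * (k + 1) * (k + 2) * (k + 3))" by (simp only: of_nat_0_less_iff)
  then show "0 < 4 / 5 * real (k * (k + 1) * (k + 2) * (k + 3))"
    by (rule mult_pos_pos[rotated]) simp
next
  show "\<exists>C>0. \<forall>\<alpha>. 0 < \<alpha> \<and> \<alpha> < 4 \<longrightarrow>
      (\<forall>\<Phi>\<in>sobolev 4 \<inter> orthogonal_comp (harmonics 1).
         sobolev_norm 4 \<Phi> \<le> C * norm (L_op \<alpha> \<Phi>))"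
    using sobolev_estimate by (intro exI[of _ 3]) auto
qed

end
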